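(* Let $c:\mathsf{X}\times\mathsf{Y}\to[0,\infty)$ be continuous, let $\varepsilon>0$ and let $(\mu,\nu)\in\mathcal{P}(\mathsf{X})\times\mathcal{P}(\mathsf{Y})$. There exists a unique coupling $\pi\in\Pi(\mu,\nu)$ that is $(c,\varepsilon)$-cyclically invariant. If the entropic optimal transport problem $$\inf_{\pi'\in\Pi(\mu,\nu)} \int_{\mathsf{X}\times\mathsf{Y}} c \,d\pi' + \varepsilon H(\pi'|\mu\otimes\nu)$$ is finite, then $\pi$ is its unique minimizer.
   Context: $(\mathsf{X},d)$ and $(\mathsf{Y},d)$ are complete separable metric spaces; $\mathsf{X}\times\mathsf{Y}$ carries the metric $d((x,y),(x',y'))=\max\{d(x,x'),d(y,y')\}$. $\mathcal{P}(\cdot)$ denotes the Borel probability measures, $\Pi(\mu,\nu)$ the set of couplings, i.e. probability measures on $\mathsf{X}\times\mathsf{Y}$ with first marginal $\mu$ and second marginal $\nu$. $B_r(x)$ is the open ball of radius $r$ around $x$. Standing assumption (differentiation of measures): given $\rho,\lambda\in\mathcal{P}(\mathsf{X})$ with $\rho\ll\lambda$, there exists $\mathsf{X}'\subset\mathsf{X}$ of full $\lambda$-measure such that $f(x):=\lim_{r\to0}\rho(B_r(x))/\lambda(B_r(x))$, $x\in\mathsf{X}'$, defines a version of the Radon–Nikodym density $d\rho/d\lambda$. The analogous property is assumed on $\mathsf{X}\times\mathsf{Y}$. Relative entropy: $H(\pi|P):=\int\log(\frac{d\pi}{dP})\,d\pi$ if $\pi\ll P$ and $H(\pi|P):=\infty$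 otherwise. The minimization problem is called finite if its value is finite, i.e. if there exists $\pi_0\in\Pi(\mu,\nu)$ with $\int c\,d\pi_0+H(\pi_0|\mu\otimes\nu)<\infty$. Definition: with $P:=\mu\otimes\nu$, a coupling $\pi\in\Pi(\mu,\nu)$ is $(c,\varepsilon)$-cyclically invariant if $\pi\sim P$ (mutually absolutely continuous) and its density admits a version $d\pi/dP:\mathsf{X}\times\mathsf{Y}\to(0,\infty)$ such that $$\prod_{i=1}^{k} \frac{d\pi}{dP}(x_{i},y_{i})=\exp\bigg(-\frac{1}{\varepsilon}\bigg[\sum_{i=1}^{k} c(x_{i},y_{i}) - \sum_{i=1}^{k} c(x_{i},y_{i+1})\bigg]\bigg)\prod_{i=1}^{k} \frac{d\pi}{dP}(x_{i},y_{i+1})$$ for all $k\in\mathbb{N}$ and $(x_i,y_i)_{i=1}^k\subset\mathsf{X}\times\mathsf{Y}$, where $y_{k+1}:=y_1$. *)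

theory Defs
  imports "HOL-Probability.Probability"
begin

definition prob_measures :: "'a::topological_space measure set" where
  "prob_measures = {M. sets M = sets borel \<and> prob_space M}"

definition couplings ::
  "'a::topological_space measure \<Rightarrow> 'b::topological_space measure \<Rightarrow> ('a \<times> 'b) measure set" where
  "couplings \<mu> \<nu> = {\<pi> \<in> prob_measures. distr \<pi> borel fst = \<mu> \<and> distr \<pi> borel snd = \<nu>}"

(* The library metric on products is the Euclidean combination of the factor metrics;
   the metric intended here is the maximum. Both induce the product topology. *)
definition max_dist :: "'a::metric_space \<times> 'b::metric_space \<Rightarrow> 'a \<times> 'b \<Rightarrow> real" where
  "max_dist z z' = max (dist (fst z) (fst z')) (dist (snd z) (snd z'))"

(* The metric d is a parameter, so that the property can be stated for max_dist.
   Positivity of the denominator makes the quotients meaningful on S, instead of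
   relying on x / 0 = 0.  Outside S the values of f are irrelevant. *)
definition differentiation_of_measures :: "('a::topological_space \<Rightarrow> 'a \<Rightarrow> real) \<Rightarrow> bool" where
  "differentiation_of_measures d \<longleftrightarrow>
     (\<forall>\<rho> \<in> prob_measures. \<forall>\<kappa> \<in> prob_measures. absolutely_continuous \<kappa> \<rho> \<longrightarrow>
       (\<exists>S \<in> sets borel. \<exists>f \<in> borel_measurable borel.
          measure \<kappa> S = 1 \<and>
          (\<forall>x \<in> S. (\<forall>r > 0. measure \<kappa> {y. d x y < r} > 0) \<and>
            ((\<lambda>r. measure \<rho> {y. d x y < r} / measure \<kappa> {y. d x y < r}) \<longlongrightarrow> f x) (at_right 0)) \<and>
          density \<kappa> (\<lambda>x. ennreal (f x)) = \<rho>))"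

definition extended_integral :: "'a measure \<Rightarrow> ('a \<Rightarrow> real) \<Rightarrow> ereal" where
  "extended_integral M g =
     enn2ereal (\<integral>\<^sup>+ x. ennreal (g x) \<partial>M) - enn2ereal (\<integral>\<^sup>+ x. ennreal (- g x) \<partial>M)"

(* KL_divergence of the library is a real-valued Bochner integral, hence 0 when the
   log-density is not integrable; here that case has to yield infinity.  The negative part
   is always integrable for probability measures, so the difference defining
   extended_integral is never of the form infinity - infinity. *)
definition relative_entropy :: "'a measure \<Rightarrow> 'a measure \<Rightarrow> ereal" where
  "relative_entropy \<pi> P =
     (if absolutely_continuous P \<pi>
      then extended_integral \<pi> (\<lambda>z. ln (enn2real (RN_deriv P \<pi> z)))
      else \<infinity>)"

(* The last conjunct encodes y_(k+1) = y_1 by quantifying over sequences subject to this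
   constraint; only the entries with indices 1, ..., k matter otherwise. *)
definition cyclically_invariant ::
  "('a::topological_space \<times> 'b::topological_space \<Rightarrow> real) \<Rightarrow> real \<Rightarrow>
   'a measure \<Rightarrow> 'b measure \<Rightarrow> ('a \<times> 'b) measure \<Rightarrow> bool" where
  "cyclically_invariant c \<epsilon> \<mu> \<nu> \<pi> \<longleftrightarrow>
     absolutely_continuous (\<mu> \<Otimes>\<^sub>M \<nu>) \<pi> \<and> absolutely_continuous \<pi> (\<mu> \<Otimes>\<^sub>M \<nu>) \<and>
     (\<exists>f \<in> borel_measurable (\<mu> \<Otimes>\<^sub>M \<nu>).
        (\<forall>z. 0 < f z) \<and>
        density (\<mu> \<Otimes>\<^sub>M \<nu>) (\<lambda>z. ennreal (f z)) = \<pi> \<and>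
        (\<forall>k \<ge> 1. \<forall>(x :: nat \<Rightarrow> 'a) (y :: nat \<Rightarrow> 'b). y (k + 1) = y 1 \<longrightarrow>
           (\<Prod>i = 1..k. f (x i, y i)) =
             exp (- (1 / \<epsilon>) * ((\<Sum>i = 1..k. c (x i, y i)) - (\<Sum>i = 1..k. c (x i, y (i + 1)))))
             * (\<Prod>i = 1..k. f (x i, y (i + 1)))))"

definition eot_cost ::
  "('a::topological_space \<times> 'b::topological_space \<Rightarrow> real) \<Rightarrow> real \<Rightarrow>
   'a measure \<Rightarrow> 'b measure \<Rightarrow> ('a \<times> 'b) measure \<Rightarrow> ereal" where
  "eot_cost c \<epsilon> \<mu> \<nu> \<pi> =
     enn2ereal (\<integral>\<^sup>+ z. ennreal (c z) \<partial>\<pi>) + ereal \<epsilon> * relative_entropy \<pi> (\<mu> \<Otimes>\<^sub>M \<nu>)"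

definition eot_value ::
  "('a::topological_space \<times> 'b::topological_space \<Rightarrow> real) \<Rightarrow> real \<Rightarrow>
   'a measure \<Rightarrow> 'b measure \<Rightarrow> ereal" where
  "eot_value c \<epsilon> \<mu> \<nu> = (INF \<pi> \<in> couplings \<mu> \<nu>. eot_cost c \<epsilon> \<mu> \<nu> \<pi>)"

definition eot_minimizer ::
  "('a::topological_space \<times> 'b::topological_space \<Rightarrow> real) \<Rightarrow> real \<Rightarrow>
   'a measure \<Rightarrow> 'b measure \<Rightarrow> ('a \<times> 'b) measure \<Rightarrow> bool" where
  "eot_minimizer c \<epsilon> \<mu> \<nu> \<pi> \<longleftrightarrow>
     \<pi> \<in> couplings \<mu> \<nu> \<and> eot_cost c \<epsilon> \<mu> \<nu> \<pi> = eot_value c \<epsilon> \<mu> \<nu>"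

end

theory Submission
  imports Defs "HOL-Complex_Analysis.Great_Picard"
begin

text \<open>
  Put K = exp (- c / \<epsilon>) and P = \<mu> \<Otimes> \<nu>. The identity for cycles of length two makes the quotient of the
  density by K multiplicatively separable, so the cyclically invariant couplings are exactly the
  couplings with a density of the form \<phi> x * \<psi> y * K (x, y), where \<phi> and \<psi> are positive and
  measurable (cyclically_invariant_iff_product_form). What has to be shown is therefore that exactly
  one such coupling exists, and that it minimizes the cost whenever some coupling has finite cost.

  The difficulty throughout is that ln \<phi> and ln \<psi> need not be integrable, so that the marginal
  constraints cannot be applied to them directly. They can be applied to bounded functions of \<phi> and
  of \<psi>. For uniqueness (product_form_coupling_unique), two product densities have a ratio r x * s y;
  integrating arctan (ln r) + arctan (ln s), which has the sign of ln (r * s), against the difference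
  of the two couplings gives zero and forces r * s = 1. For optimality (product_form_coupling_optimal),
  ln \<phi> and ln \<psi> are truncated at level n, the Young inequality for t ln t is integrated, and n
  tends to infinity with the help of Fatou's lemma.

  Existence has to cover the case in which every coupling has infinite cost, so it cannot be obtained
  by minimization. It rests on three observations. First, a slightly perturbed version of the two
  marginal equations is solved by a monotone iteration for any positive kernel bounded by 1
  (perturbed_schroedinger_system). Second, a continuous positive kernel on Polish spaces satisfies
  A x * B y \<le> K (x, y) with A, B positive almost everywhere, because \<mu> and \<nu> are carried by countable
  unions of compact sets (product_lower_bound); under such a bound the suitably normalized functions
  A * \<phi> and B * \<psi> are bounded independently of the perturbation (approximate_coupling). Third, bounded
  sequences have weakly convergent subsequences, and the weak limits of the two factors may be
  multiplied (bounded_sequence_weak_limit, weak_limit_product). Letting the perturbation tend to zero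
  yields the coupling (product_form_coupling_exists).
\<close>

section \<open>Cyclical invariance and product densities\<close>

text \<open>
  With g = f * exp (c / \<epsilon>) the identity for the cycle through (x, y) and a base point (x0, y0) reads
  g (x, y) * g (x0, y0) = g (x, y0) * g (x0, y), so the two sections of g through the base point
  determine g. Conversely, a cyclic shift of the second coordinates only permutes the factors of \<psi>
  and does not touch those of \<phi>, so it is only felt by the cost.
\<close>

lemma cyclically_invariant_iff_product_form:
  fixes c :: "'a::second_countable_topology \<times> 'b::second_countable_topology \<Rightarrow> real"
  assumes sets_cong[measurable_cong]: "sets \<mu> = sets borel" "sets \<nu> = sets borel"
    and c: "c \<in> borel_measurable borel"
  shows "cyclically_invariant c \<epsilon> \<mu> \<nu> \<pi> \<longleftrightarrow>
    (\<exists>\<phi> \<psi>. \<phi> \<in> borel_measurable \<mu> \<and> \<psi> \<in> borel_measurable \<nu> \<and> (\<forall>x. 0 < \<phi> x) \<and> (\<forall>y. 0 < \<psi> y) \<and>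
      density (\<mu> \<Otimes>\<^sub>M \<nu>) (\<lambda>z. ennreal (\<phi> (fst z) * \<psi> (snd z) * exp (- c z / \<epsilon>))) = \<pi>)"
    (is "_ \<longleftrightarrow> ?R")
proof
  have "sets (\<mu> \<Otimes>\<^sub>M \<nu>) = sets (borel :: ('a \<times> 'b) measure)"
    by (simp only: sets_pair_measure_cong[OF sets_cong] borel_prod)
  then have [measurable]: "c \<in> borel_measurable (\<mu> \<Otimes>\<^sub>M \<nu>)"
    using c by (simp cong: measurable_cong_sets)
  have [simp]: "space \<mu> = UNIV" "space \<nu> = UNIV" using sets_cong[THEN sets_eq_imp_space_eq] by auto
  {
    assume "cyclically_invariant c \<epsilon> \<mu> \<nu> \<pi>"
    then obtain f where f[measurable]: "f \<in> borel_measurable (\<mu> \<Otimes>\<^sub>M \<nu>)" and f_pos: "\<forall>z. 0 < f z"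
      and \<pi>: "density (\<mu> \<Otimes>\<^sub>M \<nu>) (\<lambda>z. ennreal (f z)) = \<pi>"
      and cyc: "\<forall>k \<ge> 1. \<forall>(x :: nat \<Rightarrow> 'a) (y :: nat \<Rightarrow> 'b). y (k + 1) = y 1 \<longrightarrow>
           (\<Prod>i = 1..k. f (x i, y i)) =
             exp (- (1 / \<epsilon>) * ((\<Sum>i = 1..k. c (x i, y i)) - (\<Sum>i = 1..k. c (x i, y (i + 1)))))
             * (\<Prod>i = 1..k. f (x i, y (i + 1)))"
      unfolding cyclically_invariant_def by (elim conjE bexE) (rule that; assumption)
    define x0 :: 'a where "x0 = undefined"
    define y0 :: 'b where "y0 = undefined"
    define g where "g z = f z * exp (c z / \<epsilon>)" for z
    have g_pos: "0 < g z" for z unfolding g_def by (intro mult_pos_pos exp_gt_zero f_pos[rule_format])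
    have g_meas[measurable]: "g \<in> borel_measurable (\<mu> \<Otimes>\<^sub>M \<nu>)" unfolding g_def by measurable
    have g: "g (x, y) * g (x0, y0) = g (x, y0) * g (x0, y)" for x y
    proof -
      have "f (x, y) * f (x0, y0) = exp (- (1 / \<epsilon>) * ((c (x, y) + c (x0, y0)) - (c (x, y0) + c (x0, y)))) * (f (x, y0) * f (x0, y))"
        using cyc[THEN spec, of 2, THEN mp, THEN spec, of "\<lambda>i. if i = 1 then x else x0", THEN spec, of "\<lambda>i. if i = 2 then y0 else y", THEN mp]
        by (simp add: numeral_2_eq_2 mult_ac)
      then have "g (x, y) * g (x0, y0) = exp (- (1 / \<epsilon>) * ((c (x, y) + c (x0, y0)) - (c (x, y0) + c (x0, y)))) * exp (c (x, y) / \<epsilon>) * exp (c (x0, y0) / \<epsilon>) * (f (x, y0) * f (x0, y))"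
        by (simp add: g_def mult_ac)
      also have "\<dots> = exp (c (x, y0) / \<epsilon>) * exp (c (x0, y) / \<epsilon>) * (f (x, y0) * f (x0, y))"
        by (simp add: exp_add[symmetric] add_divide_distrib diff_divide_distrib)
      also have "\<dots> = g (x, y0) * g (x0, y)" by (simp add: g_def mult_ac)
      finally show ?thesis .
    qed
    have f_eq: "f z = g (fst z, y0) * (g (x0, snd z) / g (x0, y0)) * exp (- c z / \<epsilon>)" for z
    proof -
      have "g z = g (fst z, y0) * (g (x0, snd z) / g (x0, y0))"
        using g[of "fst z" "snd z"] g_pos[of "(x0, y0)"] by (simp add: field_simps)
      moreover have "f z = g z * exp (- c z / \<epsilon>)"
        by (simp add: g_def exp_minus)
      ultimately show ?thesis by simp
    qed
    show ?R
    proof (intro exI[of _ "\<lambda>x. g (x, y0)"] exI[of _ "\<lambda>y. g (x0, y) / g (x0, y0)"] conjI allI)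
      show "density (\<mu> \<Otimes>\<^sub>M \<nu>) (\<lambda>z. ennreal (g (fst z, y0) * (g (x0, snd z) / g (x0, y0)) * exp (- c z / \<epsilon>))) = \<pi>"
        using \<pi> by (simp only: f_eq)
      show "(\<lambda>x. g (x, y0)) \<in> borel_measurable \<mu>" "(\<lambda>y. g (x0, y) / g (x0, y0)) \<in> borel_measurable \<nu>"
        by measurable
    qed (simp_all add: g_pos)
  }
  assume ?R
  then obtain \<phi> \<psi> where [measurable]: "\<phi> \<in> borel_measurable \<mu>" "\<psi> \<in> borel_measurable \<nu>"
    and pos: "\<forall>x. 0 < \<phi> x" "\<forall>y. 0 < \<psi> y"
    and \<pi>: "density (\<mu> \<Otimes>\<^sub>M \<nu>) (\<lambda>z. ennreal (\<phi> (fst z) * \<psi> (snd z) * exp (- c z / \<epsilon>))) = \<pi>"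
    by (elim exE conjE) (rule that; assumption)
  define f where "f z = \<phi> (fst z) * \<psi> (snd z) * exp (- c z / \<epsilon>)" for z
  have [measurable]: "f \<in> borel_measurable (\<mu> \<Otimes>\<^sub>M \<nu>)" unfolding f_def by measurable
  have f_pos: "0 < f z" for z by (simp add: f_def pos[rule_format])
  have \<pi>f: "density (\<mu> \<Otimes>\<^sub>M \<nu>) (\<lambda>z. ennreal (f z)) = \<pi>" using \<pi> by (simp add: f_def)
  have cyc: "(\<Prod>i = 1..k. f (x i, y i)) =
             exp (- (1 / \<epsilon>) * ((\<Sum>i = 1..k. c (x i, y i)) - (\<Sum>i = 1..k. c (x i, y (i + 1)))))
             * (\<Prod>i = 1..k. f (x i, y (i + 1)))" if "k \<ge> 1" "y (k + 1) = y 1" for k :: nat and x :: "nat \<Rightarrow> 'a" and y :: "nat \<Rightarrow> 'b"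
  proof -
    have "(\<Prod>i = 1..k. \<psi> (y (i + 1))) = (\<Prod>i = 2..k + 1. \<psi> (y i))"
      by (rule prod.reindex_bij_witness[of _ "\<lambda>i. i - 1" "\<lambda>i. i + 1"]) auto
    also have "\<dots> * \<psi> (y 1) = (\<Prod>i = 1..k + 1. \<psi> (y i))"
      by (subst prod.atLeast_Suc_atMost[of 1 "k + 1"]) (auto simp: mult.commute numeral_2_eq_2)
    also have "\<dots> = (\<Prod>i = 1..k. \<psi> (y i)) * \<psi> (y (k + 1))"
      by simp
    finally have \<psi>: "(\<Prod>i = 1..k. \<psi> (y (i + 1))) = (\<Prod>i = 1..k. \<psi> (y i))"
      using that(2) pos(2)[rule_format, of "y 1"] by simp
    have f_prod: "(\<Prod>i = 1..k. f (x i, y' i)) = (\<Prod>i = 1..k. \<phi> (x i)) * (\<Prod>i = 1..k. \<psi> (y' i)) * exp (- (\<Sum>i = 1..k. c (x i, y' i)) / \<epsilon>)" for y'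
      by (simp add: f_def prod.distrib exp_sum[symmetric] sum_negf[symmetric] sum_divide_distrib)
    show ?thesis
      unfolding f_prod[of y] f_prod[of "\<lambda>i. y (i + 1)"] \<psi>
      by (simp add: mult_ac exp_add[symmetric] diff_divide_distrib)
  qed
  have "absolutely_continuous (\<mu> \<Otimes>\<^sub>M \<nu>) \<pi>"
    unfolding \<pi>f[symmetric] by (intro absolutely_continuousI_density) measurable
  moreover have "absolutely_continuous \<pi> (\<mu> \<Otimes>\<^sub>M \<nu>)"
    unfolding absolutely_continuous_def
  proof
    fix N assume "N \<in> null_sets \<pi>"
    then have "N \<in> sets (\<mu> \<Otimes>\<^sub>M \<nu>)" "AE z in \<mu> \<Otimes>\<^sub>M \<nu>. z \<in> N \<longrightarrow> ennreal (f z) = 0"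
      unfolding \<pi>f[symmetric] by (simp_all add: null_sets_density_iff del: ennreal_eq_0_iff)
    moreover from this(2) have "AE z in \<mu> \<Otimes>\<^sub>M \<nu>. z \<notin> N"
      by eventually_elim (use f_pos in \<open>force simp: not_le[symmetric] ennreal_eq_0_iff\<close>)
    ultimately show "N \<in> null_sets (\<mu> \<Otimes>\<^sub>M \<nu>)" by (simp add: AE_iff_null_sets)
  qed
  ultimately show "cyclically_invariant c \<epsilon> \<mu> \<nu> \<pi>"
    unfolding cyclically_invariant_def using f_pos \<pi>f cyc
    by (intro conjI bexI[of _ f] allI impI) simp_all
qed

section \<open>Uniqueness\<close>

lemma couplings_integral_sum_eq:
  fixes \<mu> :: "'a::second_countable_topology measure" and \<nu> :: "'b::second_countable_topology measure"
  assumes "\<pi> \<in> couplings \<mu> \<nu>" "\<pi>' \<in> couplings \<mu> \<nu>"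
    and h[measurable]: "h \<in> borel_measurable borel" and k[measurable]: "k \<in> borel_measurable borel"
    and bound: "\<And>x. \<bar>h x\<bar> \<le> C" "\<And>y. \<bar>k y\<bar> \<le> (C :: real)"
  shows "(\<integral>z. h (fst z) + k (snd z) \<partial>\<pi>) = (\<integral>z. h (fst z) + k (snd z) \<partial>\<pi>')"
proof -
  have "(\<integral>z. h (fst z) + k (snd z) \<partial>\<rho>) = (\<integral>x. h x \<partial>\<mu>) + (\<integral>y. k y \<partial>\<nu>)" if \<rho>: "\<rho> \<in> couplings \<mu> \<nu>" for \<rho>
  proof -
    from \<rho> have sets: "sets \<rho> = sets (borel :: ('a \<times> 'b) measure)" and "prob_space \<rho>"
      and marg: "distr \<rho> borel fst = \<mu>" "distr \<rho> borel snd = \<nu>"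
      unfolding couplings_def prob_measures_def by simp_all
    interpret prob_space \<rho> by fact
    have m: "fst \<in> \<rho> \<rightarrow>\<^sub>M borel" "snd \<in> \<rho> \<rightarrow>\<^sub>M borel"
      unfolding measurable_cong_sets[OF sets refl] borel_prod[symmetric] by simp_all
    have "integrable \<rho> (\<lambda>z. h (fst z))"
      by (rule integrable_const_bound[of _ C]) (simp add: bound(1), rule measurable_compose[OF m(1) h])
    moreover have "integrable \<rho> (\<lambda>z. k (snd z))"
      by (rule integrable_const_bound[of _ C]) (simp add: bound(2), rule measurable_compose[OF m(2) k])
    ultimately have "(\<integral>z. h (fst z) + k (snd z) \<partial>\<rho>) = (\<integral>z. h (fst z) \<partial>\<rho>) + (\<integral>z. k (snd z) \<partial>\<rho>)" by (rule Bochner_Integration.integral_add)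
    also have "\<dots> = (\<integral>x. h x \<partial>distr \<rho> borel fst) + (\<integral>y. k y \<partial>distr \<rho> borel snd)"
      unfolding integral_distr[OF m(1) h] integral_distr[OF m(2) k] by (rule refl)
    finally show ?thesis by (simp add: marg)
  qed
  with assms show ?thesis by simp
qed

text \<open>
  Since arctan is odd and increasing, arctan a + arctan b has the sign of a + b, which is also the sign
  of exp (a + b) - 1. This makes arctan a bounded substitute for a potential a.
\<close>

lemma arctan_ln_sum_sign:
  fixes r s :: real
  assumes "0 < r" "0 < s"
  shows "0 \<le> (arctan (ln r) + arctan (ln s)) * (r * s - 1)"
    and "(arctan (ln r) + arctan (ln s)) * (r * s - 1) = 0 \<Longrightarrow> r * s = 1"
proof -
  have ln: "ln (r * s) = ln r - (- ln s)" using assms by (simp add: ln_mult)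
  have sum: "arctan (ln r) + arctan (ln s) = arctan (ln r) - arctan (- ln s)" by (simp add: arctan_minus)
  have rs: "0 < r * s" using assms by simp
  consider "r * s = 1" | "1 < r * s" | "r * s < 1" by linarith
  then have *: "r * s = 1 \<or> 0 < (arctan (ln r) + arctan (ln s)) * (r * s - 1)"
  proof cases
    case 2
    then have "- ln s < ln r" using ln_gt_zero[of "r * s"] unfolding ln by simp
    then have "arctan (- ln s) < arctan (ln r)" by (rule arctan_monotone)
    with 2 show ?thesis unfolding sum by (intro disjI2 mult_pos_pos) auto
  next
    case 3
    then have "ln r < - ln s" using ln_less_zero[OF rs] unfolding ln by simp
    then have "arctan (ln r) < arctan (- ln s)" by (rule arctan_monotone)
    with 3 show ?thesis unfolding sum by (intro disjI2 mult_neg_neg) auto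
  qed simp
  then show "0 \<le> (arctan (ln r) + arctan (ln s)) * (r * s - 1)" by (elim disjE) simp_all
  show "(arctan (ln r) + arctan (ln s)) * (r * s - 1) = 0 \<Longrightarrow> r * s = 1" using * by (metis less_irrefl)
qed

text \<open>
  With r = \<phi>' / \<phi> and s = \<psi>' / \<psi> the function w = arctan (ln r) + arctan (ln s) is bounded and a sum of
  functions of one coordinate, so the two couplings integrate it to the same value. The integral of
  w * (r * s - 1) against the first coupling therefore vanishes, while its integrand is nonnegative and
  zero only where r * s = 1.
\<close>

lemma product_form_coupling_unique:
  fixes \<mu> :: "'a::second_countable_topology measure" and \<nu> :: "'b::second_countable_topology measure" and K :: "'a \<times> 'b \<Rightarrow> real"
  assumes sets_cong[measurable_cong]: "sets \<mu> = sets borel" "sets \<nu> = sets borel"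
    and meas[measurable]: "\<phi> \<in> borel_measurable \<mu>" "\<psi> \<in> borel_measurable \<nu>" "\<phi>' \<in> borel_measurable \<mu>" "\<psi>' \<in> borel_measurable \<nu>"
      "K \<in> borel_measurable (\<mu> \<Otimes>\<^sub>M \<nu>)"
    and pos: "\<And>x. 0 < \<phi> x" "\<And>y. 0 < \<psi> y" "\<And>x. 0 < \<phi>' x" "\<And>y. 0 < \<psi>' y" "\<And>z. 0 < K z"
    and coupl: "density (\<mu> \<Otimes>\<^sub>M \<nu>) (\<lambda>z. ennreal (\<phi> (fst z) * \<psi> (snd z) * K z)) \<in> couplings \<mu> \<nu>"
      "density (\<mu> \<Otimes>\<^sub>M \<nu>) (\<lambda>z. ennreal (\<phi>' (fst z) * \<psi>' (snd z) * K z)) \<in> couplings \<mu> \<nu>"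
  shows "density (\<mu> \<Otimes>\<^sub>M \<nu>) (\<lambda>z. ennreal (\<phi> (fst z) * \<psi> (snd z) * K z)) =
      density (\<mu> \<Otimes>\<^sub>M \<nu>) (\<lambda>z. ennreal (\<phi>' (fst z) * \<psi>' (snd z) * K z))"
proof -
  define P where "P = \<mu> \<Otimes>\<^sub>M \<nu>"
  define f where "f z = \<phi> (fst z) * \<psi> (snd z) * K z" for z
  define f' where "f' z = \<phi>' (fst z) * \<psi>' (snd z) * K z" for z
  have [measurable]: "f \<in> borel_measurable P" "f' \<in> borel_measurable P" unfolding f_def f'_def P_def by measurable
  have f_pos: "0 < f z" "0 < f' z" for z by (simp_all add: f_def f'_def pos)
  note coupl = coupl[folded f_def f'_def P_def]
  define h where "h x = arctan (ln (\<phi>' x / \<phi> x))" for x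
  define k where "k y = arctan (ln (\<psi>' y / \<psi> y))" for y
  have [measurable]: "h \<in> borel_measurable \<mu>" "k \<in> borel_measurable \<nu>"
    unfolding h_def k_def by (intro measurable_compose[OF _ borel_measurable_arctan]; measurable)+
  have bound: "\<bar>h x\<bar> \<le> pi / 2" "\<bar>k y\<bar> \<le> pi / 2" for x y
    using arctan_bounded[of "ln (\<phi>' x / \<phi> x)"] arctan_bounded[of "ln (\<psi>' y / \<psi> y)"]
    unfolding h_def k_def by linarith+
  have eq: "(\<integral>z. h (fst z) + k (snd z) \<partial>density P f) = (\<integral>z. h (fst z) + k (snd z) \<partial>density P f')"
  proof (rule couplings_integral_sum_eq[OF coupl])
    show "h \<in> borel_measurable borel" "k \<in> borel_measurable borel"
      using \<open>h \<in> borel_measurable \<mu>\<close> \<open>k \<in> borel_measurable \<nu>\<close>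
      by (simp_all add: measurable_cong_sets[OF sets_cong(1) refl] measurable_cong_sets[OF sets_cong(2) refl])
  qed (rule bound)+
  define w where "w z = h (fst z) + k (snd z)" for z
  have [measurable]: "w \<in> borel_measurable P" unfolding w_def P_def by measurable
  have int: "integrable P (\<lambda>z. g z * w z)"
    if [measurable]: "g \<in> borel_measurable P" and "\<And>z. 0 < g z" and g: "density P g \<in> couplings \<mu> \<nu>" for g
  proof -
    interpret prob_space "density P g" using g by (simp add: couplings_def prob_measures_def)
    have "integrable (density P g) w"
    proof (rule integrable_const_bound[of _ pi])
      show "AE z in density P g. norm (w z) \<le> pi"
      proof (rule AE_I2)
        fix z show "norm (w z) \<le> pi" using bound(1)[of "fst z"] bound(2)[of "snd z"] unfolding w_def real_norm_def by linarith
      qed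
    qed simp
    then show ?thesis using integrable_density[of w P g] \<open>\<And>z. 0 < g z\<close> by (simp add: less_imp_le)
  qed
  have "(\<integral>z. w z * (f' z - f z) \<partial>P) = (\<integral>z. f' z * w z \<partial>P) - (\<integral>z. f z * w z \<partial>P)"
    using int[of f] int[of f'] f_pos coupl by (simp add: algebra_simps)
  also have "\<dots> = (\<integral>z. w z \<partial>density P f') - (\<integral>z. w z \<partial>density P f)"
    using f_pos by (simp add: integral_density less_imp_le)
  also have "\<dots> = 0" using eq by (simp add: w_def)
  finally have 0: "(\<integral>z. w z * (f' z - f z) \<partial>P) = 0" .
  have fac: "w z * (f' z - f z) = f z * (w z * (\<phi>' (fst z) / \<phi> (fst z) * (\<psi>' (snd z) / \<psi> (snd z)) - 1))" for z
    using pos(1)[of "fst z"] pos(2)[of "snd z"] by (simp add: f_def f'_def field_simps)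
  have "AE z in P. w z * (f' z - f z) = 0"
  proof (subst integral_nonneg_eq_0_iff_AE[symmetric])
    show "integrable P (\<lambda>z. w z * (f' z - f z))"
      using int[of f] int[of f'] f_pos coupl by (simp add: algebra_simps)
    show "AE z in P. 0 \<le> w z * (f' z - f z)"
      unfolding fac unfolding w_def h_def k_def
      by (intro AE_I2 mult_nonneg_nonneg arctan_ln_sum_sign(1) divide_pos_pos pos) (simp add: f_pos less_imp_le)
  qed (rule 0)
  then have "AE z in P. ennreal (f z) = ennreal (f' z)"
  proof eventually_elim
    case (elim z)
    then have "w z * (\<phi>' (fst z) / \<phi> (fst z) * (\<psi>' (snd z) / \<psi> (snd z)) - 1) = 0"
      unfolding fac using f_pos(1)[of z] by simp
    then have "\<phi>' (fst z) / \<phi> (fst z) * (\<psi>' (snd z) / \<psi> (snd z)) = 1"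
      unfolding w_def h_def k_def by (intro arctan_ln_sum_sign(2) divide_pos_pos pos)
    then show ?case using pos(1)[of "fst z"] pos(2)[of "snd z"] by (simp add: f_def f'_def field_simps)
  qed
  then have "density P f = density P f'" by (intro density_cong) auto
  then show ?thesis by (simp add: f_def f'_def P_def)
qed

section \<open>Optimality\<close>

text \<open>
  The bound t * ln (1 / t) \<le> 1 - t controls the negative part of the entropy integral, so the entropy
  is a genuine difference, whatever version of the density is used.
\<close>

lemma relative_entropy_density:
  fixes g :: "'a \<Rightarrow> real"
  assumes "prob_space P" and [measurable]: "g \<in> borel_measurable P" and nn: "\<And>z. 0 \<le> g z"
    and dens: "density P g = \<pi>" and "prob_space \<pi>"
  shows "(\<integral>\<^sup>+ z. ennreal (- ln (g z)) \<partial>\<pi>) \<le> 1"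
    and "relative_entropy \<pi> P = enn2ereal (\<integral>\<^sup>+ z. ennreal (ln (g z)) \<partial>\<pi>) - enn2ereal (\<integral>\<^sup>+ z. ennreal (- ln (g z)) \<partial>\<pi>)"
proof -
  interpret P: prob_space P by fact
  have "(\<integral>\<^sup>+ z. ennreal (- ln (g z)) \<partial>\<pi>) = (\<integral>\<^sup>+ z. ennreal (g z) * ennreal (- ln (g z)) \<partial>P)"
    unfolding dens[symmetric] by (subst nn_integral_density) auto
  also have "\<dots> \<le> (\<integral>\<^sup>+ z. 1 \<partial>P)"
  proof (intro nn_integral_mono)
    fix z
    have "g z * (- ln (g z)) \<le> 1"
    proof (cases "g z = 0")
      case False
      then have "0 < g z" using nn[of z] by simp
      then have "ln (1 / g z) \<le> 1 / g z - 1" by (intro ln_le_minus_one) simp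
      then have "g z * ln (1 / g z) \<le> g z * (1 / g z - 1)" by (rule mult_left_mono) (rule nn)
      moreover have "ln (1 / g z) = - ln (g z)" "g z * (1 / g z - 1) = 1 - g z"
        using \<open>0 < g z\<close> by (simp_all add: ln_div field_simps)
      ultimately show ?thesis using nn[of z] by simp
    qed simp
    then have "ennreal (g z * (- ln (g z))) \<le> 1" by (simp add: ennreal_le_1)
    then show "ennreal (g z) * ennreal (- ln (g z)) \<le> 1"
      by (subst ennreal_mult'[symmetric]) (simp_all add: nn)
  qed
  finally show "(\<integral>\<^sup>+ z. ennreal (- ln (g z)) \<partial>\<pi>) \<le> 1" by (simp add: P.emeasure_space_1)
  have ac: "absolutely_continuous P \<pi>" unfolding dens[symmetric] by (rule absolutely_continuousI_density) measurable
  have "AE z in P. ennreal (g z) = RN_deriv P \<pi> z"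
    by (rule P.RN_deriv_unique) (use dens in auto)
  then have "AE z in P. 0 < ennreal (g z) \<longrightarrow> enn2real (RN_deriv P \<pi> z) = g z"
    by eventually_elim (metis enn2real_ennreal nn)
  then have eq: "AE z in \<pi>. enn2real (RN_deriv P \<pi> z) = g z"
    unfolding dens[symmetric] by (subst AE_density) auto
  have "(\<integral>\<^sup>+ z. ennreal (ln (enn2real (RN_deriv P \<pi> z))) \<partial>\<pi>) = (\<integral>\<^sup>+ z. ennreal (ln (g z)) \<partial>\<pi>)"
       "(\<integral>\<^sup>+ z. ennreal (- ln (enn2real (RN_deriv P \<pi> z))) \<partial>\<pi>) = (\<integral>\<^sup>+ z. ennreal (- ln (g z)) \<partial>\<pi>)"
    by (intro nn_integral_cong_AE; use eq in eventually_elim; simp)+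
  then show "relative_entropy \<pi> P = enn2ereal (\<integral>\<^sup>+ z. ennreal (ln (g z)) \<partial>\<pi>) - enn2ereal (\<integral>\<^sup>+ z. ennreal (- ln (g z)) \<partial>\<pi>)"
    using ac by (simp add: relative_entropy_def extended_integral_def)
qed

text \<open>
  As c is nonnegative and the negative part of the entropy integral is finite, the cost is infinite
  precisely when c or the logarithm of the density fails to be integrable; otherwise it is an ordinary
  integral.
\<close>

lemma eot_cost_integrable:
  fixes g :: "'a::topological_space \<times> 'b::topological_space \<Rightarrow> real"
  assumes P: "prob_space (\<mu> \<Otimes>\<^sub>M \<nu>)" and g[measurable]: "g \<in> borel_measurable (\<mu> \<Otimes>\<^sub>M \<nu>)" and nn: "\<And>z. 0 \<le> g z"
    and dens: "density (\<mu> \<Otimes>\<^sub>M \<nu>) g = \<pi>" and "prob_space \<pi>"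
    and c: "c \<in> borel_measurable (\<mu> \<Otimes>\<^sub>M \<nu>)" "\<And>z. 0 \<le> c z" and \<epsilon>: "0 < \<epsilon>"
  shows "eot_cost c \<epsilon> \<mu> \<nu> \<pi> < \<infinity> \<Longrightarrow> integrable \<pi> c \<and> integrable \<pi> (\<lambda>z. ln (g z))"
    and "integrable \<pi> c \<Longrightarrow> integrable \<pi> (\<lambda>z. ln (g z)) \<Longrightarrow>
      eot_cost c \<epsilon> \<mu> \<nu> \<pi> = ereal ((\<integral>z. c z \<partial>\<pi>) + \<epsilon> * (\<integral>z. ln (g z) \<partial>\<pi>))"
proof -
  have sets_\<pi>[measurable_cong]: "sets \<pi> = sets (\<mu> \<Otimes>\<^sub>M \<nu>)" by (simp add: dens[symmetric])
  have [measurable]: "c \<in> borel_measurable \<pi>" "g \<in> borel_measurable \<pi>" using c g by (simp_all cong: measurable_cong_sets)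
  note ent = relative_entropy_density[OF P g nn dens \<open>prob_space \<pi>\<close>]
  define a where "a = (\<integral>\<^sup>+ z. ennreal (ln (g z)) \<partial>\<pi>)"
  define b where "b = (\<integral>\<^sup>+ z. ennreal (- ln (g z)) \<partial>\<pi>)"
  define d where "d = (\<integral>\<^sup>+ z. ennreal (c z) \<partial>\<pi>)"
  have b1: "b \<le> 1" using ent(1) by (simp add: b_def)
  then obtain b' where b': "b = ennreal b'" "0 \<le> b'" by (cases b) (auto simp: top_unique)
  have cost: "eot_cost c \<epsilon> \<mu> \<nu> \<pi> = enn2ereal d + ereal \<epsilon> * (enn2ereal a - ereal b')"
    unfolding eot_cost_def ent(2) a_def[symmetric] b_def[symmetric] d_def[symmetric] b' using b'(2) by simp
  show "integrable \<pi> c \<and> integrable \<pi> (\<lambda>z. ln (g z))" if fin: "eot_cost c \<epsilon> \<mu> \<nu> \<pi> < \<infinity>"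
  proof
    have a_fin: "a < top"
      using fin \<epsilon> unfolding cost by (cases a; cases d) auto
    have d_fin: "d < top"
      using fin \<epsilon> unfolding cost by (cases a; cases d) auto
    show "integrable \<pi> c" using d_fin c(2)
      by (intro integrableI_nonneg) (auto simp: d_def)
    show "integrable \<pi> (\<lambda>z. ln (g z))"
      using a_fin b' by (intro real_integrable_def[THEN iffD2]) (auto simp: a_def b_def)
  qed
  assume int: "integrable \<pi> c" "integrable \<pi> (\<lambda>z. ln (g z))"
  have "d = ennreal (\<integral>z. c z \<partial>\<pi>)" unfolding d_def by (rule nn_integral_eq_integral) (use int c in auto)
  moreover have "a < top" using int(2) by (simp add: real_integrable_def a_def less_top)
  then obtain a' where a': "a = ennreal a'" "0 \<le> a'" by (cases a) auto
  moreover have "(\<integral>z. ln (g z) \<partial>\<pi>) = a' - b'"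
    using real_lebesgue_integral_def[OF int(2)] a' b' by (simp add: a_def[symmetric] b_def[symmetric])
  ultimately show "eot_cost c \<epsilon> \<mu> \<nu> \<pi> = ereal ((\<integral>z. c z \<partial>\<pi>) + \<epsilon> * (\<integral>z. ln (g z) \<partial>\<pi>))"
    unfolding cost using c(2) by (simp add: integral_nonneg_AE)
qed

text \<open>
  This is the Bregman divergence of the strictly convex function t ln t between g and y.
\<close>

lemma young_entropy:
  fixes g y :: real
  assumes "0 \<le> g" "0 < y"
  shows "0 \<le> g * (ln g - ln y) - g + y" and "g * (ln g - ln y) - g + y = 0 \<Longrightarrow> g = y"
proof -
  have eq: "g * (ln g - ln y) - g + y = g * (y / g - 1 - ln (y / g))" if "0 < g"
    using that assms by (simp add: ln_div field_simps)
  have le: "0 \<le> y / g - 1 - ln (y / g)" if "0 < g" using ln_le_minus_one[of "y / g"] that assms by simp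
  show "0 \<le> g * (ln g - ln y) - g + y"
    using eq le assms by (cases "g = 0") auto
  assume 0: "g * (ln g - ln y) - g + y = 0"
  then have g: "0 < g" using assms by (cases "g = 0") auto
  then have "ln (y / g) = y / g - 1" using 0 eq[OF g] by simp
  then have "y / g = 1" using g assms by (intro ln_eq_minus_one) auto
  then show "g = y" using g by simp
qed

text \<open>
  Truncation at level N is odd, monotone and 1-Lipschitz. Hence the sum of the truncations of a and b
  lies between 0 and a + b, and all three bounds follow from this.
\<close>

lemma clip_sum:
  fixes a b N :: real
  assumes "0 \<le> N"
  defines "t \<equiv> max (- N) (min N a) + max (- N) (min N b)"
  shows "\<bar>t\<bar> \<le> \<bar>a + b\<bar>" "exp t \<le> 1 + exp (a + b)" "\<bar>t\<bar> \<le> t + 2 * max 0 (- (a + b))"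
proof -
  have *: "(0 \<le> t \<and> t \<le> a + b) \<or> (t \<le> 0 \<and> a + b \<le> t)"
    using assms(1) unfolding t_def by (auto simp: max_def min_def)
  then show "\<bar>t\<bar> \<le> \<bar>a + b\<bar>" "\<bar>t\<bar> \<le> t + 2 * max 0 (- (a + b))" by auto
  from * have "exp t \<le> exp (a + b) \<or> exp t \<le> 1" by auto
  then show "exp t \<le> 1 + exp (a + b)" using exp_gt_zero[of "a + b"] by linarith
qed

text \<open>
  Let h = ln \<phi> + ln \<psi>, so that \<pi> has density K * exp h, and let g be the density of a competitor \<pi>' of
  finite cost \<epsilon> * e. For a function t let \<theta> t be the Young gap between g and K * exp t. If h were
  integrable for both couplings, the marginal constraints would give \<integral> \<theta> h dP = e - \<integral> h d\<pi>, and
  \<epsilon> * \<integral> h d\<pi> is the cost of \<pi>; nonnegativity of the gap would prove optimality, and a vanishing gap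
  g = K * exp h. For the truncations hn of h this computation is legitimate up to the error
  \<integral> K * exp hn dP - 1, which tends to zero. The resulting upper bound for \<integral> hn d\<pi> shows by Fatou's lemma
  that h is integrable for \<pi>, and a second use of Fatou's lemma transfers the estimate from hn to h.
\<close>

lemma product_form_coupling_optimal:
  fixes \<mu> :: "'a::second_countable_topology measure" and \<nu> :: "'b::second_countable_topology measure" and c :: "'a \<times> 'b \<Rightarrow> real"
  assumes "prob_space \<mu>" "prob_space \<nu>" and sets_cong: "sets \<mu> = sets borel" "sets \<nu> = sets borel"
    and meas[measurable]: "\<phi> \<in> borel_measurable \<mu>" "\<psi> \<in> borel_measurable \<nu>" "c \<in> borel_measurable (\<mu> \<Otimes>\<^sub>M \<nu>)"
    and pos: "\<And>x. 0 < \<phi> x" "\<And>y. 0 < \<psi> y" and c_nonneg: "\<And>z. 0 \<le> c z" and \<epsilon>: "0 < \<epsilon>"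
    and dens: "density (\<mu> \<Otimes>\<^sub>M \<nu>) (\<lambda>z. ennreal (\<phi> (fst z) * \<psi> (snd z) * exp (- c z / \<epsilon>))) = \<pi>"
    and coupl: "\<pi> \<in> couplings \<mu> \<nu>" "\<pi>' \<in> couplings \<mu> \<nu>" and fin: "eot_cost c \<epsilon> \<mu> \<nu> \<pi>' < \<infinity>"
  shows "eot_cost c \<epsilon> \<mu> \<nu> \<pi> \<le> eot_cost c \<epsilon> \<mu> \<nu> \<pi>'"
    and "eot_cost c \<epsilon> \<mu> \<nu> \<pi>' \<le> eot_cost c \<epsilon> \<mu> \<nu> \<pi> \<Longrightarrow> \<pi>' = \<pi>"
proof -
  define P where "P = \<mu> \<Otimes>\<^sub>M \<nu>"
  have sets_P: "sets P = sets (borel :: ('a \<times> 'b) measure)"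
    unfolding P_def by (simp only: sets_pair_measure_cong[OF sets_cong] borel_prod)
  interpret \<mu>: prob_space \<mu> by fact
  interpret \<nu>: prob_space \<nu> by fact
  interpret pair_prob_space \<mu> \<nu> ..
  have prob_P: "prob_space P" unfolding P_def by unfold_locales
  interpret Q: prob_space P by fact
  have prob: "prob_space \<pi>" "prob_space \<pi>'" and sets_coupl: "sets \<pi> = sets borel" "sets \<pi>' = sets borel"
    using coupl unfolding couplings_def prob_measures_def by simp_all
  interpret \<pi>: prob_space \<pi> by fact
  interpret \<pi>': prob_space \<pi>' by fact
  have [measurable]: "c \<in> borel_measurable P" using meas by (simp add: P_def)
  define h where "h z = ln (\<phi> (fst z)) + ln (\<psi> (snd z))" for z
  define K where "K z = exp (- c z / \<epsilon>)" for z
  define f where "f z = K z * exp (h z)" for z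
  have [measurable]: "h \<in> borel_measurable P" unfolding h_def P_def by measurable
  have [measurable]: "K \<in> borel_measurable P" unfolding K_def by measurable
  have [measurable]: "f \<in> borel_measurable P" unfolding f_def by measurable
  have K: "0 < K z" "K z \<le> 1" for z using c_nonneg[of z] \<epsilon> by (simp_all add: K_def)
  have ln_K: "ln (K z) = - c z / \<epsilon>" for z by (simp add: K_def)
  have f_eq: "f z = \<phi> (fst z) * \<psi> (snd z) * exp (- c z / \<epsilon>)" for z
    by (simp add: f_def h_def K_def exp_add pos)
  have f_pos: "0 < f z" for z by (simp add: f_def K)
  have ln_f: "ln (f z) = h z - c z / \<epsilon>" for z
    using K(1)[of z] by (simp add: f_def ln_mult ln_K)
  have dens_f: "density P f = \<pi>" using dens by (simp add: f_eq P_def)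

  have ac: "absolutely_continuous P \<pi>'"
  proof (rule ccontr)
    assume "\<not> ?thesis"
    then have "relative_entropy \<pi>' (\<mu> \<Otimes>\<^sub>M \<nu>) = \<infinity>" by (simp add: relative_entropy_def P_def)
    then have "eot_cost c \<epsilon> \<mu> \<nu> \<pi>' = \<infinity>" using \<epsilon> by (simp add: eot_cost_def)
    with fin show False by simp
  qed
  obtain g where g[measurable]: "g \<in> borel_measurable P" and g_nonneg: "\<And>z. 0 \<le> g z"
    and RN: "AE z in P. RN_deriv P \<pi>' z = ennreal (g z)"
    using Q.real_RN_deriv[of \<pi>'] ac sets_P sets_coupl \<pi>'.finite_measure_axioms by metis
  have dens_g: "density P g = \<pi>'"
  proof -
    have "density P g = density P (RN_deriv P \<pi>')" using RN by (intro density_cong) auto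
    also have "\<dots> = \<pi>'" using ac sets_P sets_coupl by (intro Q.density_RN_deriv) auto
    finally show ?thesis .
  qed
  note cost_f = eot_cost_integrable[of \<mu> \<nu> f \<pi> c \<epsilon>, folded P_def, OF prob_P _ less_imp_le[OF f_pos] dens_f prob(1) _ c_nonneg \<epsilon>, simplified]
  note cost_g = eot_cost_integrable[of \<mu> \<nu> g \<pi>' c \<epsilon>, folded P_def, OF prob_P _ g_nonneg dens_g prob(2) _ c_nonneg \<epsilon>, simplified]
  have meas_\<pi>: "k \<in> borel_measurable \<pi>" "k \<in> borel_measurable \<pi>'" if "k \<in> borel_measurable P" for k :: "'a \<times> 'b \<Rightarrow> real"
    using that unfolding dens_f[symmetric] dens_g[symmetric] by simp_all
  have int_\<pi>: "integrable \<pi> k \<longleftrightarrow> integrable P (\<lambda>z. f z * k z)" "(\<integral>z. k z \<partial>\<pi>) = (\<integral>z. f z * k z \<partial>P)"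
    if "k \<in> borel_measurable P" for k :: "'a \<times> 'b \<Rightarrow> real"
    using that f_pos unfolding dens_f[symmetric] by (simp_all add: integrable_density integral_density less_imp_le)
  have int_\<pi>': "integrable \<pi>' k \<longleftrightarrow> integrable P (\<lambda>z. g z * k z)" "(\<integral>z. k z \<partial>\<pi>') = (\<integral>z. g z * k z \<partial>P)"
    if "k \<in> borel_measurable P" for k :: "'a \<times> 'b \<Rightarrow> real"
    using that g_nonneg unfolding dens_g[symmetric] by (simp_all add: integrable_density integral_density)
  have f_int: "integrable P f" "(\<integral>z. f z \<partial>P) = 1"
    using int_\<pi>[of "\<lambda>_. 1"] \<pi>.prob_space by simp_all
  have g_int: "integrable P g" "(\<integral>z. g z \<partial>P) = 1"
    using int_\<pi>'[of "\<lambda>_. 1"] \<pi>'.prob_space by simp_all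
  from cost_g(1) fin have int_c: "integrable \<pi>' c" and int_lng: "integrable \<pi>' (\<lambda>z. ln (g z))" by auto
  define e where "e = (\<integral>z. ln (g z) + c z / \<epsilon> \<partial>\<pi>')"
  have int_e: "integrable \<pi>' (\<lambda>z. ln (g z) + c z / \<epsilon>)" using int_c int_lng by simp
  have cost': "eot_cost c \<epsilon> \<mu> \<nu> \<pi>' = ereal (\<epsilon> * e)"
    using cost_g(2)[OF int_c int_lng] int_c int_lng \<epsilon> by (simp add: e_def field_simps)

  define a where "a n x = max (- real n) (min (real n) (ln (\<phi> x)))" for n :: nat and x
  define b where "b n y = max (- real n) (min (real n) (ln (\<psi> y)))" for n :: nat and y
  define hn where "hn n z = a n (fst z) + b n (snd z)" for n z
  have [measurable]: "a n \<in> borel_measurable \<mu>" "b n \<in> borel_measurable \<nu>" for n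
    unfolding a_def b_def by measurable
  have [measurable]: "hn n \<in> borel_measurable P" for n unfolding hn_def P_def by measurable
  have ab: "\<bar>a n x\<bar> \<le> real n" "\<bar>b n y\<bar> \<le> real n" for n x y by (auto simp: a_def b_def)
  have hn: "\<bar>hn n z\<bar> \<le> \<bar>h z\<bar>" "exp (hn n z) \<le> 1 + exp (h z)" "\<bar>hn n z\<bar> \<le> hn n z + 2 * max 0 (- h z)" for n z
    unfolding hn_def h_def a_def b_def by (rule clip_sum; simp)+
  have hn_bound: "\<bar>hn n z\<bar> \<le> 2 * real n" for n z
    using ab(1)[of n "fst z"] ab(2)[of n "snd z"] unfolding hn_def by linarith
  have clip_lim: "(\<lambda>n. max (- real n) (min (real n) t)) \<longlonglongrightarrow> t" for t
  proof (rule tendsto_eventually)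
    obtain N :: nat where "\<bar>t\<bar> \<le> real N" using real_arch_simple by blast
    then show "\<forall>\<^sub>F n in sequentially. max (- real n) (min (real n) t) = t"
      by (intro eventually_sequentiallyI[of N]) (auto simp: max_def min_def)
  qed
  have hn_lim: "(\<lambda>n. hn n z) \<longlonglongrightarrow> h z" for z
    unfolding hn_def h_def a_def b_def by (intro tendsto_add clip_lim)
  have int_hn: "integrable \<pi> (hn n)" "integrable \<pi>' (hn n)" for n
    by (rule \<pi>.integrable_const_bound[of _ "2 * real n"] \<pi>'.integrable_const_bound[of _ "2 * real n"];
        simp add: hn_bound meas_\<pi>)+
  define m where "m n = (\<integral>z. hn n z \<partial>\<pi>)" for n
  have m': "m n = (\<integral>z. hn n z \<partial>\<pi>')" for n
    unfolding m_def hn_def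
  proof (rule couplings_integral_sum_eq[OF coupl])
    show "a n \<in> borel_measurable borel" "b n \<in> borel_measurable borel"
      using \<open>a n \<in> borel_measurable \<mu>\<close> \<open>b n \<in> borel_measurable \<nu>\<close>
      by (simp_all add: measurable_cong_sets[OF sets_cong(1) refl] measurable_cong_sets[OF sets_cong(2) refl])
  qed (rule ab)+
  define Z where "Z n = (\<integral>z. K z * exp (hn n z) \<partial>P)" for n
  \<comment> \<open>The majorant 1 + f serves both the bound and the limit of the normalizing integrals.\<close>
  have Kexp: "K z * exp (hn n z) \<le> 1 + f z" for n z
  proof -
    have "K z * exp (hn n z) \<le> K z * (1 + exp (h z))" using K by (intro mult_left_mono hn less_imp_le)
    also have "\<dots> \<le> 1 + f z" using K(2)[of z] by (simp add: f_def distrib_left)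
    finally show ?thesis .
  qed
  have int_K: "integrable P (\<lambda>z. K z * exp (hn n z))" for n
    by (rule Bochner_Integration.integrable_bound[of _ "\<lambda>z. 1 + f z"])
      (use f_int Kexp[of _ n] K(1) f_pos in \<open>auto simp: abs_mult less_imp_le\<close>)
  have Z_le: "Z n \<le> 2" for n
  proof -
    have "Z n \<le> (\<integral>z. 1 + f z \<partial>P)" unfolding Z_def using f_int by (intro integral_mono int_K Kexp) auto
    also have "\<dots> = 2" using f_int Q.prob_space by simp
    finally show ?thesis .
  qed
  have Z_lim: "Z \<longlonglongrightarrow> 1"
    unfolding Z_def f_int(2)[symmetric]
  proof (rule integral_dominated_convergence[where w = "\<lambda>z. 1 + f z"])
    show "AE z in P. (\<lambda>n. K z * exp (hn n z)) \<longlonglongrightarrow> f z"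
      unfolding f_def by (intro AE_I2 tendsto_mult_left tendsto_exp hn_lim)
    show "AE z in P. norm (K z * exp (hn n z)) \<le> 1 + f z" for n
      using Kexp[of _ n] K(1) by (auto simp: abs_mult less_imp_le)
  qed (use f_int in auto)

  define \<theta> where "\<theta> t z = g z * (ln (g z) - ln (K z * exp t)) - g z + K z * exp t" for t z
  have \<theta>_nonneg: "0 \<le> \<theta> t z" for t z
    unfolding \<theta>_def by (intro young_entropy g_nonneg mult_pos_pos K exp_gt_zero)
  have \<theta>_eq: "\<theta> t z = g z * (ln (g z) + c z / \<epsilon>) - g z * t - g z + K z * exp t" for t z
    using K(1)[of z] by (simp add: \<theta>_def ln_mult ln_K algebra_simps)
  have \<theta>_int: "integrable P (\<lambda>z. \<theta> (hn n z) z)" "(\<integral>z. \<theta> (hn n z) z \<partial>P) = e - m n - 1 + Z n" for n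
  proof -
    have 1: "integrable P (\<lambda>z. g z * (ln (g z) + c z / \<epsilon>))" "(\<integral>z. g z * (ln (g z) + c z / \<epsilon>) \<partial>P) = e"
      using int_e int_\<pi>'[of "\<lambda>z. ln (g z) + c z / \<epsilon>"] by (simp_all add: e_def)
    have 2: "integrable P (\<lambda>z. g z * hn n z)" "(\<integral>z. g z * hn n z \<partial>P) = m n"
      using int_hn(2)[of n] int_\<pi>'[of "hn n"] by (simp_all add: m')
    show "integrable P (\<lambda>z. \<theta> (hn n z) z)"
      unfolding \<theta>_eq by (intro Bochner_Integration.integrable_add Bochner_Integration.integrable_diff 1 2 g_int int_K)
    show "(\<integral>z. \<theta> (hn n z) z \<partial>P) = e - m n - 1 + Z n"
      unfolding \<theta>_eq
      using 1 2 g_int int_K[of n] by (simp add: Z_def del: distrib_left)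
  qed
  have \<theta>_int_nonneg: "0 \<le> e - m n - 1 + Z n" for n
    unfolding \<theta>_int(2)[symmetric] by (intro Bochner_Integration.integral_nonneg \<theta>_nonneg)

  \<comment> \<open>Since x * exp (- x) \<le> 1, the negative part of h is integrable for \<pi> from the start,
    so the upper bound for the integral of hn bounds the integral of its absolute value.\<close>
  have tail: "f z * max 0 (- h z) \<le> 1" for z
  proof (cases "0 \<le> h z")
    case False
    have "1 + (- h z) \<le> exp (- h z)" by (rule exp_ge_add_one_self)
    then have "- h z \<le> exp (- h z)" by linarith
    then have "exp (h z) * (- h z) \<le> exp (h z) * exp (- h z)" by (rule mult_left_mono) simp
    then have "exp (h z) * (- h z) \<le> 1" by (simp add: exp_minus)
    then have "K z * (exp (h z) * (- h z)) \<le> 1 * 1" using K[of z] False by (intro mult_mono) (auto simp: mult_nonneg_nonpos)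
    then show ?thesis using False by (simp add: f_def max_def)
  qed (simp add: max_def)
  have abs_hn: "(\<integral>z. \<bar>hn n z\<bar> \<partial>\<pi>) \<le> e + 3" for n
  proof -
    have "(\<integral>z. \<bar>hn n z\<bar> \<partial>\<pi>) = (\<integral>z. f z * \<bar>hn n z\<bar> \<partial>P)" by (intro int_\<pi>(2)) measurable
    also have "\<dots> \<le> (\<integral>z. f z * hn n z + 2 \<partial>P)"
    proof (intro integral_mono)
      show "integrable P (\<lambda>z. f z * \<bar>hn n z\<bar>)"
        using int_hn(1)[of n] by (subst int_\<pi>(1)[symmetric]) auto
      show "integrable P (\<lambda>z. f z * hn n z + 2)"
        using int_hn(1)[of n] int_\<pi>(1)[of "hn n"] by simp
      fix z
      have "f z * \<bar>hn n z\<bar> \<le> f z * (hn n z + 2 * max 0 (- h z))"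
        by (intro mult_left_mono hn less_imp_le f_pos)
      also have "\<dots> = f z * hn n z + 2 * (f z * max 0 (- h z))" by (simp add: distrib_left)
      finally show "f z * \<bar>hn n z\<bar> \<le> f z * hn n z + 2" using tail[of z] by linarith
    qed
    also have "\<dots> = m n + 2"
      using int_hn(1)[of n] int_\<pi>[of "hn n"] Q.prob_space by (simp add: m_def)
    also have "\<dots> \<le> e + 3" using \<theta>_int_nonneg[of n] Z_le[of n] by simp
    finally show ?thesis .
  qed
  have int_h: "integrable \<pi> h"
  proof (rule integrableI_bounded)
    show "h \<in> borel_measurable \<pi>" by (rule meas_\<pi>) measurable
    have "(\<integral>\<^sup>+ z. ennreal (norm (h z)) \<partial>\<pi>) = (\<integral>\<^sup>+ z. liminf (\<lambda>n. ennreal \<bar>hn n z\<bar>) \<partial>\<pi>)"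
      by (intro nn_integral_cong lim_imp_Liminf[symmetric]) (auto intro!: tendsto_ennrealI tendsto_rabs hn_lim)
    also have "\<dots> \<le> liminf (\<lambda>n. \<integral>\<^sup>+ z. ennreal \<bar>hn n z\<bar> \<partial>\<pi>)"
    proof (intro nn_integral_liminf)
      fix n
      have [measurable]: "hn n \<in> borel_measurable \<pi>" by (rule meas_\<pi>) measurable
      show "(\<lambda>z. ennreal \<bar>hn n z\<bar>) \<in> borel_measurable \<pi>" by measurable
    qed
    also have "\<dots> \<le> liminf (\<lambda>n::nat. ennreal (e + 3))"
    proof (intro Liminf_mono always_eventually allI)
      fix n
      have "(\<integral>\<^sup>+ z. ennreal \<bar>hn n z\<bar> \<partial>\<pi>) = ennreal (\<integral>z. \<bar>hn n z\<bar> \<partial>\<pi>)"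
        using int_hn(1)[of n] by (intro nn_integral_eq_integral) auto
      then show "(\<integral>\<^sup>+ z. ennreal \<bar>hn n z\<bar> \<partial>\<pi>) \<le> ennreal (e + 3)" using abs_hn[of n] by (simp add: ennreal_leI)
    qed
    also have "\<dots> < \<infinity>" by (simp add: Liminf_const)
    finally show "(\<integral>\<^sup>+ z. ennreal (norm (h z)) \<partial>\<pi>) < \<infinity>" .
  qed
  define mh where "mh = (\<integral>z. h z \<partial>\<pi>)"
  have m_lim: "m \<longlonglongrightarrow> mh" unfolding m_def mh_def
  proof (rule integral_dominated_convergence[where w = "\<lambda>z. \<bar>h z\<bar>"])
    show "AE z in \<pi>. (\<lambda>n. hn n z) \<longlonglongrightarrow> h z" by (intro AE_I2 hn_lim)
    show "AE z in \<pi>. norm (hn n z) \<le> \<bar>h z\<bar>" for n by (intro AE_I2) (simp add: hn)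
  qed (use int_h int_hn in auto)
  have lim: "(\<lambda>n. e - m n - 1 + Z n) \<longlonglongrightarrow> e - mh - 1 + 1"
    by (intro tendsto_intros m_lim Z_lim)
  have e_mh: "0 \<le> e - mh"
    using LIMSEQ_le_const[OF lim, of 0] \<theta>_int_nonneg by auto
  have "(\<integral>\<^sup>+ z. ennreal (\<theta> (h z) z) \<partial>P) = (\<integral>\<^sup>+ z. liminf (\<lambda>n. ennreal (\<theta> (hn n z) z)) \<partial>P)"
    unfolding \<theta>_eq
    by (intro nn_integral_cong lim_imp_Liminf[symmetric]) (auto intro!: tendsto_intros hn_lim)
  also have "\<dots> \<le> liminf (\<lambda>n. \<integral>\<^sup>+ z. ennreal (\<theta> (hn n z) z) \<partial>P)"
    using \<theta>_int(1) by (intro nn_integral_liminf) simp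
  also have "\<dots> = liminf (\<lambda>n. ennreal (e - m n - 1 + Z n))"
    by (simp add: nn_integral_eq_integral \<theta>_int \<theta>_nonneg)
  also have "\<dots> = ennreal (e - mh)"
    using lim by (intro lim_imp_Liminf tendsto_ennrealI) auto
  finally have fatou: "(\<integral>\<^sup>+ z. ennreal (\<theta> (h z) z) \<partial>P) \<le> ennreal (e - mh)" .

  have int_neg: "integrable \<pi> (\<lambda>z. max 0 (- ln (f z)))"
  proof (rule integrableI_bounded)
    show "(\<lambda>z. max 0 (- ln (f z))) \<in> borel_measurable \<pi>" by (rule meas_\<pi>) measurable
    have "(\<integral>\<^sup>+ z. ennreal (norm (max 0 (- ln (f z)))) \<partial>\<pi>) = (\<integral>\<^sup>+ z. ennreal (- ln (f z)) \<partial>\<pi>)"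
      by (intro nn_integral_cong) (auto simp: max_def ennreal_neg)
    also have "\<dots> \<le> 1"
      by (rule relative_entropy_density(1)[OF prob_P _ less_imp_le[OF f_pos] dens_f prob(1)]) measurable
    finally show "(\<integral>\<^sup>+ z. ennreal (norm (max 0 (- ln (f z)))) \<partial>\<pi>) < \<infinity>" by (simp add: le_less_trans)
  qed
  \<comment> \<open>From c / \<epsilon> = h - ln f, where only the negative part of ln f can spoil integrability.\<close>
  have "integrable \<pi> (\<lambda>z. c z / \<epsilon>)"
  proof (rule Bochner_Integration.integrable_bound[of _ "\<lambda>z. \<bar>h z\<bar> + max 0 (- ln (f z))"])
    show "AE z in \<pi>. norm (c z / \<epsilon>) \<le> norm (\<bar>h z\<bar> + max 0 (- ln (f z)))"
    proof (rule AE_I2)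
      fix z
      have "0 \<le> c z / \<epsilon>" using c_nonneg[of z] \<epsilon> by simp
      moreover have "c z / \<epsilon> = h z - ln (f z)" by (simp add: ln_f)
      ultimately show "norm (c z / \<epsilon>) \<le> norm (\<bar>h z\<bar> + max 0 (- ln (f z)))" by (auto simp: max_def)
    qed
    show "(\<lambda>z. c z / \<epsilon>) \<in> borel_measurable \<pi>" by (rule meas_\<pi>) measurable
  qed (use int_h int_neg in auto)
  then have int_c\<pi>: "integrable \<pi> c" using integrable_mult_left[of \<epsilon> \<pi> "\<lambda>z. c z / \<epsilon>"] \<epsilon> by simp
  have int_lnf: "integrable \<pi> (\<lambda>z. ln (f z))" unfolding ln_f using int_h \<open>integrable \<pi> (\<lambda>z. c z / \<epsilon>)\<close> by simp
  have cost: "eot_cost c \<epsilon> \<mu> \<nu> \<pi> = ereal (\<epsilon> * mh)"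
  proof -
    have "(\<integral>z. ln (f z) \<partial>\<pi>) = mh - (\<integral>z. c z \<partial>\<pi>) / \<epsilon>"
      unfolding ln_f mh_def using int_h int_c\<pi> by simp
    then show ?thesis using cost_f(2)[OF int_c\<pi> int_lnf] \<epsilon> by (simp add: field_simps)
  qed
  show "eot_cost c \<epsilon> \<mu> \<nu> \<pi> \<le> eot_cost c \<epsilon> \<mu> \<nu> \<pi>'"
    unfolding cost cost' using e_mh \<epsilon> by simp
  assume "eot_cost c \<epsilon> \<mu> \<nu> \<pi>' \<le> eot_cost c \<epsilon> \<mu> \<nu> \<pi>"
  then have "e - mh \<le> 0" unfolding cost cost' using \<epsilon> by simp
  then have "(\<integral>\<^sup>+ z. ennreal (\<theta> (h z) z) \<partial>P) = 0" using fatou by (simp add: ennreal_neg)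
  moreover have "(\<lambda>z. \<theta> (h z) z) \<in> borel_measurable P" unfolding \<theta>_def by measurable
  ultimately have "AE z in P. \<theta> (h z) z \<le> 0"
    by (simp add: nn_integral_0_iff_AE ennreal_eq_0_iff)
  then have "AE z in P. \<theta> (h z) z = 0"
    by eventually_elim (intro antisym \<theta>_nonneg)
  then have "AE z in P. ennreal (g z) = ennreal (f z)"
  proof eventually_elim
    case (elim z)
    have "0 < K z * exp (h z)" using K(1) by simp
    from young_entropy(2)[OF g_nonneg this] elim have "g z = K z * exp (h z)"
      unfolding \<theta>_def .
    then show ?case by (simp add: f_def)
  qed
  then have "density P g = density P f" by (intro density_cong) auto
  then show "\<pi>' = \<pi>" by (simp add: dens_f dens_g)
qed

section \<open>The perturbed Schroedinger system\<close>

lemma ennreal_inverse_antimono: "(a::ennreal) \<le> b \<Longrightarrow> inverse b \<le> inverse a"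
  including ennreal.lifting
  by transfer (auto intro: ereal_inverse_antimono)

lemma tendsto_inverse_ennreal:
  fixes l :: ennreal
  assumes "(f \<longlongrightarrow> l) F"
  shows "((\<lambda>x. inverse (f x)) \<longlongrightarrow> inverse l) F"
proof (rule continuous_on_tendsto_compose[where s = UNIV and f = inverse])
  show "continuous_on UNIV (inverse :: ennreal \<Rightarrow> ennreal)"
    using continuous_on_inverse_ennreal[OF continuous_on_id] .
qed (use assms in auto)

lemma ennreal_inverse_mult_self: "0 < (a::ennreal) \<Longrightarrow> a < top \<Longrightarrow> inverse a * a = 1"
  by (metis divide_ennreal_def ennreal_divide_self mult.commute not_gr_zero)

lemma ennreal_inverse_mult_self_le: "inverse a * (a::ennreal) \<le> 1"
  by (cases "0 < a"; cases "a = top") (auto simp: ennreal_inverse_mult_self less_top)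

text \<open>
  The duality between the two marginal equations: the total mass of the weighted kernel can be
  computed from either side.
\<close>

lemma (in pair_sigma_finite) Fubini_product_weights:
  assumes [measurable]: "K \<in> borel_measurable (M1 \<Otimes>\<^sub>M M2)" "f \<in> borel_measurable M1" "g \<in> borel_measurable M2"
  shows "(\<integral>\<^sup>+ y. (\<integral>\<^sup>+ x. K (x, y) * f x \<partial>M1) * g y \<partial>M2) = (\<integral>\<^sup>+ x. f x * (\<integral>\<^sup>+ y. K (x, y) * g y \<partial>M2) \<partial>M1)"
proof -
  have "(\<integral>\<^sup>+ y. (\<integral>\<^sup>+ x. K (x, y) * f x \<partial>M1) * g y \<partial>M2) = (\<integral>\<^sup>+ y. (\<integral>\<^sup>+ x. K (x, y) * f x * g y \<partial>M1) \<partial>M2)"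
    by (intro nn_integral_cong nn_integral_multc[symmetric]) simp
  also have "\<dots> = (\<integral>\<^sup>+ x. (\<integral>\<^sup>+ y. K (x, y) * f x * g y \<partial>M2) \<partial>M1)"
    using Fubini[of "\<lambda>(x, y). K (x, y) * f x * g y"] by simp
  also have "\<dots> = (\<integral>\<^sup>+ x. f x * (\<integral>\<^sup>+ y. K (x, y) * g y \<partial>M2) \<partial>M1)"
    by (intro nn_integral_cong, subst nn_integral_cmult[symmetric]) (auto intro!: nn_integral_cong simp: mult_ac)
  finally show ?thesis .
qed

lemma nn_integral_pos:
  assumes [measurable]: "f \<in> borel_measurable M" and "AE x in M. 0 < f x" "emeasure M (space M) \<noteq> 0"
  shows "0 < (\<integral>\<^sup>+ x. f x \<partial>M)"
proof (rule ccontr)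
  assume "\<not> ?thesis"
  then have "AE x in M. f x = 0" by (simp add: nn_integral_0_iff_AE)
  with assms(2) have "AE x in M. False" by eventually_elim simp
  then show False using assms(3) by (simp add: AE_iff_null null_sets_def)
qed

text \<open>
  The Schroedinger system asks for \<phi> * \<integral> K \<psi> dN = 1 and \<psi> * \<integral> K \<phi> dM = 1. Eliminating \<phi> = 1 / \<integral> K \<psi> dN
  turns it into a fixed point equation \<psi> = T \<psi>, where T is monotone and positively homogeneous of
  degree one, so that the scale of \<psi> is undetermined and an iteration has no reason to stay bounded.
  The perturbed map (1 - e) * T \<psi> + e fixes the scale: with w = \<integral> K \<phi> dM the identity \<integral> w * \<psi> dN = 1
  gives \<integral> w dN = 1 at a fixed point.

  The iteration starts below its image and increases, so the corresponding w decrease. Comparing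
  \<integral> w_n \<psi>_n dN = 1 with \<integral> w_n \<psi>_(n+1) dN \<le> (1 - e) + e * \<integral> w_n dN shows that \<integral> w_n dN never drops below 1.
  This survives in the limit, whence \<phi> cannot vanish almost everywhere; so \<psi> is finite, and the
  inequalities between the total masses turn into equations, which say that the marginal equations
  hold. All functions are extended nonnegative, with inverse top = 0, so that no limit has to be known
  to be finite in advance.
\<close>

lemma perturbed_schroedinger_system:
  fixes K :: "'a \<times> 'b \<Rightarrow> ennreal" and e :: real
  assumes "prob_space M" "prob_space N"
    and K_meas[measurable]: "K \<in> borel_measurable (M \<Otimes>\<^sub>M N)"
    and K_pos: "\<And>z. 0 < K z" and K_le: "\<And>z. K z \<le> 1" and e: "0 < e" "e < 1"
  obtains \<phi> \<psi> where "\<phi> \<in> borel_measurable M" "\<psi> \<in> borel_measurable N"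
    "AE x in M. \<phi> x * (\<integral>\<^sup>+ y. K (x, y) * \<psi> y \<partial>N) = 1"
    "AE y in N. \<psi> y = ennreal (1 - e) * inverse (\<integral>\<^sup>+ x. K (x, y) * \<phi> x \<partial>M) + ennreal e"
    "(\<integral>\<^sup>+ y. (\<integral>\<^sup>+ x. K (x, y) * \<phi> x \<partial>M) \<partial>N) = 1"
proof -
  interpret M: prob_space M by fact
  interpret N: prob_space N by fact
  interpret pair_sigma_finite M N ..
  define Phi where "Phi \<psi> x = inverse (\<integral>\<^sup>+ y. K (x, y) * \<psi> y \<partial>N)" for \<psi> x
  define W where "W \<phi> y = (\<integral>\<^sup>+ x. K (x, y) * \<phi> x \<partial>M)" for \<phi> y
  define F where "F \<psi> y = ennreal (1 - e) * inverse (W (Phi \<psi>) y) + ennreal e" for \<psi> y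
  define \<psi>s where "\<psi>s n = (F ^^ n) (\<lambda>_. ennreal e)" for n
  have [measurable]: "Phi \<psi> \<in> borel_measurable M" if [measurable]: "\<psi> \<in> borel_measurable N" for \<psi>
    unfolding Phi_def by measurable
  have [measurable]: "W \<phi> \<in> borel_measurable N" if [measurable]: "\<phi> \<in> borel_measurable M" for \<phi>
    unfolding W_def by measurable
  have step: "\<psi>s (Suc n) = F (\<psi>s n)" for n by (simp add: \<psi>s_def)
  have [measurable]: "\<psi>s n \<in> borel_measurable N" for n
  proof (induction n)
    case (Suc n) note Suc.IH[measurable]
    show ?case unfolding step F_def by measurable
  qed (simp add: \<psi>s_def)
  have Phi_anti: "Phi \<psi>' x \<le> Phi \<psi> x" if "\<And>y. \<psi> y \<le> \<psi>' y" for \<psi> \<psi>' x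
    unfolding Phi_def by (intro ennreal_inverse_antimono nn_integral_mono mult_left_mono that) simp
  have W_mono: "W \<phi> y \<le> W \<phi>' y" if "\<And>x. \<phi> x \<le> \<phi>' x" for \<phi> \<phi>' y
    unfolding W_def by (intro nn_integral_mono mult_left_mono that) simp
  have F_mono: "F \<psi> y \<le> F \<psi>' y" if "\<And>y. \<psi> y \<le> \<psi>' y" for \<psi> \<psi>' y
    unfolding F_def by (intro add_right_mono mult_left_mono ennreal_inverse_antimono W_mono Phi_anti that) simp
  have \<psi>s_ge: "ennreal e \<le> \<psi>s n y" for n y
    by (cases n) (simp add: \<psi>s_def, simp add: step F_def)
  have \<psi>s_Suc: "\<psi>s n y \<le> \<psi>s (Suc n) y" for n y
  proof (induction n arbitrary: y)
    case 0 then show ?case using \<psi>s_ge[of "Suc 0" y] by (simp add: \<psi>s_def)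
  next
    case (Suc n) then show ?case unfolding step by (rule F_mono)
  qed
  define I where "I n x = (\<integral>\<^sup>+ y. K (x, y) * \<psi>s n y \<partial>N)" for n x
  define w where "w n = W (Phi (\<psi>s n))" for n
  have [measurable]: "I n \<in> borel_measurable M" "w n \<in> borel_measurable N" for n
    unfolding I_def w_def by measurable
  have Phi_I: "Phi (\<psi>s n) x = inverse (I n x)" for n x by (simp add: Phi_def I_def)
  have \<psi>_pos: "0 < \<psi>s n y" for n y using \<psi>s_ge[of n y] e by (metis ennreal_0 ennreal_less_iff less_le_trans order_le_less)
  have I_pos: "0 < I n x" if "x \<in> space M" for n x
  proof -
    have [measurable]: "(\<lambda>y. K (x, y)) \<in> borel_measurable N" using that by measurable
    show ?thesis
    unfolding I_def using \<psi>_pos K_pos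
    by (intro nn_integral_pos) (auto simp: N.emeasure_space_1 ennreal_zero_less_mult_iff)
  qed
  have w_\<psi>: "(\<integral>\<^sup>+ y. w n y * \<psi>s m y \<partial>N) = (\<integral>\<^sup>+ x. Phi (\<psi>s n) x * I m x \<partial>M)" for n m
    unfolding w_def W_def I_def by (rule Fubini_product_weights) measurable
  have w_le: "ennreal e * (\<integral>\<^sup>+ y. w n y \<partial>N) \<le> 1" for n
  proof -
    have "ennreal e * (\<integral>\<^sup>+ y. w n y \<partial>N) = (\<integral>\<^sup>+ y. ennreal e * w n y \<partial>N)" by (simp add: nn_integral_cmult)
    also have "\<dots> \<le> (\<integral>\<^sup>+ y. w n y * \<psi>s n y \<partial>N)"
      by (subst mult.commute) (intro nn_integral_mono mult_left_mono \<psi>s_ge, simp)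
    also have "\<dots> \<le> (\<integral>\<^sup>+ x. 1 \<partial>M)"
      unfolding w_\<psi> Phi_I by (intro nn_integral_mono ennreal_inverse_mult_self_le)
    finally show ?thesis by (simp add: M.emeasure_space_1)
  qed
  have w_int_fin: "(\<integral>\<^sup>+ y. w n y \<partial>N) < top" for n
    using w_le[of n] e by (cases "\<integral>\<^sup>+ y. w n y \<partial>N") (auto simp: ennreal_mult_top top_unique)
  have w_fin: "AE y in N. w n y < top" for n
    using nn_integral_PInf_AE[of "w n" N] w_int_fin[of n] by (auto simp: less_top)
  \<comment> \<open>Only an inequality, since inverse (w n y) * w n y = 0 where w n y is 0 or infinite.\<close>
  have w_split: "(\<integral>\<^sup>+ y. w n y * \<psi>s (Suc n) y \<partial>N) \<le> ennreal (1 - e) + ennreal e * (\<integral>\<^sup>+ y. w n y \<partial>N)" for n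
  proof -
    have "(\<integral>\<^sup>+ y. w n y * \<psi>s (Suc n) y \<partial>N) \<le> (\<integral>\<^sup>+ y. ennreal (1 - e) + ennreal e * w n y \<partial>N)"
    proof (intro nn_integral_mono)
      fix y
      have "w n y * \<psi>s (Suc n) y = ennreal (1 - e) * (inverse (w n y) * w n y) + ennreal e * w n y"
        by (simp add: step F_def w_def distrib_left mult_ac)
      also have "\<dots> \<le> ennreal (1 - e) * 1 + ennreal e * w n y"
        by (intro add_right_mono mult_left_mono ennreal_inverse_mult_self_le) simp
      finally show "w n y * \<psi>s (Suc n) y \<le> ennreal (1 - e) + ennreal e * w n y" by simp
    qed
    then show ?thesis by (simp add: nn_integral_add nn_integral_cmult N.emeasure_space_1)
  qed
  \<comment> \<open>Finiteness is inherited from one iterate to the next: a positive Phi times an infinite I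
    would make the total mass infinite.\<close>
  have I_fin: "AE x in M. I n x < top" for n
  proof (induction n)
    case 0
    have "I 0 x \<le> ennreal e" for x
    proof -
      have "I 0 x \<le> (\<integral>\<^sup>+ y. 1 * ennreal e \<partial>N)" unfolding I_def \<psi>s_def
        by (intro nn_integral_mono mult_mono K_le) auto
      then show ?thesis by (simp add: N.emeasure_space_1)
    qed
    then show ?case by (intro AE_I2) (metis ennreal_less_top le_less_trans)
  next
    case (Suc n)
    have "(\<integral>\<^sup>+ x. Phi (\<psi>s n) x * I (Suc n) x \<partial>M) = (\<integral>\<^sup>+ y. w n y * \<psi>s (Suc n) y \<partial>N)" by (simp add: w_\<psi>)
    also have "\<dots> \<le> ennreal (1 - e) + ennreal e * (\<integral>\<^sup>+ y. w n y \<partial>N)" by (rule w_split)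
    also have "\<dots> < top" using w_int_fin[of n] by (simp add: ennreal_mult_less_top)
    finally have "(\<integral>\<^sup>+ x. Phi (\<psi>s n) x * I (Suc n) x \<partial>M) < top" .
    then have "AE x in M. Phi (\<psi>s n) x * I (Suc n) x \<noteq> top"
      using nn_integral_PInf_AE[of "\<lambda>x. Phi (\<psi>s n) x * I (Suc n) x" M] by simp
    with Suc show ?case
      by eventually_elim (auto simp: Phi_I ennreal_mult_eq_top_iff less_top)
  qed
  have w_\<psi>_1: "(\<integral>\<^sup>+ y. w n y * \<psi>s n y \<partial>N) = 1" for n
  proof -
    have "(\<integral>\<^sup>+ y. w n y * \<psi>s n y \<partial>N) = (\<integral>\<^sup>+ x. 1 \<partial>M)"
      unfolding w_\<psi> Phi_I
    proof (intro nn_integral_cong_AE)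
      show "AE x in M. inverse (I n x) * I n x = 1" using I_fin[of n] AE_space
        by eventually_elim (auto intro!: ennreal_inverse_mult_self I_pos)
    qed
    then show ?thesis by (simp add: M.emeasure_space_1)
  qed
  have ge1: "1 \<le> a" if "1 \<le> ennreal (1 - e) + ennreal e * a" for a
  proof (cases a)
    case (real r)
    then have "1 \<le> ennreal ((1 - e) + e * r)" using that e
      by (simp add: ennreal_plus ennreal_mult)
    then have "e * 1 \<le> e * r" by simp
    then have "1 \<le> r" using e by simp
    then show ?thesis using real by simp
  qed simp
  have w_ge: "1 \<le> (\<integral>\<^sup>+ y. w n y \<partial>N)" for n
  proof -
    have "1 = (\<integral>\<^sup>+ y. w n y * \<psi>s n y \<partial>N)" by (simp add: w_\<psi>_1)
    also have "\<dots> \<le> (\<integral>\<^sup>+ y. w n y * \<psi>s (Suc n) y \<partial>N)"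
      by (intro nn_integral_mono mult_left_mono \<psi>s_Suc) simp
    also note w_split
    finally show ?thesis by (rule ge1)
  qed
  define \<psi> where "\<psi> y = (SUP n. \<psi>s n y)" for y
  have [measurable]: "\<psi> \<in> borel_measurable N" unfolding \<psi>_def by measurable
  define \<phi> where "\<phi> = Phi \<psi>"
  have [measurable]: "\<phi> \<in> borel_measurable M" unfolding \<phi>_def by measurable
  define J where "J x = (\<integral>\<^sup>+ y. K (x, y) * \<psi> y \<partial>N)" for x
  have [measurable]: "J \<in> borel_measurable M" unfolding J_def by measurable
  have inc: "incseq (\<lambda>n. \<psi>s n y)" for y by (intro incseq_SucI \<psi>s_Suc)
  have I_J: "(\<lambda>n. I n x) \<longlonglongrightarrow> J x" if "x \<in> space M" for x
  proof -
    have [measurable]: "(\<lambda>y. K (x, y)) \<in> borel_measurable N" using that by measurable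
    show ?thesis unfolding I_def J_def
    proof (rule nn_integral_LIMSEQ)
      show "incseq (\<lambda>n y. K (x, y) * \<psi>s n y)"
        by (intro incseq_SucI le_funI mult_left_mono \<psi>s_Suc) simp
      show "(\<lambda>n. K (x, y) * \<psi>s n y) \<longlonglongrightarrow> K (x, y) * \<psi> y" for y
        unfolding \<psi>_def using K_le[of "(x,y)"]
        by (intro ennreal_tendsto_cmult LIMSEQ_SUP inc) (auto simp: le_less_trans)
    qed measurable
  qed
  have Phi_\<phi>: "(\<lambda>n. Phi (\<psi>s n) x) \<longlonglongrightarrow> \<phi> x" if "x \<in> space M" for x
    unfolding \<phi>_def Phi_I unfolding Phi_def J_def[symmetric]
    by (intro tendsto_inverse_ennreal I_J that)
  have Phi_dec: "Phi (\<psi>s n) x \<le> Phi (\<psi>s 0) x" for n x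
    using inc by (intro Phi_anti) (auto simp: incseq_def)
  have w_lim: "(\<lambda>n. w n y) \<longlonglongrightarrow> W \<phi> y" if "w 0 y < top" "y \<in> space N" for y
  proof -
    have [measurable]: "(\<lambda>x. K (x, y)) \<in> borel_measurable M" using that by measurable
    show ?thesis unfolding w_def W_def
    proof (rule nn_integral_dominated_convergence)
      show "(\<integral>\<^sup>+ x. K (x, y) * Phi (\<psi>s 0) x \<partial>M) < \<infinity>" using that by (simp add: w_def W_def)
      show "AE x in M. K (x, y) * Phi (\<psi>s n) x \<le> K (x, y) * Phi (\<psi>s 0) x" for n
        by (intro AE_I2 mult_left_mono Phi_dec) simp
      show "AE x in M. (\<lambda>n. K (x, y) * Phi (\<psi>s n) x) \<longlonglongrightarrow> K (x, y) * \<phi> x"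
        using le_less_trans[OF K_le] by (intro AE_I2 ennreal_tendsto_cmult Phi_\<phi>) auto
    qed measurable
  qed
  have "(\<lambda>n. \<integral>\<^sup>+ y. w n y \<partial>N) \<longlonglongrightarrow> (\<integral>\<^sup>+ y. W \<phi> y \<partial>N)"
  proof (rule nn_integral_dominated_convergence)
    show "(\<integral>\<^sup>+ y. w 0 y \<partial>N) < \<infinity>" using w_int_fin by simp
    show "AE y in N. w n y \<le> w 0 y" for n
      unfolding w_def by (intro AE_I2 W_mono Phi_dec)
    show "AE y in N. (\<lambda>n. w n y) \<longlonglongrightarrow> W \<phi> y"
      using w_fin[of 0] AE_space by eventually_elim (rule w_lim)
  qed measurable
  then have W_ge: "1 \<le> (\<integral>\<^sup>+ y. W \<phi> y \<partial>N)"
    by (rule LIMSEQ_le_const) (use w_ge in auto)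
  have W_fin: "AE y in N. W \<phi> y < top"
    using w_fin[of 0] AE_space
  proof eventually_elim
    case (elim y)
    have "W \<phi> y \<le> w 0 y"
      by (rule LIMSEQ_le_const2[OF w_lim[OF elim]])
        (auto simp: w_def intro!: exI[of _ 0] W_mono Phi_dec)
    with elim show ?case by simp
  qed
  have \<psi>_eq: "AE y in N. \<psi> y = ennreal (1 - e) * inverse (W \<phi> y) + ennreal e"
    using w_fin[of 0] AE_space
  proof eventually_elim
    case (elim y)
    have "(\<lambda>n. \<psi>s (Suc n) y) \<longlonglongrightarrow> ennreal (1 - e) * inverse (W \<phi> y) + ennreal e"
      unfolding step F_def w_def[symmetric]
      by (intro tendsto_add tendsto_const ennreal_tendsto_cmult
          tendsto_inverse_ennreal w_lim elim) simp
    moreover have "(\<lambda>n. \<psi>s (Suc n) y) \<longlonglongrightarrow> \<psi> y"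
      unfolding \<psi>_def by (intro LIMSEQ_Suc LIMSEQ_SUP inc)
    ultimately show ?case by (rule LIMSEQ_unique[symmetric])
  qed
  have "\<not> (AE x in M. \<phi> x = 0)"
  proof
    assume "AE x in M. \<phi> x = 0"
    have "W \<phi> y = 0" if "y \<in> space N" for y
    proof -
      have "W \<phi> y = (\<integral>\<^sup>+ x. 0 \<partial>M)" unfolding W_def
        by (intro nn_integral_cong_AE) (use \<open>AE x in M. \<phi> x = 0\<close> in \<open>eventually_elim, simp\<close>)
      then show ?thesis by simp
    qed
    then have "(\<integral>\<^sup>+ y. W \<phi> y \<partial>N) = (\<integral>\<^sup>+ y. 0 \<partial>N)" by (intro nn_integral_cong)
    with W_ge show False by simp
  qed
  then have W_pos: "0 < W \<phi> y" if "y \<in> space N" for y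
  proof -
    have [measurable]: "(\<lambda>x. K (x, y)) \<in> borel_measurable M" using that by measurable
    have "\<not> (AE x in M. K (x, y) * \<phi> x = 0)"
      using \<open>\<not> (AE x in M. \<phi> x = 0)\<close> K_pos by (simp add: less_le)
    then have "(\<integral>\<^sup>+ x. K (x, y) * \<phi> x \<partial>M) \<noteq> 0" by (subst nn_integral_0_iff_AE) auto
    then show ?thesis unfolding W_def by (simp add: less_le)
  qed
  have "(\<integral>\<^sup>+ y. W \<phi> y * \<psi> y \<partial>N) = (\<integral>\<^sup>+ y. ennreal (1 - e) + ennreal e * W \<phi> y \<partial>N)"
  proof (intro nn_integral_cong_AE)
    show "AE y in N. W \<phi> y * \<psi> y = ennreal (1 - e) + ennreal e * W \<phi> y"
      using \<psi>_eq W_fin AE_space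
    proof eventually_elim
      case (elim y)
      have "W \<phi> y * \<psi> y = ennreal (1 - e) * (inverse (W \<phi> y) * W \<phi> y) + ennreal e * W \<phi> y"
        by (subst elim(1)) (simp add: distrib_left mult_ac)
      also have "inverse (W \<phi> y) * W \<phi> y = 1" using W_pos elim by (intro ennreal_inverse_mult_self) auto
      finally show ?case by simp
    qed
  qed
  also have "\<dots> = ennreal (1 - e) + ennreal e * (\<integral>\<^sup>+ y. W \<phi> y \<partial>N)"
    by (simp add: nn_integral_add nn_integral_cmult N.emeasure_space_1)
  finally have 1: "(\<integral>\<^sup>+ y. W \<phi> y * \<psi> y \<partial>N) = ennreal (1 - e) + ennreal e * (\<integral>\<^sup>+ y. W \<phi> y \<partial>N)" .
  \<comment> \<open>The total mass is at most 1 from one side and at least 1 from the other.\<close>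
  have 2: "(\<integral>\<^sup>+ y. W \<phi> y * \<psi> y \<partial>N) = (\<integral>\<^sup>+ x. \<phi> x * J x \<partial>M)"
    unfolding W_def J_def by (rule Fubini_product_weights) measurable
  have \<phi>J: "\<phi> x * J x \<le> 1" for x
    unfolding \<phi>_def Phi_def J_def by (rule ennreal_inverse_mult_self_le)
  have 3: "(\<integral>\<^sup>+ x. \<phi> x * J x \<partial>M) \<le> (\<integral>\<^sup>+ x. 1 \<partial>M)" by (intro nn_integral_mono \<phi>J)
  have 4: "1 \<le> ennreal (1 - e) + ennreal e * (\<integral>\<^sup>+ y. W \<phi> y \<partial>N)"
  proof -
    have "1 = ennreal (1 - e) + ennreal e * 1" using e by (simp flip: ennreal_plus)
    also have "\<dots> \<le> ennreal (1 - e) + ennreal e * (\<integral>\<^sup>+ y. W \<phi> y \<partial>N)"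
      by (intro add_left_mono mult_left_mono W_ge) simp
    finally show ?thesis .
  qed
  have eq1: "(\<integral>\<^sup>+ x. \<phi> x * J x \<partial>M) = 1"
    using 1 2 3 4 by (simp add: M.emeasure_space_1)
  have W1: "(\<integral>\<^sup>+ y. W \<phi> y \<partial>N) = 1"
  proof -
    have eq: "ennreal (1 - e) + ennreal e * (\<integral>\<^sup>+ y. W \<phi> y \<partial>N) = 1" using 1 2 eq1 by simp
    show ?thesis
    proof (cases "\<integral>\<^sup>+ y. W \<phi> y \<partial>N")
      case (real r)
      then have "ennreal ((1 - e) + e * r) = ennreal 1" using eq e
        by (simp add: ennreal_plus ennreal_mult)
      then have "(1 - e) + e * r = 1" using real e by (subst (asm) ennreal_inj) (auto intro!: add_nonneg_nonneg)
      then show ?thesis using e real by simp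
    next
      case top then show ?thesis using eq e by (simp add: ennreal_mult_top)
    qed
  qed
  have "AE x in M. \<phi> x * J x = 1"
  proof -
    have "(\<integral>\<^sup>+ x. 1 - \<phi> x * J x \<partial>M) = 1 - 1"
      using eq1 \<phi>J by (subst nn_integral_diff) (auto simp: M.emeasure_space_1)
    then have "AE x in M. 1 - \<phi> x * J x = 0" by (simp add: nn_integral_0_iff_AE)
    then show ?thesis
    proof eventually_elim
      case (elim x) then show ?case using \<phi>J[of x] by (metis antisym diff_eq_0_iff_ennreal ennreal_one_less_top linorder_not_le)
    qed
  qed
  with \<psi>_eq W1 show ?thesis
    by (intro that[of \<phi> \<psi>]) (auto simp: J_def W_def)
qed

section \<open>Weak compactness of bounded functions\<close>

lemma nn_integral_le_mult_imp_AE_le: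
  assumes "finite_measure M" and [measurable]: "f \<in> borel_measurable M"
    and le: "\<And>A. A \<in> sets M \<Longrightarrow> (\<integral>\<^sup>+ x\<in>A. f x \<partial>M) \<le> ennreal C * emeasure M A"
  shows "AE x in M. f x \<le> ennreal C"
proof -
  interpret finite_measure M by fact
  define A where "A = {x \<in> space M. ennreal C < f x}"
  have [measurable]: "A \<in> sets M" unfolding A_def by measurable
  have "(\<integral>\<^sup>+ x. (f x - ennreal C) * indicator A x \<partial>M) = (\<integral>\<^sup>+ x. f x * indicator A x - ennreal C * indicator A x \<partial>M)"
    by (intro nn_integral_cong) (auto split: split_indicator)
  also have "\<dots> = (\<integral>\<^sup>+ x\<in>A. f x \<partial>M) - (\<integral>\<^sup>+ x. ennreal C * indicator A x \<partial>M)"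
    by (intro nn_integral_diff) (auto simp: nn_integral_cmult_indicator emeasure_eq_measure ennreal_mult_eq_top_iff A_def split: split_indicator)
  also have "\<dots> = 0"
  proof (rule diff_eq_0_ennreal)
    show *: "(\<integral>\<^sup>+ x\<in>A. f x \<partial>M) \<le> (\<integral>\<^sup>+ x. ennreal C * indicator A x \<partial>M)"
      using le[of A] by (simp add: nn_integral_cmult_indicator)
    show "(\<integral>\<^sup>+ x\<in>A. f x \<partial>M) < top"
      by (rule le_less_trans[OF *]) (simp add: nn_integral_cmult_indicator emeasure_eq_measure ennreal_mult_less_top)
  qed
  finally have "AE x in M. (f x - ennreal C) * indicator A x = 0"
    by (simp add: nn_integral_0_iff_AE)
  with AE_space show ?thesis
  proof eventually_elim
    case (elim x)
    then show ?case by (cases "x \<in> A") (auto simp: A_def diff_eq_0_iff_ennreal)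
  qed
qed

text \<open>
  Uniform boundedness dominates the i-th integral by C * measure M (E i), which is summable, so the
  limit may be taken inside the series.
\<close>

lemma weak_limit_countably_additive:
  fixes f :: "nat \<Rightarrow> 'a \<Rightarrow> real" and E :: "nat \<Rightarrow> 'a set"
  assumes "finite_measure M" and [measurable]: "\<And>n. f n \<in> borel_measurable M"
    and bound: "\<And>n x. \<bar>f n x\<bar> \<le> C"
    and E[measurable]: "\<And>i. E i \<in> sets M" and disj: "disjoint_family E"
    and lim: "\<And>i. (\<lambda>n. LINT x:E i|M. f n x) \<longlonglongrightarrow> l i"
  shows "summable l" "(\<lambda>n. LINT x:(\<Union>i. E i)|M. f n x) \<longlonglongrightarrow> (\<Sum>i. l i)"
proof -
  interpret finite_measure M by fact
  have int: "integrable M (f n)" for n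
    by (rule integrable_const_bound[of _ C]) (use bound in auto)
  have set_int: "set_integrable M A (f n)" if "A \<in> sets M" for n A
    using int that unfolding set_integrable_def by (intro integrable_mult_indicator)
  have *: "(LINT x:(\<Union>i. E i)|M. f n x) = (\<Sum>i. LINT x:E i|M. f n x)" for n
    using disj by (intro lebesgue_integral_countable_add set_int) (auto simp: disjoint_family_on_def)
  have "\<bar>LINT x:E i|M. f n x\<bar> \<le> C * measure M (E i)" for n i
  proof -
    have "\<bar>LINT x:E i|M. f n x\<bar> \<le> (LINT x|M. C * indicator (E i) x)"
      unfolding set_lebesgue_integral_def
      using bound by (intro integral_abs_bound[THEN order_trans] integral_mono integrable_abs integrable_mult_indicator int)
        (auto simp: abs_mult emeasure_eq_measure split: split_indicator)
    then show ?thesis by simp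
  qed
  then have "\<forall>\<^sub>F (i, n) in at_top \<times>\<^sub>F sequentially. norm (LINT x:E i|M. f n x) \<le> C * measure M (E i)"
    by (auto intro: always_eventually)
  moreover have "summable (\<lambda>i. C * measure M (E i))"
    using finite_measure_UNION[OF _ disj] E by (intro summable_mult) (auto simp: sums_iff image_subset_iff)
  ultimately have "summable (\<lambda>i. norm (l i)) \<and> (\<lambda>n. \<Sum>i. LINT x:E i|M. f n x) \<longlonglongrightarrow> suminf l"
    using tannerys_theorem[where F = sequentially and a = "\<lambda>i n. LINT x:E i|M. f n x" and b = l, OF lim] by simp
  then show "summable l" "(\<lambda>n. LINT x:(\<Union>i. E i)|M. f n x) \<longlonglongrightarrow> (\<Sum>i. l i)"
    unfolding * by (auto intro: summable_norm_cancel)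
qed

lemma borel_countable_Int_stable_generator:
  obtains G :: "'a::second_countable_topology set set"
  where "countable G" "Int_stable G" "UNIV \<in> G" "G \<subseteq> sets borel" "sets (borel :: 'a measure) = sigma_sets UNIV G"
proof -
  obtain B :: "'a set set" where B: "countable B" "topological_basis B" using ex_countable_basis by blast
  define G where "G = Inter ` {F. finite F \<and> F \<subseteq> B}"
  have "countable G" unfolding G_def using B(1) by (intro countable_image countable_Collect_finite_subset)
  moreover have "Int_stable G"
  proof (rule Int_stableI)
    fix a b assume "a \<in> G" "b \<in> G"
    then obtain F F' where "finite F" "F \<subseteq> B" "a = \<Inter>F" "finite F'" "F' \<subseteq> B" "b = \<Inter>F'" by (auto simp: G_def)
    then show "a \<inter> b \<in> G" unfolding G_def by (intro image_eqI[where x = "F \<union> F'"]) auto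
  qed
  moreover have "UNIV \<in> G" unfolding G_def by (intro image_eqI[where x = "{}"]) auto
  moreover have G_open: "open g" if "g \<in> G" for g
    using that topological_basis_open[OF B(2)] by (auto simp: G_def)
  moreover have "sets (borel :: 'a measure) = sigma_sets UNIV G"
  proof
    have "sigma_sets UNIV B \<subseteq> sigma_sets UNIV G"
    proof (rule sigma_sets_mono')
      show "B \<subseteq> G" unfolding G_def
      proof
        fix b assume "b \<in> B"
        then show "b \<in> Inter ` {F. finite F \<and> F \<subseteq> B}" by (intro image_eqI[where x = "{b}"]) auto
      qed
    qed
    then show "sets (borel :: 'a measure) \<subseteq> sigma_sets UNIV G"
      by (simp add: borel_eq_countable_basis[OF B])
    show "sigma_sets UNIV G \<subseteq> sets (borel :: 'a measure)"
      using G_open by (intro sets.sigma_sets_subset[of G borel, simplified]) auto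
  qed
  ultimately show ?thesis by (intro that[of G]) auto
qed

text \<open>
  A diagonal sequence makes the integrals over the sets of a countable generator converge. The sets on
  which they converge form a Dynkin system, so the integrals converge over every Borel set; the limit
  is a measure dominated by C * M, and its Radon-Nikodym density is the weak limit. Approximation by
  simple functions passes from sets to integrable test functions.
\<close>

lemma bounded_sequence_weak_limit:
  fixes M :: "'a::second_countable_topology measure" and f :: "nat \<Rightarrow> 'a \<Rightarrow> real"
  assumes "finite_measure M" and sets_M[measurable_cong]: "sets M = sets borel"
    and f[measurable]: "\<And>n. f n \<in> borel_measurable M"
    and bound: "\<And>n x. 0 \<le> f n x" "\<And>n x. f n x \<le> C"
  obtains r g where "strict_mono (r :: nat \<Rightarrow> nat)" "g \<in> borel_measurable M" "\<And>x. 0 \<le> g x" "\<And>x. g x \<le> C"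
    "\<And>h. integrable M h \<Longrightarrow> (\<lambda>n. \<integral>x. f (r n) x * h x \<partial>M) \<longlonglongrightarrow> (\<integral>x. g x * h x \<partial>M)"
proof -
  interpret finite_measure M by fact
  have space_M[simp]: "space M = UNIV" using sets_eq_imp_space_eq[OF sets_M] by simp
  have C: "0 \<le> C" using bound[of 0 undefined] by linarith
  have abs_bound: "\<bar>f n x\<bar> \<le> C" for n x using bound[of n x] by auto
  obtain G :: "'a set set" where G: "countable G" "Int_stable G" "UNIV \<in> G" "G \<subseteq> sets borel"
    "sets (borel :: 'a measure) = sigma_sets UNIV G" by (rule borel_countable_Int_stable_generator)
  have int: "integrable M (f n)" for n
    by (rule integrable_const_bound[of _ C]) (use abs_bound in auto)
  have le: "0 \<le> (LINT x:A|M. f n x)" "(LINT x:A|M. f n x) \<le> C * measure M A" if "A \<in> sets M" for n A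
  proof -
    show "0 \<le> (LINT x:A|M. f n x)" unfolding set_lebesgue_integral_def by (intro Bochner_Integration.integral_nonneg) (auto simp: bound split: split_indicator)
    have "(LINT x:A|M. f n x) \<le> (LINT x|M. C * indicator A x)"
      unfolding set_lebesgue_integral_def
      using bound that by (intro integral_mono integrable_mult_indicator int)
        (auto simp: emeasure_eq_measure split: split_indicator)
    then show "(LINT x:A|M. f n x) \<le> C * measure M A" using that by simp
  qed
  have "\<exists>r. strict_mono (r :: nat \<Rightarrow> nat) \<and> (\<forall>A\<in>G. \<exists>l. (\<lambda>n. LINT x:A|M. f (r n) x) \<longlonglongrightarrow> l)"
  proof -
    have "norm (LINT x:A|M. f n x) \<le> C * measure M UNIV" if "A \<in> G" for n A
    proof -
      have "A \<in> sets M" using that G(4) sets_M by auto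
      have "C * measure M A \<le> C * measure M UNIV"
        by (intro mult_left_mono C bounded_measure[of A, simplified])
      with le[OF \<open>A \<in> sets M\<close>, of n] show ?thesis by auto
    qed
    then show ?thesis
      using function_convergent_subsequence[OF G(1), of "\<lambda>n A. LINT x:A|M. f n x" "C * measure M UNIV"] by metis
  qed
  then obtain r where r: "strict_mono (r :: nat \<Rightarrow> nat)"
    and conv_G: "\<And>A. A \<in> G \<Longrightarrow> convergent (\<lambda>n. LINT x:A|M. f (r n) x)"
    by (auto simp: convergent_def)
  have set_int: "set_integrable M A (f n)" if "A \<in> sets M" for n A
    using int that unfolding set_integrable_def by (intro integrable_mult_indicator)
  have conv: "convergent (\<lambda>n. LINT x:A|M. f (r n) x)" if A: "A \<in> sets M" for A
  proof -
    have "A \<in> sigma_sets UNIV G" using A by (simp add: sets_M G(5))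
    with G(2) subset_UNIV[of G, unfolded Pow_UNIV[symmetric]] show ?thesis
    proof (induction rule: sigma_sets_induct_disjoint)
      case (basic A) then show ?case by (rule conv_G)
    next
      case empty show ?case by (simp add: set_lebesgue_integral_def convergent_const)
    next
      case (compl A)
      then have [measurable]: "A \<in> sets M" by (simp add: sets_M G(5))
      have "(LINT x:UNIV - A|M. f n x) = (LINT x:UNIV|M. f n x) - (LINT x:A|M. f n x)" for n
      proof -
        have "(LINT x:A \<union> (UNIV - A)|M. f n x) = (LINT x:A|M. f n x) + (LINT x:UNIV - A|M. f n x)"
          by (rule set_integral_Un) (auto intro!: set_int)
        then show ?thesis by simp
      qed
      then show ?case using convergent_diff[OF conv_G[OF G(3)] compl(2)] by simp
    next
      case (union A)
      then have A: "A i \<in> sets M" for i by (auto simp: sets_M G(5))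
      from union(3) obtain l where "\<And>i. (\<lambda>n. LINT x:A i|M. f (r n) x) \<longlonglongrightarrow> l i"
        unfolding convergent_def by metis
      from weak_limit_countably_additive(2)[OF \<open>finite_measure M\<close> f abs_bound A union(1) this]
      show ?case by (auto simp: convergent_def)
    qed
  qed
  define l where "l A = lim (\<lambda>n. LINT x:A|M. f (r n) x)" for A
  have l: "(\<lambda>n. LINT x:A|M. f (r n) x) \<longlonglongrightarrow> l A" if "A \<in> sets M" for A
    using conv[OF that] by (simp add: l_def convergent_LIMSEQ_iff)
  have l_nonneg: "0 \<le> l A" and l_le: "l A \<le> C * measure M A" if "A \<in> sets M" for A
    using l[OF that] le[OF that] by (auto intro: LIMSEQ_le_const LIMSEQ_le_const2)
  define N where "N = measure_of UNIV (sets M) (\<lambda>A. ennreal (l A))"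
  have sets_N: "sets N = sets M" unfolding N_def using sets.sigma_sets_eq[of M] by simp
  have em_N: "emeasure N A = ennreal (l A)" if "A \<in> sets M" for A
  proof (rule emeasure_measure_of[OF N_def])
    show "A \<in> sets N" using that by (simp add: sets_N)
    show "positive (sets N) (\<lambda>A. ennreal (l A))"
    proof -
      have "l {} = 0" using LIMSEQ_unique[OF l[of "{}"], of 0] by (simp add: set_lebesgue_integral_def)
      then show ?thesis by (simp add: positive_def)
    qed
    show "countably_additive (sets N) (\<lambda>A. ennreal (l A))"
    proof (rule countably_additiveI)
      fix A :: "nat \<Rightarrow> 'a set" assume "range A \<subseteq> sets N" and disj: "disjoint_family A"
      then have A: "A i \<in> sets M" for i by (auto simp: sets_N)
      note W = weak_limit_countably_additive[OF \<open>finite_measure M\<close> f abs_bound A disj l[OF A]]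
      have "l (\<Union>i. A i) = (\<Sum>i. l (A i))"
        using A by (intro LIMSEQ_unique[OF l W(2)]) auto
      then show "(\<Sum>i. ennreal (l (A i))) = ennreal (l (\<Union>i. A i))"
        using W(1) l_nonneg[OF A] by (simp add: suminf_ennreal2)
    qed
  qed (auto simp: sets.sets_into_space)
  have "absolutely_continuous M N"
    unfolding absolutely_continuous_def
  proof
    fix A assume A: "A \<in> null_sets M"
    then have "l A \<le> 0" using l_le[of A] by (auto simp: null_sets_def measure_def)
    with A show "A \<in> null_sets N" by (auto simp: null_sets_def sets_N em_N ennreal_neg)
  qed
  then obtain d where d[measurable]: "d \<in> borel_measurable M" and dN: "density M d = N"
    using Radon_Nikodym[of N] sets_N by auto
  have int_d: "(\<integral>\<^sup>+ x\<in>A. d x \<partial>M) = ennreal (l A)" if [measurable]: "A \<in> sets M" for A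
    using em_N[OF that] by (simp add: dN[symmetric] emeasure_density)
  have "AE x in M. d x \<le> ennreal C"
  proof (rule nn_integral_le_mult_imp_AE_le[OF \<open>finite_measure M\<close> d])
    fix A assume "A \<in> sets M"
    then show "(\<integral>\<^sup>+ x\<in>A. d x \<partial>M) \<le> ennreal C * emeasure M A"
      using l_le[of A] C by (simp add: int_d emeasure_eq_measure ennreal_mult[symmetric])
  qed
  \<comment> \<open>Truncation makes the bound hold everywhere instead of almost everywhere.\<close>
  define g where "g x = enn2real (min (d x) (ennreal C))" for x
  have [measurable]: "g \<in> borel_measurable M" unfolding g_def by measurable
  have g: "0 \<le> g x" "g x \<le> C" for x
    using C by (simp_all add: g_def enn2real_leI)
  have int_k: "integrable M (\<lambda>x. k x * h x)"
    if [measurable]: "k \<in> borel_measurable M" and k: "\<And>x. 0 \<le> k x" "\<And>x. k x \<le> C" and h: "integrable M h" for k h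
  proof (rule Bochner_Integration.integrable_bound)
    show "integrable M (\<lambda>x. C * h x)" using h by simp
    have [measurable]: "h \<in> borel_measurable M" using h by simp
    show "(\<lambda>x. k x * h x) \<in> borel_measurable M" by measurable
    show "AE x in M. norm (k x * h x) \<le> norm (C * h x)"
      using k C by (auto simp: abs_mult intro!: AE_I2 mult_right_mono)
  qed
  note int_f = int_k[OF f bound] and int_g = int_k[OF \<open>g \<in> borel_measurable M\<close> g]
  have l_g: "l A = (LINT x:A|M. g x)" if [measurable]: "A \<in> sets M" for A
  proof -
    have "integrable M (\<lambda>x. g x * indicator A x)"
      by (intro int_g) (simp add: emeasure_eq_measure)
    then have "ennreal (LINT x:A|M. g x) = (\<integral>\<^sup>+ x. ennreal (g x * indicator A x) \<partial>M)"
      using g by (subst nn_integral_eq_integral) (auto simp: set_lebesgue_integral_def mult.commute)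
    also have "\<dots> = (\<integral>\<^sup>+ x\<in>A. ennreal (g x) \<partial>M)"
      by (intro nn_integral_cong) (simp split: split_indicator)
    also have "\<dots> = (\<integral>\<^sup>+ x\<in>A. d x \<partial>M)"
      using \<open>AE x in M. d x \<le> ennreal C\<close>
      by (intro nn_integral_cong_AE, eventually_elim) (auto simp: g_def min_def top_unique le_less_trans)
    also have "\<dots> = ennreal (l A)" by (rule int_d) fact
    finally show ?thesis using l_nonneg[OF that] g
      by (subst (asm) ennreal_inj) (auto simp: set_lebesgue_integral_def intro!: Bochner_Integration.integral_nonneg)
  qed
  have "(\<lambda>n. \<integral>x. f (r n) x * h x \<partial>M) \<longlonglongrightarrow> (\<integral>x. g x * h x \<partial>M)" if "integrable M h" for h
    using that
  proof (induction h)
    case (base A c)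
    from tendsto_mult_right[OF l[OF base(1)], of c] show ?case
      unfolding l_g[OF base(1)] by (simp add: set_lebesgue_integral_def mult_ac)
  next
    case (add h h')
    then show ?case by (simp add: distrib_left int_f int_g tendsto_add)
  next
    case (lim h s)
    have conv: "(\<lambda>i. \<integral>x. \<bar>s i x - h x\<bar> \<partial>M) \<longlonglongrightarrow> (\<integral>x. 0 \<partial>M)"
    proof (rule integral_dominated_convergence[where w = "\<lambda>x. 3 * \<bar>h x\<bar>"])
      show "AE x in M. (\<lambda>i. \<bar>s i x - h x\<bar>) \<longlonglongrightarrow> 0"
        by (intro AE_I2 tendsto_rabs_zero LIM_zero lim.hyps(2))
      show "AE x in M. norm \<bar>s i x - h x\<bar> \<le> 3 * \<bar>h x\<bar>" for i
      proof (rule AE_I2)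
        fix x assume "x \<in> space M"
        then show "norm \<bar>s i x - h x\<bar> \<le> 3 * \<bar>h x\<bar>" using lim.hyps(3)[of x i] by simp
      qed
    qed (use lim in auto)
    have approx: "\<bar>(\<integral>x. k x * h x \<partial>M) - (\<integral>x. k x * s i x \<partial>M)\<bar> \<le> C * (\<integral>x. \<bar>s i x - h x\<bar> \<partial>M)"
      if [measurable]: "k \<in> borel_measurable M" and k: "\<And>x. 0 \<le> k x" "\<And>x. k x \<le> C" for k i
    proof -
      note int_k = int_k[OF that]
      have "\<bar>(\<integral>x. k x * h x \<partial>M) - (\<integral>x. k x * s i x \<partial>M)\<bar> = \<bar>\<integral>x. k x * (h x - s i x) \<partial>M\<bar>"
        using lim int_k by (simp add: right_diff_distrib)
      also have "\<dots> \<le> (\<integral>x. \<bar>k x * (h x - s i x)\<bar> \<partial>M)" by (rule integral_abs_bound)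
      also have "\<dots> \<le> (\<integral>x. C * \<bar>s i x - h x\<bar> \<partial>M)"
        using lim k by (intro integral_mono integrable_abs int_k)
          (auto simp: abs_mult abs_minus_commute intro!: mult_right_mono)
      finally show ?thesis by simp
    qed
    show ?case
    proof (rule LIMSEQ_I)
      fix e :: real assume "0 < e"
      have "(\<lambda>i. C * (\<integral>x. \<bar>s i x - h x\<bar> \<partial>M)) \<longlonglongrightarrow> C * 0"
        using conv by (intro tendsto_mult_left) simp
      then have "\<forall>\<^sub>F i in sequentially. C * (\<integral>x. \<bar>s i x - h x\<bar> \<partial>M) < e / 3"
        using \<open>0 < e\<close> by (intro order_tendstoD(2)) auto
      then obtain i where i: "C * (\<integral>x. \<bar>s i x - h x\<bar> \<partial>M) < e / 3" by (auto simp: eventually_sequentially)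
      obtain n0 where n0: "\<And>n. n \<ge> n0 \<Longrightarrow> \<bar>(\<integral>x. f (r n) x * s i x \<partial>M) - (\<integral>x. g x * s i x \<partial>M)\<bar> < e / 3"
        using LIMSEQ_D[OF lim.IH, of "e / 3" i] \<open>0 < e\<close> by auto
      show "\<exists>no. \<forall>n\<ge>no. norm ((\<integral>x. f (r n) x * h x \<partial>M) - (\<integral>x. g x * h x \<partial>M)) < e"
      proof (intro exI allI impI)
        fix n assume "n \<ge> n0"
        from n0[OF this] approx[OF f bound, of "r n" i] approx[OF \<open>g \<in> borel_measurable M\<close> g, of i] i
        show "norm ((\<integral>x. f (r n) x * h x \<partial>M) - (\<integral>x. g x * h x \<partial>M)) < e"
          unfolding real_norm_def abs_less_iff abs_le_iff by linarith
      qed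
    qed
  qed
  with r g show ?thesis by (intro that[of r g]) auto
qed

section \<open>Lower bounds of product form\<close>

text \<open>
  Finite Borel measures on Polish spaces are inner regular with respect to compact sets.
\<close>

lemma polish_exhaustion_by_compacts:
  fixes M :: "'a::polish_space measure"
  assumes "finite_measure M" "sets M = sets borel"
  obtains C :: "nat \<Rightarrow> 'a set" where "\<And>n. compact (C n)" "incseq C" "AE x in M. \<exists>n. x \<in> C n"
proof -
  interpret finite_measure M by fact
  have [simp]: "space M = UNIV" using sets_eq_imp_space_eq[OF assms(2)] by simp
  have reg: "emeasure M UNIV = (SUP K\<in>{K. K \<subseteq> UNIV \<and> compact K}. emeasure M K)"
    by (rule inner_regular) (use assms in \<open>auto simp: emeasure_eq_measure\<close>)
  have "\<exists>K. compact K \<and> measure M (- K) < 1 / Suc n" for n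
  proof (rule ccontr)
    assume neg: "\<not> ?thesis"
    have "emeasure M K \<le> ennreal (measure M UNIV - 1 / Suc n)" if "compact K" for K
    proof -
      have "K \<in> sets M" using that assms(2) by (simp add: compact_imp_closed)
      then have "measure M (- K) = measure M UNIV - measure M K"
        using finite_measure_compl[of K] by (simp add: Compl_eq_Diff_UNIV)
      then show ?thesis using neg that by (auto simp: emeasure_eq_measure not_less intro!: ennreal_leI)
    qed
    then have "emeasure M UNIV \<le> ennreal (measure M UNIV - 1 / Suc n)"
      unfolding reg by (intro SUP_least) auto
    moreover have "1 / Suc n \<le> measure M UNIV" using neg[simplified, rule_format, of "{}"] by (simp add: not_less)
    ultimately show False by (simp add: emeasure_eq_measure)
  qed
  then obtain K where K: "\<And>n. compact (K n)" "\<And>n. measure M (- K n) < 1 / Suc n" by metis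
  have K_sets: "K n \<in> sets M" for n using K(1) assms(2) by (simp add: compact_imp_closed)
  have compl_sets: "- (\<Union>n. K n) \<in> sets M" "- K n \<in> sets M" for n
    using K_sets by (auto simp: Compl_eq_Diff_UNIV assms(2))
  have null: "measure M (- (\<Union>n. K n)) \<le> inverse (real (Suc n))" for n
  proof -
    have "measure M (- (\<Union>n. K n)) \<le> measure M (- K n)"
      by (intro finite_measure_mono compl_sets) auto
    also have "\<dots> \<le> inverse (real (Suc n))" using K(2)[of n] by (simp add: inverse_eq_divide)
    finally show ?thesis .
  qed
  have "measure M (- (\<Union>n. K n)) \<le> 0"
    by (rule LIMSEQ_le_const[OF LIMSEQ_inverse_real_of_nat]) (use null in blast)
  then have "measure M (- (\<Union>n. K n)) = 0" by (simp add: antisym)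
  then have "AE x in M. x \<in> (\<Union>n. K n)"
    using compl_sets by (intro AE_I[of _ _ "- (\<Union>n. K n)"]) (auto simp: emeasure_eq_measure)
  then have "AE x in M. \<exists>n. x \<in> (\<Union>i\<le>n. K i)" by eventually_elim auto
  moreover have "compact (\<Union>i\<le>n. K i)" for n using K(1) by (intro compact_UN) auto
  moreover have "incseq (\<lambda>n. \<Union>i\<le>n. K i)" by (intro incseq_SucI UN_mono) auto
  ultimately show ?thesis by (intro that[of "\<lambda>n. \<Union>i\<le>n. K i"])
qed

text \<open>
  Exhaust the two spaces up to null sets by increasing compact sets C n and D n, and choose positive
  constants \<kappa> n \<le> 1, decreasing in n, below the minimum of K on C n \<times> D n. If m and l are the first
  indices with x \<in> C m and y \<in> D l, then K (x, y) \<ge> \<kappa> (max m l) \<ge> \<kappa> m * \<kappa> l, which has product form.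
\<close>

lemma product_lower_bound:
  fixes K :: "'a::polish_space \<times> 'b::polish_space \<Rightarrow> real"
  assumes "finite_measure \<mu>" "finite_measure \<nu>"
    and [measurable_cong]: "sets \<mu> = sets borel" "sets \<nu> = sets borel"
    and cont: "continuous_on UNIV K" and K_pos: "\<And>z. 0 < K z"
  obtains A B where "A \<in> borel_measurable \<mu>" "B \<in> borel_measurable \<nu>"
    "\<And>x. 0 \<le> A x" "\<And>x. A x \<le> 1" "\<And>y. 0 \<le> B y" "\<And>y. B y \<le> 1"
    "AE x in \<mu>. 0 < A x" "AE y in \<nu>. 0 < B y" "\<And>x y. A x * B y \<le> K (x, y)"
proof -
  obtain C where C: "\<And>n. compact (C n)" "incseq C" "AE x in \<mu>. \<exists>n. x \<in> C n"
    using polish_exhaustion_by_compacts[OF assms(1,3)] by blast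
  obtain D where D: "\<And>n. compact (D n)" "incseq D" "AE y in \<nu>. \<exists>n. y \<in> D n"
    using polish_exhaustion_by_compacts[OF assms(2,4)] by blast
  have "\<exists>k>0. k \<le> 1 \<and> (\<forall>z\<in>C n \<times> D n. k \<le> K z)" for n
  proof (cases "C n \<times> D n = {}")
    case False
    then obtain z where z: "z \<in> C n \<times> D n" "\<forall>z'\<in>C n \<times> D n. K z \<le> K z'"
      using continuous_attains_inf[OF compact_Times[OF C(1) D(1)], of n n K] continuous_on_subset[OF cont] by auto
    show ?thesis
      by (rule exI[of _ "min 1 (K z)"]) (use z K_pos in \<open>auto intro: min.coboundedI2\<close>)
  qed (auto intro: exI[of _ 1])
  then obtain k where k: "\<And>n. 0 < k n" "\<And>n. k n \<le> 1" "\<And>n z. z \<in> C n \<times> D n \<Longrightarrow> k n \<le> K z" by metis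
  define \<kappa> where "\<kappa> n = (\<Prod>i\<le>n. k i)" for n
  have \<kappa>_pos: "0 < \<kappa> n" for n unfolding \<kappa>_def by (intro prod_pos) (simp add: k)
  have \<kappa>_le1: "\<kappa> n \<le> 1" for n unfolding \<kappa>_def by (intro prod_le_1) (simp add: k less_imp_le)
  have \<kappa>_le: "\<kappa> n \<le> k n" for n
  proof -
    have "\<kappa> n = k n * (\<Prod>i<n. k i)" by (simp add: \<kappa>_def lessThan_Suc_atMost[symmetric] mult.commute)
    also have "\<dots> \<le> k n * 1" using k by (intro mult_left_mono prod_le_1) (auto simp: less_imp_le)
    finally show ?thesis by simp
  qed
  define A where "A x = (if \<exists>n. x \<in> C n then \<kappa> (LEAST n. x \<in> C n) else 0)" for x
  define B where "B y = (if \<exists>n. y \<in> D n then \<kappa> (LEAST n. y \<in> D n) else 0)" for y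
  have [measurable]: "C n \<in> sets \<mu>" "D n \<in> sets \<nu>" for n
    using C(1) D(1) by (simp_all add: assms compact_imp_closed)
  have [measurable]: "\<kappa> \<in> borel_measurable (count_space UNIV)" by simp
  have "A \<in> borel_measurable \<mu>" "B \<in> borel_measurable \<nu>" unfolding A_def B_def by measurable
  moreover have "A x * B y \<le> K (x, y)" for x y
  proof (cases "(\<exists>n. x \<in> C n) \<and> (\<exists>n. y \<in> D n)")
    case True
    define m where "m = (LEAST n. x \<in> C n)"
    define l where "l = (LEAST n. y \<in> D n)"
    have "x \<in> C m" "y \<in> D l" using True unfolding m_def l_def by (auto intro: LeastI_ex)
    then have "(x, y) \<in> C (max m l) \<times> D (max m l)"
      using incseqD[OF C(2), of m "max m l"] incseqD[OF D(2), of l "max m l"] by auto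
    then have "k (max m l) \<le> K (x, y)" by (rule k)
    moreover have "\<kappa> m * \<kappa> l \<le> \<kappa> (max m l)"
      using \<kappa>_pos[of m] \<kappa>_pos[of l] \<kappa>_le1[of m] \<kappa>_le1[of l]
      by (cases "m \<le> l") (simp_all add: mult_left_le mult_left_le_one_le)
    ultimately show ?thesis using True \<kappa>_le[of "max m l"] by (simp add: A_def B_def m_def l_def)
  qed (use K_pos in \<open>auto simp: A_def B_def less_imp_le\<close>)
  moreover have "AE x in \<mu>. 0 < A x" using C(3) by eventually_elim (simp add: A_def \<kappa>_pos)
  moreover have "AE x in \<nu>. 0 < B x" using D(3) by eventually_elim (simp add: B_def \<kappa>_pos)
  ultimately show ?thesis
    using \<kappa>_pos \<kappa>_le1 by (intro that[of A B]) (auto simp: A_def B_def less_imp_le)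
qed

section \<open>Existence\<close>

lemma measure_sublevel_tendsto_0:
  fixes A :: "'a \<Rightarrow> real"
  assumes "finite_measure M" and [measurable]: "A \<in> borel_measurable M" and pos: "AE x in M. 0 < A x"
  shows "(\<lambda>m. measure M {x \<in> space M. A x < 1 / Suc m}) \<longlonglongrightarrow> 0"
proof -
  interpret finite_measure M by fact
  have "(\<lambda>m. measure M {x \<in> space M. A x < 1 / Suc m}) \<longlonglongrightarrow> measure M (\<Inter>m. {x \<in> space M. A x < 1 / Suc m})"
  proof (rule finite_Lim_measure_decseq)
    show "decseq (\<lambda>m. {x \<in> space M. A x < 1 / Suc m})"
    proof (rule decseq_SucI, safe)
      fix m x assume "A x < 1 / Suc (Suc m)"
      also have "\<dots> \<le> 1 / Suc m" by (intro divide_left_mono) auto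
      finally show "A x < 1 / Suc m" .
    qed
  qed auto
  also have "measure M (\<Inter>m. {x \<in> space M. A x < 1 / Suc m}) = 0"
  proof -
    have "AE x in M. x \<notin> (\<Inter>m. {x \<in> space M. A x < 1 / Suc m})"
      using pos
    proof eventually_elim
      case (elim x)
      obtain m where "inverse (real (Suc m)) < A x" using reals_Archimedean[OF elim] by auto
      then have "\<not> A x < 1 / Suc m" by (simp add: inverse_eq_divide)
      then show ?case by blast
    qed
    then have "(\<Inter>m. {x \<in> space M. A x < 1 / Suc m}) \<in> null_sets M"
      by (subst (asm) AE_iff_null_sets[symmetric]) auto
    then show ?thesis by (simp add: null_sets_def measure_def)
  qed
  finally show ?thesis .
qed

lemma prob_space_eqI_le:
  assumes "prob_space M" "prob_space N" "sets N = sets M"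
    and le: "\<And>E. E \<in> sets M \<Longrightarrow> emeasure N E \<le> emeasure M E"
  shows "N = M"
proof (rule measure_eqI)
  interpret M: prob_space M by fact
  interpret N: prob_space N by fact
  fix E assume "E \<in> sets N"
  then have E: "E \<in> sets M" "E \<in> sets N" using assms by auto
  have sp: "space N = space M" using assms by (intro sets_eq_imp_space_eq)
  have "measure N E \<le> measure M E" "measure N (space M - E) \<le> measure M (space M - E)"
    using le[OF E(1)] le[of "space M - E"] E by (auto simp: M.emeasure_eq_measure N.emeasure_eq_measure)
  moreover have "measure N (space M - E) = 1 - measure N E" "measure M (space M - E) = 1 - measure M E"
    using N.prob_compl[OF E(2)] M.prob_compl[OF E(1)] sp by auto
  ultimately show "emeasure N E = emeasure M E" by (simp add: M.emeasure_eq_measure N.emeasure_eq_measure)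
qed (use assms in auto)

text \<open>
  Products of weakly convergent sequences need not converge weakly, but here the factors depend on
  different variables: integrating the second factor against the sections of G turns its weak
  convergence into bounded pointwise convergence of functions of x, which may be paired with the weakly
  convergent first factor.
\<close>

lemma (in pair_prob_space) weak_limit_product:
  fixes u :: "nat \<Rightarrow> 'a \<Rightarrow> real" and v :: "nat \<Rightarrow> 'b \<Rightarrow> real" and G :: "'a \<times> 'b \<Rightarrow> real"
  assumes [measurable]: "\<And>n. u n \<in> borel_measurable M1" "\<And>n. v n \<in> borel_measurable M2"
      "u' \<in> borel_measurable M1" "v' \<in> borel_measurable M2" "G \<in> borel_measurable (M1 \<Otimes>\<^sub>M M2)"
    and bound: "\<And>n x. \<bar>u n x\<bar> \<le> C" "\<And>n y. \<bar>v n y\<bar> \<le> C" "\<And>x. \<bar>u' x\<bar> \<le> C" "\<And>y. \<bar>v' y\<bar> \<le> C" "\<And>z. \<bar>G z\<bar> \<le> D"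
    and lim_u: "\<And>h. integrable M1 h \<Longrightarrow> (\<lambda>n. \<integral>x. u n x * h x \<partial>M1) \<longlonglongrightarrow> (\<integral>x. u' x * h x \<partial>M1)"
    and lim_v: "\<And>h. integrable M2 h \<Longrightarrow> (\<lambda>n. \<integral>y. v n y * h y \<partial>M2) \<longlonglongrightarrow> (\<integral>y. v' y * h y \<partial>M2)"
  shows "(\<lambda>n. \<integral>z. u n (fst z) * v n (snd z) * G z \<partial>(M1 \<Otimes>\<^sub>M M2)) \<longlonglongrightarrow> (\<integral>z. u' (fst z) * v' (snd z) * G z \<partial>(M1 \<Otimes>\<^sub>M M2))"
proof -
  have C: "0 \<le> C" using bound(1)[of 0 undefined] by (meson abs_ge_zero order_trans)
  have D: "0 \<le> D" using bound(5)[of undefined] by (meson abs_ge_zero order_trans)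
  define k where "k n x = (\<integral>y. v n y * G (x, y) \<partial>M2)" for n x
  define k' where "k' x = (\<integral>y. v' y * G (x, y) \<partial>M2)" for x
  have [measurable]: "k n \<in> borel_measurable M1" "k' \<in> borel_measurable M1" for n
    unfolding k_def k'_def by measurable
  have prod_bound: "\<bar>a * b\<bar> \<le> C * D" if "\<bar>a\<bar> \<le> C" "\<bar>b\<bar> \<le> D" for a b :: real
    unfolding abs_mult using that C by (intro mult_mono) auto
  have G_int: "integrable M2 (\<lambda>y. G (x, y))" if "x \<in> space M1" for x
  proof (rule M2.integrable_const_bound[of _ D])
    show "(\<lambda>y. G (x, y)) \<in> borel_measurable M2" using that by measurable
  qed (simp add: bound)
  have int_bound: "\<bar>\<integral>y. w y * G (x, y) \<partial>M2\<bar> \<le> C * D"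
    if "w \<in> borel_measurable M2" and w: "\<And>y. \<bar>w y\<bar> \<le> C" and x: "x \<in> space M1" for w x
  proof -
    have "\<bar>\<integral>y. w y * G (x, y) \<partial>M2\<bar> \<le> (\<integral>y. \<bar>w y * G (x, y)\<bar> \<partial>M2)" by (rule integral_abs_bound)
    also have "\<dots> \<le> (\<integral>y. C * D \<partial>M2)"
    proof (rule integral_mono_AE')
      show "AE y in M2. \<bar>w y * G (x, y)\<bar> \<le> C * D" by (intro AE_I2 prod_bound w bound)
    qed (auto simp: C D)
    finally show ?thesis by (simp add: M2.prob_space)
  qed
  have k_bound: "\<bar>k n x\<bar> \<le> C * D" "\<bar>k' x\<bar> \<le> C * D" if "x \<in> space M1" for n x
    unfolding k_def k'_def using that bound by (auto intro!: int_bound)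
  have k_int: "integrable M1 (k n)" "integrable M1 k'" for n
    by (rule M1.integrable_const_bound[of _ "C * D"]; auto intro!: AE_I2 k_bound)+
  have Fub: "(\<integral>z. a (fst z) * b (snd z) * G z \<partial>(M1 \<Otimes>\<^sub>M M2)) = (\<integral>x. a x * (\<integral>y. b y * G (x, y) \<partial>M2) \<partial>M1)"
    if [measurable]: "a \<in> borel_measurable M1" "b \<in> borel_measurable M2"
      and a: "\<And>x. \<bar>a x\<bar> \<le> C" and b: "\<And>y. \<bar>b y\<bar> \<le> C" for a b
  proof -
    have "integrable (M1 \<Otimes>\<^sub>M M2) (\<lambda>z. a (fst z) * b (snd z) * G z)"
    proof (rule P.integrable_const_bound[of _ "C * C * D"])
      show "AE z in M1 \<Otimes>\<^sub>M M2. norm (a (fst z) * b (snd z) * G z) \<le> C * C * D"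
        unfolding real_norm_def abs_mult using C D by (intro AE_I2 mult_mono a b bound) auto
    qed measurable
    then have "(\<integral>z. a (fst z) * b (snd z) * G z \<partial>(M1 \<Otimes>\<^sub>M M2)) = (\<integral>x. \<integral>y. a x * b y * G (x, y) \<partial>M2 \<partial>M1)"
      by (subst integral_fst'[symmetric]) simp_all
    then show ?thesis by (simp add: mult.assoc)
  qed
  have k_lim: "(\<lambda>n. k n x) \<longlonglongrightarrow> k' x" if "x \<in> space M1" for x
    unfolding k_def k'_def by (rule lim_v[OF G_int[OF that]])
  have 1: "(\<lambda>n. \<integral>x. u n x * (k n x - k' x) \<partial>M1) \<longlonglongrightarrow> (\<integral>x. 0 \<partial>M1)"
  proof (rule integral_dominated_convergence[where w = "\<lambda>x. C * (2 * (C * D))"])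
    show "AE x in M1. (\<lambda>n. u n x * (k n x - k' x)) \<longlonglongrightarrow> 0"
    proof (rule AE_I2)
      fix x assume "x \<in> space M1"
      then have "(\<lambda>n. k n x - k' x) \<longlonglongrightarrow> 0" using k_lim LIM_zero by blast
      moreover have "Bfun (\<lambda>n. u n x) sequentially" using bound(1) by (intro BfunI[of _ C]) auto
      ultimately show "(\<lambda>n. u n x * (k n x - k' x)) \<longlonglongrightarrow> 0"
        by (simp add: tendsto_Zfun_iff bounded_bilinear.Bfun_prod_Zfun[OF bounded_bilinear_mult])
    qed
    show "AE x in M1. norm (u n x * (k n x - k' x)) \<le> C * (2 * (C * D))" for n
    proof (rule AE_I2)
      fix x assume "x \<in> space M1"
      then have "\<bar>k n x - k' x\<bar> \<le> 2 * (C * D)" using k_bound(1)[of x n] k_bound(2)[of x] by linarith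
      then show "norm (u n x * (k n x - k' x)) \<le> C * (2 * (C * D))"
        unfolding real_norm_def abs_mult using C bound(1) by (intro mult_mono) auto
    qed
  qed auto
  have 2: "(\<lambda>n. \<integral>x. u n x * k' x \<partial>M1) \<longlonglongrightarrow> (\<integral>x. u' x * k' x \<partial>M1)" by (rule lim_u) (rule k_int)
  have uk: "integrable M1 (\<lambda>x. u n x * h x)" if h: "integrable M1 h" for n h
  proof (rule Bochner_Integration.integrable_bound)
    have [measurable]: "h \<in> borel_measurable M1" using h by simp
    show "(\<lambda>x. u n x * h x) \<in> borel_measurable M1" by measurable
    show "integrable M1 (\<lambda>x. C * h x)" using h by simp
    show "AE x in M1. norm (u n x * h x) \<le> norm (C * h x)"
      using bound(1) C by (auto simp: abs_mult intro!: AE_I2 mult_right_mono)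
  qed
  have "(\<integral>x. u n x * (k n x - k' x) \<partial>M1) + (\<integral>x. u n x * k' x \<partial>M1) = (\<integral>x. u n x * k n x \<partial>M1)" for n
  proof -
    have "(\<integral>x. u n x * (k n x - k' x) \<partial>M1) = (\<integral>x. u n x * k n x \<partial>M1) - (\<integral>x. u n x * k' x \<partial>M1)"
      unfolding right_diff_distrib by (intro Bochner_Integration.integral_diff uk k_int)
    then show ?thesis by simp
  qed
  with tendsto_add[OF 1 2] have "(\<lambda>n. \<integral>x. u n x * k n x \<partial>M1) \<longlonglongrightarrow> (\<integral>x. u' x * k' x \<partial>M1)" by simp
  then show ?thesis
    by (simp add: Fub bound k_def k'_def)
qed

lemma ennreal_mult_eq_1_imp:
  fixes a b :: ennreal
  assumes "a * b = 1"
  shows "0 < a" "a < top" "b < top"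
proof -
  have "a \<noteq> 0" "b \<noteq> 0" using assms by auto
  then have "a \<noteq> top" "b \<noteq> top" using assms by (auto simp: ennreal_top_mult ennreal_mult_top)
  with \<open>a \<noteq> 0\<close> show "0 < a" "a < top" "b < top"
    by (simp_all add: zero_less_iff_neq_zero top.not_eq_extremum)
qed

text \<open>
  Let (\<phi>, \<psi>) solve the perturbed system and put s = \<integral> B \<psi> d\<nu> and t = \<integral> A \<phi> d\<mu>. Inserting A * B \<le> K into the
  marginal equations gives A * \<phi> * s \<le> 1 and, up to the perturbation, B * \<psi> * t \<le> 1. The functions
  u = A * \<phi> * s and v = B * \<psi> / s are therefore bounded as soon as t * s is bounded away from zero. This
  holds because a fixed part of the mass of the approximate coupling sits where A and B are at least
  \<delta>, and there K \<le> 1 bounds that mass by t * s / \<delta>^2. The bound C depends on A, B and \<delta> alone, which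
  is what makes the passage to the limit e \<longlongrightarrow> 0 possible.
\<close>

lemma approximate_coupling:
  fixes K :: "'a \<times> 'b \<Rightarrow> real" and A :: "'a \<Rightarrow> real" and B :: "'b \<Rightarrow> real"
  assumes "prob_space \<mu>" "prob_space \<nu>"
    and meas[measurable]: "K \<in> borel_measurable (\<mu> \<Otimes>\<^sub>M \<nu>)" "A \<in> borel_measurable \<mu>" "B \<in> borel_measurable \<nu>"
    and K: "\<And>z. 0 < K z" "\<And>z. K z \<le> 1"
    and A: "\<And>x. 0 \<le> A x" "AE x in \<mu>. 0 < A x"
    and B: "\<And>y. 0 \<le> B y" "\<And>y. B y \<le> 1" "AE y in \<nu>. 0 < B y"
    and AB: "\<And>x y. A x * B y \<le> K (x, y)"
    and \<delta>: "0 < \<delta>" "measure \<mu> {x \<in> space \<mu>. A x < \<delta>} \<le> 1 / 4" "measure \<nu> {y \<in> space \<nu>. B y < \<delta>} \<le> 1 / 4"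
    and e: "0 < e" "e \<le> 1 / 4"
  defines "C \<equiv> 4 / \<delta>\<^sup>2 + 1 / (\<integral>y. B y \<partial>\<nu>)"
  obtains u v where "u \<in> borel_measurable \<mu>" "v \<in> borel_measurable \<nu>"
    "\<And>x. 0 \<le> u x" "\<And>x. u x \<le> 1" "\<And>y. 0 \<le> v y" "\<And>y. v y \<le> C"
    "\<And>E. E \<in> sets \<mu> \<Longrightarrow> (\<integral>\<^sup>+ z. ennreal (u (fst z) * v (snd z) * (K z / (A (fst z) * B (snd z)))) * indicator E (fst z) \<partial>(\<mu> \<Otimes>\<^sub>M \<nu>)) \<le> emeasure \<mu> E"
    "\<And>F. F \<in> sets \<nu> \<Longrightarrow> (\<integral>\<^sup>+ z. ennreal (u (fst z) * v (snd z) * (K z / (A (fst z) * B (snd z)))) * indicator F (snd z) \<partial>(\<mu> \<Otimes>\<^sub>M \<nu>)) \<le> emeasure \<nu> F + ennreal e"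
    "(\<integral>\<^sup>+ z. ennreal (u (fst z) * v (snd z) * (K z / (A (fst z) * B (snd z)))) \<partial>(\<mu> \<Otimes>\<^sub>M \<nu>)) = 1"
proof -
  interpret \<mu>: prob_space \<mu> by fact
  interpret \<nu>: prob_space \<nu> by fact
  interpret pair_prob_space \<mu> \<nu> ..
  obtain \<phi> \<psi> where meas'[measurable]: "\<phi> \<in> borel_measurable \<mu>" "\<psi> \<in> borel_measurable \<nu>"
    and \<phi>_eq: "AE x in \<mu>. \<phi> x * (\<integral>\<^sup>+ y. ennreal (K (x, y)) * \<psi> y \<partial>\<nu>) = 1"
    and \<psi>_eq: "AE y in \<nu>. \<psi> y = ennreal (1 - e) * inverse (\<integral>\<^sup>+ x. ennreal (K (x, y)) * \<phi> x \<partial>\<mu>) + ennreal e"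
    and w_int: "(\<integral>\<^sup>+ y. (\<integral>\<^sup>+ x. ennreal (K (x, y)) * \<phi> x \<partial>\<mu>) \<partial>\<nu>) = 1"
    using perturbed_schroedinger_system[OF \<open>prob_space \<mu>\<close> \<open>prob_space \<nu>\<close>, of "\<lambda>z. ennreal (K z)" e] K e
    by (auto simp: ennreal_le_1)
  define w where "w y = (\<integral>\<^sup>+ x. ennreal (K (x, y)) * \<phi> x \<partial>\<mu>)" for y
  define I where "I x = (\<integral>\<^sup>+ y. ennreal (K (x, y)) * \<psi> y \<partial>\<nu>)" for x
  have [measurable]: "w \<in> borel_measurable \<nu>" "I \<in> borel_measurable \<mu>" unfolding w_def I_def by measurable
  note \<phi>_eq = \<phi>_eq[folded I_def] and \<psi>_eq = \<psi>_eq[folded w_def] and w_int = w_int[folded w_def]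
  define s where "s = (\<integral>\<^sup>+ y. ennreal (B y) * \<psi> y \<partial>\<nu>)"
  define t where "t = (\<integral>\<^sup>+ x. ennreal (A x) * \<phi> x \<partial>\<mu>)"
  define \<beta> where "\<beta> = (\<integral>y. B y \<partial>\<nu>)"

  have \<phi>_fin: "AE x in \<mu>. 0 < \<phi> x \<and> \<phi> x < top \<and> I x < top"
    using \<phi>_eq
  proof eventually_elim
    case (elim x)
    from ennreal_mult_eq_1_imp[OF elim] show ?case by blast
  qed
  \<comment> \<open>A single good point x0 suffices to bound the integrals against \<psi>.\<close>
  obtain x0 where x0: "x0 \<in> space \<mu>" "0 < A x0" "I x0 < top"
  proof -
    have "AE x in \<mu>. x \<in> space \<mu> \<and> 0 < A x \<and> I x < top" using A(2) \<phi>_fin AE_space by eventually_elim auto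
    then have "\<exists>x. x \<in> space \<mu> \<and> 0 < A x \<and> I x < top"
      by (rule eventually_happens'[OF \<mu>.ae_filter_bot])
    then show ?thesis using that by blast
  qed
  have \<psi>_fin: "AE y in \<nu>. \<psi> y < top"
  proof -
    have [measurable]: "(\<lambda>y. K (x0, y)) \<in> borel_measurable \<nu>" using x0(1) by measurable
    have "AE y in \<nu>. ennreal (K (x0, y)) * \<psi> y \<noteq> top"
      using nn_integral_PInf_AE[of "\<lambda>y. ennreal (K (x0, y)) * \<psi> y" \<nu>] x0(3) by (simp add: I_def)
    then show ?thesis
    proof eventually_elim
      case (elim y)
      have "ennreal (K (x0, y)) \<noteq> 0" using K(1)[of "(x0, y)"] by (simp add: ennreal_eq_0_iff)
      with elim show ?case by (simp add: ennreal_mult_eq_top_iff top.not_eq_extremum)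
    qed
  qed
  have \<psi>_ge: "AE y in \<nu>. ennreal e \<le> \<psi> y" using \<psi>_eq by eventually_elim simp

  have A_s: "ennreal (A x) * s \<le> I x" if "x \<in> space \<mu>" for x
  proof -
    have "ennreal (A x) * s = (\<integral>\<^sup>+ y. ennreal (A x * B y) * \<psi> y \<partial>\<nu>)"
      unfolding s_def by (subst nn_integral_cmult[symmetric]) (auto simp: ennreal_mult A B mult.assoc)
    also have "\<dots> \<le> I x" unfolding I_def by (intro nn_integral_mono mult_right_mono ennreal_leI AB) simp
    finally show ?thesis .
  qed
  have B_t: "ennreal (B y) * t \<le> w y" if "y \<in> space \<nu>" for y
  proof -
    have "ennreal (B y) * t = (\<integral>\<^sup>+ x. ennreal (A x * B y) * \<phi> x \<partial>\<mu>)"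
      unfolding t_def by (subst nn_integral_cmult[symmetric]) (auto simp: ennreal_mult A B mult_ac)
    also have "\<dots> \<le> w y" unfolding w_def by (intro nn_integral_mono mult_right_mono ennreal_leI AB) simp
    finally show ?thesis .
  qed
  have s_fin: "s < top"
  proof -
    have "ennreal (A x0) * s < top" using A_s[OF x0(1)] x0(3) by (rule le_less_trans)
    then show ?thesis using x0(2) by (cases "s = top") (auto simp: ennreal_mult_top top.not_eq_extremum)
  qed
  have B_int: "integrable \<nu> B" by (rule \<nu>.integrable_const_bound[of _ 1]) (use B in auto)
  have \<beta>_pos: "0 < \<beta>"
  proof -
    have "0 \<le> \<beta>" unfolding \<beta>_def by (intro Bochner_Integration.integral_nonneg B)
    moreover have "\<beta> \<noteq> 0"
    proof
      assume "\<beta> = 0"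
      then have "AE y in \<nu>. B y = 0"
        unfolding \<beta>_def using integral_nonneg_eq_0_iff_AE[OF B_int] B(1) by auto
      with B(3) have "AE y in \<nu>. False" by eventually_elim simp
      then show False using \<nu>.AE_False by simp
    qed
    ultimately show ?thesis by simp
  qed
  \<comment> \<open>The lower bound for s absorbs the perturbation: e / s \<le> 1 / \<beta> uniformly in e.\<close>
  have s_ge: "ennreal (e * \<beta>) \<le> s"
  proof -
    have "ennreal (e * \<beta>) = ennreal e * (\<integral>\<^sup>+ y. ennreal (B y) \<partial>\<nu>)"
      using B_int B(1) e by (simp add: nn_integral_eq_integral \<beta>_def ennreal_mult')
    also have "\<dots> = (\<integral>\<^sup>+ y. ennreal e * ennreal (B y) \<partial>\<nu>)" by (simp add: nn_integral_cmult)
    also have "\<dots> \<le> s" unfolding s_def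
      by (intro nn_integral_mono_AE, use \<psi>_ge in eventually_elim) (simp add: mult.commute[of "ennreal e"] mult_left_mono)
    finally show ?thesis .
  qed
  obtain sr where sr: "s = ennreal sr" "0 < sr" "e * \<beta> \<le> sr"
  proof -
    obtain sr where 1: "s = ennreal sr" "0 \<le> sr" using s_fin by (cases s) auto
    moreover have "e * \<beta> \<le> sr" using s_ge 1 by simp
    moreover have "0 < e * \<beta>" using e \<beta>_pos by simp
    ultimately show ?thesis using that by fastforce
  qed
  have A\<phi>s: "AE x in \<mu>. ennreal (A x) * \<phi> x * s \<le> 1"
    using \<phi>_eq AE_space
  proof eventually_elim
    case (elim x)
    have "ennreal (A x) * \<phi> x * s = \<phi> x * (ennreal (A x) * s)" by (simp add: mult_ac)
    also have "\<dots> \<le> \<phi> x * I x" by (intro mult_left_mono A_s elim) simp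
    finally show ?case using elim by simp
  qed

  define q where "q z = ennreal (K z) * \<phi> (fst z) * \<psi> (snd z)" for z
  have [measurable]: "q \<in> borel_measurable (\<mu> \<Otimes>\<^sub>M \<nu>)" unfolding q_def by measurable
  have q1: "(\<integral>\<^sup>+ z. q z * indicator E (fst z) \<partial>(\<mu> \<Otimes>\<^sub>M \<nu>)) = emeasure \<mu> E" if [measurable]: "E \<in> sets \<mu>" for E
  proof -
    have "(\<integral>\<^sup>+ z. q z * indicator E (fst z) \<partial>(\<mu> \<Otimes>\<^sub>M \<nu>)) = (\<integral>\<^sup>+ x. \<integral>\<^sup>+ y. q (x, y) * indicator E x \<partial>\<nu> \<partial>\<mu>)"
      by (subst \<nu>.nn_integral_fst[symmetric]) simp_all
    also have "\<dots> = (\<integral>\<^sup>+ x. \<integral>\<^sup>+ y. (\<phi> x * indicator E x) * (ennreal (K (x, y)) * \<psi> y) \<partial>\<nu> \<partial>\<mu>)"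
      unfolding q_def by (intro nn_integral_cong) (simp add: mult_ac)
    also have "\<dots> = (\<integral>\<^sup>+ x. (\<phi> x * indicator E x) * I x \<partial>\<mu>)"
      unfolding I_def by (intro nn_integral_cong nn_integral_cmult) measurable
    also have "\<dots> = (\<integral>\<^sup>+ x. indicator E x \<partial>\<mu>)"
      by (intro nn_integral_cong_AE, use \<phi>_eq in eventually_elim) (simp split: split_indicator)
    finally show ?thesis by simp
  qed
  have q2: "(\<integral>\<^sup>+ z. q z * indicator F (snd z) \<partial>(\<mu> \<Otimes>\<^sub>M \<nu>)) \<le> emeasure \<nu> F + ennreal e" if [measurable]: "F \<in> sets \<nu>" for F
  proof -
    have "(\<integral>\<^sup>+ z. q z * indicator F (snd z) \<partial>(\<mu> \<Otimes>\<^sub>M \<nu>)) = (\<integral>\<^sup>+ y. \<integral>\<^sup>+ x. q (x, y) * indicator F y \<partial>\<mu> \<partial>\<nu>)"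
      by (subst nn_integral_snd[symmetric]) simp_all
    also have "\<dots> = (\<integral>\<^sup>+ y. \<integral>\<^sup>+ x. (\<psi> y * indicator F y) * (ennreal (K (x, y)) * \<phi> x) \<partial>\<mu> \<partial>\<nu>)"
      unfolding q_def by (intro nn_integral_cong) (simp add: mult_ac)
    also have "\<dots> = (\<integral>\<^sup>+ y. (\<psi> y * indicator F y) * w y \<partial>\<nu>)"
      unfolding w_def by (intro nn_integral_cong nn_integral_cmult) measurable
    also have "\<dots> \<le> (\<integral>\<^sup>+ y. indicator F y + ennreal e * w y \<partial>\<nu>)"
    proof (intro nn_integral_mono_AE, use \<psi>_eq in eventually_elim)
      case (elim y)
      have "\<psi> y * w y = ennreal (1 - e) * (inverse (w y) * w y) + ennreal e * w y"
        by (subst elim) (simp add: distrib_left distrib_right mult_ac)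
      also have "\<dots> \<le> 1 * 1 + ennreal e * w y"
        using e by (intro add_right_mono mult_mono ennreal_inverse_mult_self_le) (auto simp: ennreal_le_1)
      finally show "\<psi> y * indicator F y * w y \<le> indicator F y + ennreal e * w y"
        by (auto split: split_indicator)
    qed
    also have "\<dots> = emeasure \<nu> F + ennreal e"
      using w_int by (simp add: nn_integral_add nn_integral_cmult)
    finally show ?thesis .
  qed
  have q_total: "(\<integral>\<^sup>+ z. q z \<partial>(\<mu> \<Otimes>\<^sub>M \<nu>)) = 1"
  proof -
    have "(\<integral>\<^sup>+ z. q z \<partial>(\<mu> \<Otimes>\<^sub>M \<nu>)) = (\<integral>\<^sup>+ z. q z * indicator (space \<mu>) (fst z) \<partial>(\<mu> \<Otimes>\<^sub>M \<nu>))"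
      by (intro nn_integral_cong) (auto simp: space_pair_measure)
    then show ?thesis using q1[of "space \<mu>"] by (simp add: \<mu>.emeasure_space_1)
  qed

  define X where "X = {x \<in> space \<mu>. \<delta> \<le> A x}"
  define Y where "Y = {y \<in> space \<nu>. \<delta> \<le> B y}"
  have [measurable]: "X \<in> sets \<mu>" "Y \<in> sets \<nu>" unfolding X_def Y_def by measurable
  \<comment> \<open>Outside X \<times> Y the mass is at most 3 / 4, one quarter for each marginal and one for e.\<close>
  have ts_ge: "ennreal (\<delta>\<^sup>2 / 4) \<le> t * s"
  proof -
    define J where "J = (\<integral>\<^sup>+ z. q z * (indicator X (fst z) * indicator Y (snd z)) \<partial>(\<mu> \<Otimes>\<^sub>M \<nu>))"
    have "1 = (\<integral>\<^sup>+ z. q z \<partial>(\<mu> \<Otimes>\<^sub>M \<nu>))" by (simp add: q_total)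
    also have "\<dots> \<le> (\<integral>\<^sup>+ z. q z * (indicator X (fst z) * indicator Y (snd z)) + q z * indicator (space \<mu> - X) (fst z) + q z * indicator (space \<nu> - Y) (snd z) \<partial>(\<mu> \<Otimes>\<^sub>M \<nu>))"
      by (intro nn_integral_mono) (auto simp: space_pair_measure split: split_indicator)
    also have "\<dots> = J + (\<integral>\<^sup>+ z. q z * indicator (space \<mu> - X) (fst z) \<partial>(\<mu> \<Otimes>\<^sub>M \<nu>)) + (\<integral>\<^sup>+ z. q z * indicator (space \<nu> - Y) (snd z) \<partial>(\<mu> \<Otimes>\<^sub>M \<nu>))"
      unfolding J_def by (simp add: nn_integral_add)
    also have "\<dots> \<le> J + emeasure \<mu> (space \<mu> - X) + (emeasure \<nu> (space \<nu> - Y) + ennreal e)"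
      using q1[of "space \<mu> - X"] q2[of "space \<nu> - Y"] by (intro add_mono) auto
    also have "space \<mu> - X = {x \<in> space \<mu>. A x < \<delta>}" by (auto simp: X_def)
    also have "space \<nu> - Y = {y \<in> space \<nu>. B y < \<delta>}" by (auto simp: Y_def)
    also have "J + emeasure \<mu> {x \<in> space \<mu>. A x < \<delta>} + (emeasure \<nu> {y \<in> space \<nu>. B y < \<delta>} + ennreal e) \<le> J + ennreal (1/4) + (ennreal (1/4) + ennreal (1/4))"
      using \<delta> e unfolding \<mu>.emeasure_eq_measure \<nu>.emeasure_eq_measure by (intro add_mono ennreal_leI) auto
    also have "\<dots> = J + ennreal (1/4 + (1/4 + 1/4))" by (simp only: add.assoc ennreal_plus zero_le_divide_1_iff zero_le_numeral add_nonneg_nonneg)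
    finally have 1: "1 \<le> J + ennreal (3/4)" by simp
    have J: "ennreal (1 / 4) \<le> J"
    proof (cases J)
      case (real r)
      then have "ennreal 1 \<le> ennreal (r + 3/4)" using 1 by simp
      then have "1 \<le> r + 3/4" using real by (subst (asm) ennreal_le_iff) auto
      then show ?thesis using real by (simp add: ennreal_leI)
    qed simp
    have "ennreal (\<delta>\<^sup>2) * J = (\<integral>\<^sup>+ z. ennreal (\<delta>\<^sup>2) * (q z * (indicator X (fst z) * indicator Y (snd z))) \<partial>(\<mu> \<Otimes>\<^sub>M \<nu>))"
      unfolding J_def by (simp add: nn_integral_cmult)
    also have "\<dots> \<le> (\<integral>\<^sup>+ z. (ennreal (A (fst z)) * \<phi> (fst z)) * (ennreal (B (snd z)) * \<psi> (snd z)) \<partial>(\<mu> \<Otimes>\<^sub>M \<nu>))"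
    proof (intro nn_integral_mono)
      fix z
      show "ennreal (\<delta>\<^sup>2) * (q z * (indicator X (fst z) * indicator Y (snd z))) \<le> (ennreal (A (fst z)) * \<phi> (fst z)) * (ennreal (B (snd z)) * \<psi> (snd z))"
      proof (cases "fst z \<in> X \<and> snd z \<in> Y")
        case True
        then have "\<delta>\<^sup>2 * K z \<le> A (fst z) * B (snd z) * 1"
          unfolding power2_eq_square X_def Y_def using \<delta> K(1)[of z] K(2)[of z] A(1) B(1) by (intro mult_mono) auto
        then have "ennreal (\<delta>\<^sup>2 * K z) * (\<phi> (fst z) * \<psi> (snd z)) \<le> ennreal (A (fst z) * B (snd z)) * (\<phi> (fst z) * \<psi> (snd z))"
          by (intro mult_right_mono ennreal_leI) auto
        then show ?thesis using True K(1)[of z] A(1) B(1) by (simp add: q_def ennreal_mult mult_ac)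
      qed auto
    qed
    also have "\<dots> = (\<integral>\<^sup>+ x. \<integral>\<^sup>+ y. (ennreal (A x) * \<phi> x) * (ennreal (B y) * \<psi> y) \<partial>\<nu> \<partial>\<mu>)"
      by (subst \<nu>.nn_integral_fst[symmetric]) simp_all
    also have "\<dots> = t * s"
      unfolding t_def s_def by (simp add: nn_integral_cmult nn_integral_multc)
    finally have "ennreal (\<delta>\<^sup>2) * J \<le> t * s" .
    moreover have "ennreal (\<delta>\<^sup>2 / 4) \<le> ennreal (\<delta>\<^sup>2) * J"
      using mult_left_mono[OF J, of "ennreal (\<delta>\<^sup>2)"] by (simp flip: ennreal_mult)
    ultimately show ?thesis by (rule order_trans[rotated])
  qed
  have ts_le: "t * s \<le> 1"
  proof -
    have "t * s = (\<integral>\<^sup>+ x. ennreal (A x) * \<phi> x * s \<partial>\<mu>)" unfolding t_def by (simp add: nn_integral_multc)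
    also have "\<dots> \<le> (\<integral>\<^sup>+ x. 1 \<partial>\<mu>)" by (intro nn_integral_mono_AE A\<phi>s)
    finally show ?thesis by (simp add: \<mu>.emeasure_space_1)
  qed
  obtain tr where tr: "t = ennreal tr" "0 < tr" "\<delta>\<^sup>2 / 4 \<le> tr * sr"
  proof -
    have "t \<noteq> top" using ts_le sr by (auto simp: ennreal_top_mult top_unique)
    then obtain tr where 1: "t = ennreal tr" "0 \<le> tr" by (cases t) auto
    then have 2: "\<delta>\<^sup>2 / 4 \<le> tr * sr" using ts_ge sr by (simp flip: ennreal_mult add: ennreal_le_iff)
    have "0 < tr * sr" using 2 \<delta> by (smt (verit) divide_pos_pos zero_less_power)
    then have "0 < tr" using sr by (simp add: zero_less_mult_iff)
    with 1 2 show ?thesis using that by blast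
  qed
  define uu where "uu x = ennreal (A x) * \<phi> x * s" for x
  define vv where "vv y = ennreal (B y) * \<psi> y * inverse s" for y
  have vv_le: "AE y in \<nu>. vv y \<le> ennreal C"
    using \<psi>_eq AE_space
  proof eventually_elim
    case (elim y)
    have 1: "ennreal (B y) * inverse (w y) \<le> ennreal (1 / tr)"
    proof (cases "B y = 0")
      case False
      then have By: "0 < B y" using B(1)[of y] by simp
      have "inverse (w y) \<le> inverse (ennreal (B y * tr))"
        using B_t[OF elim(2)] By tr by (intro ennreal_inverse_antimono) (simp add: ennreal_mult)
      also have "\<dots> = ennreal (inverse (B y * tr))" using By tr by (intro inverse_ennreal) simp
      finally have "ennreal (B y) * inverse (w y) \<le> ennreal (B y) * ennreal (inverse (B y * tr))" by (rule mult_left_mono) simp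
      also have "\<dots> = ennreal (1 / tr)" using By tr by (simp flip: ennreal_mult add: field_simps)
      finally show ?thesis .
    qed simp
    have "ennreal (B y) * \<psi> y = ennreal (1 - e) * (ennreal (B y) * inverse (w y)) + ennreal (B y) * ennreal e"
      by (subst elim(1)) (simp add: distrib_left mult_ac)
    also have "\<dots> \<le> 1 * ennreal (1 / tr) + 1 * ennreal e"
      using e B by (intro add_mono mult_mono 1) (auto simp: ennreal_le_1)
    also have "\<dots> = ennreal (1 / tr + e)" using tr e by simp
    finally have "vv y \<le> ennreal (1 / tr + e) * inverse s" unfolding vv_def by (rule mult_right_mono) simp
    also have "\<dots> = ennreal ((1 / tr + e) / sr)"
    proof -
      have "inverse s = ennreal (inverse sr)" using sr by (simp add: inverse_ennreal)
      moreover have "0 \<le> 1 / tr + e" "0 \<le> inverse sr" using tr sr e by simp_all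
      ultimately show ?thesis unfolding divide_inverse[of _ sr] by (simp only: ennreal_mult)
    qed
    also have "\<dots> \<le> ennreal C"
    proof (rule ennreal_leI)
      have "1 / (tr * sr) \<le> 1 / (\<delta>\<^sup>2 / 4)" using tr \<delta> sr by (intro divide_left_mono) auto
      moreover have "e / sr \<le> e / (e * \<beta>)" using e sr \<beta>_pos by (intro divide_left_mono) auto
      moreover have "(1 / tr + e) / sr = 1 / (tr * sr) + e / sr" by (simp add: add_divide_distrib)
      ultimately show "(1 / tr + e) / sr \<le> C" using e unfolding C_def \<beta>_def[symmetric] by simp
    qed
    finally show ?case .
  qed
  have C: "0 \<le> C" using \<beta>_pos \<delta> unfolding C_def \<beta>_def[symmetric] by simp
  define u where "u x = enn2real (min 1 (uu x))" for x
  define v where "v y = enn2real (min (ennreal C) (vv y))" for y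
  have [measurable]: "u \<in> borel_measurable \<mu>" "v \<in> borel_measurable \<nu>"
    unfolding u_def v_def uu_def vv_def by measurable
  have u_bounds: "0 \<le> u x" "u x \<le> 1" for x by (simp_all add: u_def enn2real_leI)
  have v_bounds: "0 \<le> v y" "v y \<le> C" for y using C by (simp_all add: v_def enn2real_leI)
  have u_eq: "AE x in \<mu>. 0 < A x \<and> ennreal (u x) = uu x"
    using A\<phi>s A(2)
  proof eventually_elim
    case (elim x)
    then have "uu x \<le> 1" by (simp add: uu_def)
    moreover from this have "uu x < top" by (rule le_less_trans) simp
    ultimately show ?case using elim by (simp add: u_def min_absorb2)
  qed
  have v_eq: "AE y in \<nu>. 0 < B y \<and> ennreal (v y) = vv y"
    using vv_le B(3)
  proof eventually_elim
    case (elim y)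
    from elim(1) have "vv y < top" by (rule le_less_trans) simp
    with elim show ?case by (simp add: v_def min_absorb2)
  qed
  define p where "p z = ennreal (u (fst z) * v (snd z) * (K z / (A (fst z) * B (snd z))))" for z
  have [measurable]: "p \<in> borel_measurable (\<mu> \<Otimes>\<^sub>M \<nu>)" unfolding p_def by measurable
  have pq: "p (x, y) = q (x, y)"
    if x: "0 < A x" "ennreal (u x) = uu x" and y: "0 < B y" "ennreal (v y) = vv y" for x y
  proof -
    have "0 \<le> K (x, y) / (A x * B y)" using x y K(1)[of "(x, y)"] by simp
    then have "p (x, y) = ennreal (u x) * ennreal (v y) * ennreal (K (x, y) / (A x * B y))"
      by (simp only: p_def fst_conv snd_conv ennreal_mult mult_nonneg_nonneg u_bounds(1) v_bounds(1))
    also have "\<dots> = (ennreal (A x) * \<phi> x * s) * (ennreal (B y) * \<psi> y * inverse s) * ennreal (K (x, y) / (A x * B y))"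
      by (simp add: x y uu_def vv_def)
    also have "\<dots> = (ennreal (A x) * ennreal (B y) * ennreal (K (x, y) / (A x * B y))) * (\<phi> x * \<psi> y) * (inverse s * s)"
      by (simp add: mult_ac)
    also have "inverse s * s = 1" using sr by (intro ennreal_inverse_mult_self) auto
    also have "ennreal (A x) * ennreal (B y) * ennreal (K (x, y) / (A x * B y)) = ennreal (K (x, y))"
      using x y K(1)[of "(x, y)"] by (simp flip: ennreal_mult)
    finally show ?thesis by (simp add: q_def mult_ac)
  qed
  have p_eq: "(\<integral>\<^sup>+ z. p z * k z \<partial>(\<mu> \<Otimes>\<^sub>M \<nu>)) = (\<integral>\<^sup>+ z. q z * k z \<partial>(\<mu> \<Otimes>\<^sub>M \<nu>))"
    if [measurable]: "k \<in> borel_measurable (\<mu> \<Otimes>\<^sub>M \<nu>)" for k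
  proof -
    have "(\<integral>\<^sup>+ x. \<integral>\<^sup>+ y. p (x, y) * k (x, y) \<partial>\<nu> \<partial>\<mu>) = (\<integral>\<^sup>+ x. \<integral>\<^sup>+ y. q (x, y) * k (x, y) \<partial>\<nu> \<partial>\<mu>)"
    proof (intro nn_integral_cong_AE, use u_eq in eventually_elim)
      case (elim x)
      show "(\<integral>\<^sup>+ y. p (x, y) * k (x, y) \<partial>\<nu>) = (\<integral>\<^sup>+ y. q (x, y) * k (x, y) \<partial>\<nu>)"
        by (intro nn_integral_cong_AE, use v_eq in eventually_elim) (simp add: pq elim)
    qed
    then show ?thesis
      using \<nu>.nn_integral_fst[of "\<lambda>z. p z * k z" \<mu>] \<nu>.nn_integral_fst[of "\<lambda>z. q z * k z" \<mu>] by simp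
  qed
  show ?thesis
  proof (rule that[of u v])
    show "(\<integral>\<^sup>+ z. ennreal (u (fst z) * v (snd z) * (K z / (A (fst z) * B (snd z)))) * indicator E (fst z) \<partial>(\<mu> \<Otimes>\<^sub>M \<nu>)) \<le> emeasure \<mu> E" if [measurable]: "E \<in> sets \<mu>" for E
      unfolding p_def[symmetric] by (subst p_eq) (simp_all add: q1)
    show "(\<integral>\<^sup>+ z. ennreal (u (fst z) * v (snd z) * (K z / (A (fst z) * B (snd z)))) * indicator F (snd z) \<partial>(\<mu> \<Otimes>\<^sub>M \<nu>)) \<le> emeasure \<nu> F + ennreal e" if [measurable]: "F \<in> sets \<nu>" for F
      unfolding p_def[symmetric] by (subst p_eq) (simp_all add: q2)
    show "(\<integral>\<^sup>+ z. ennreal (u (fst z) * v (snd z) * (K z / (A (fst z) * B (snd z)))) \<partial>(\<mu> \<Otimes>\<^sub>M \<nu>)) = 1"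
      unfolding p_def[symmetric] using p_eq[of "\<lambda>_. 1"] q_total by simp
  qed (use u_bounds v_bounds in auto)
qed

text \<open>
  Let u and v be weak limits of the bounded factors of the approximate couplings as the perturbation
  tends to zero. The density of the approximate couplings is u_n x * v_n y * L (x, y) with
  L = K / (A * B), and L is bounded only on the sets S m where A and B are at least 1 / (m + 1). On
  these the limit is legitimate and yields that the marginals of q = u * v * L are at most \<mu> and \<nu>.
  No mass escapes, because the approximate couplings have prescribed marginals and thus uniformly
  little mass outside S m. So q has total mass 1, and marginals below \<mu> and \<nu> must be equal to them.
  Finally u and v are positive almost everywhere since the marginals charge every nonnull set.
\<close>

lemma product_form_coupling_exists:
  fixes \<mu> :: "'a::polish_space measure" and \<nu> :: "'b::polish_space measure" and K :: "'a \<times> 'b \<Rightarrow> real"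
  assumes "prob_space \<mu>" "prob_space \<nu>" and sets_cong: "sets \<mu> = sets borel" "sets \<nu> = sets borel"
    and cont: "continuous_on UNIV K" and K: "\<And>z. 0 < K z" "\<And>z. K z \<le> 1"
  obtains \<phi> \<psi> where "\<phi> \<in> borel_measurable \<mu>" "\<psi> \<in> borel_measurable \<nu>" "\<And>x. 0 < \<phi> x" "\<And>y. 0 < \<psi> y"
    "density (\<mu> \<Otimes>\<^sub>M \<nu>) (\<lambda>z. ennreal (\<phi> (fst z) * \<psi> (snd z) * K z)) \<in> couplings \<mu> \<nu>"
proof -
  interpret \<mu>: prob_space \<mu> by fact
  interpret \<nu>: prob_space \<nu> by fact
  interpret pair_prob_space \<mu> \<nu> ..
  define P where "P = \<mu> \<Otimes>\<^sub>M \<nu>"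
  have sets_P: "sets P = sets (borel :: ('a \<times> 'b) measure)"
    unfolding P_def by (simp only: sets_pair_measure_cong[OF sets_cong] borel_prod)
  have sp[simp]: "space \<mu> = UNIV" "space \<nu> = UNIV" "space P = UNIV"
    using sets_cong[THEN sets_eq_imp_space_eq] sets_P[THEN sets_eq_imp_space_eq] by auto
  have fst_snd[measurable]: "fst \<in> P \<rightarrow>\<^sub>M \<mu>" "snd \<in> P \<rightarrow>\<^sub>M \<nu>" unfolding P_def by measurable
  have "K \<in> borel_measurable borel" by (intro borel_measurable_continuous_onI cont)
  then have [measurable]: "K \<in> borel_measurable P" by (simp add: measurable_cong_sets[OF sets_P refl])
  obtain A B where [measurable]: "A \<in> borel_measurable \<mu>" "B \<in> borel_measurable \<nu>"
    and A12: "\<And>x. 0 \<le> A x" "\<And>x. A x \<le> 1" and B12: "\<And>y. 0 \<le> B y" "\<And>y. B y \<le> 1"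
    and A3: "AE x in \<mu>. 0 < A x" and B3: "AE y in \<nu>. 0 < B y" and AB: "\<And>x y. A x * B y \<le> K (x, y)"
    by (rule product_lower_bound[OF \<mu>.finite_measure_axioms \<nu>.finite_measure_axioms sets_cong cont K(1)]) blast
  note A = A12 A3 and B = B12 B3
  define a where "a m = measure \<mu> {x \<in> space \<mu>. A x < 1 / Suc m}" for m
  define b where "b m = measure \<nu> {y \<in> space \<nu>. B y < 1 / Suc m}" for m
  have a_lim: "a \<longlonglongrightarrow> 0" unfolding a_def by (intro measure_sublevel_tendsto_0 A \<mu>.finite_measure_axioms) measurable
  have b_lim: "b \<longlonglongrightarrow> 0" unfolding b_def by (intro measure_sublevel_tendsto_0 B \<nu>.finite_measure_axioms) measurable
  have "\<forall>\<^sub>F m in sequentially. a m < 1 / 4 \<and> b m < 1 / 4"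
    using a_lim b_lim by (intro eventually_conj order_tendstoD(2)) auto
  then obtain m0 where m0: "a m0 \<le> 1 / 4" "b m0 \<le> 1 / 4"     using eventually_happens'[OF sequentially_bot] less_imp_le by blast
  define \<delta> where "\<delta> = 1 / real (Suc m0)"
  define C where "C = max 1 (4 / \<delta>\<^sup>2 + 1 / (\<integral>y. B y \<partial>\<nu>))"
  \<comment> \<open>The offset 4 keeps the perturbations at most 1 / 4.\<close>
  define e where "e n = 1 / real (n + 4)" for n :: nat
  define L where "L z = K z / (A (fst z) * B (snd z))" for z
  have [measurable]: "L \<in> borel_measurable P" unfolding L_def by measurable
  have L_nonneg: "0 \<le> L z" for z unfolding L_def by (intro divide_nonneg_nonneg mult_nonneg_nonneg A B less_imp_le K)
  define approx where "approx n u v \<longleftrightarrow> u \<in> borel_measurable \<mu> \<and> v \<in> borel_measurable \<nu> \<and>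
      (\<forall>x. 0 \<le> u x \<and> u x \<le> C) \<and> (\<forall>y. 0 \<le> v y \<and> v y \<le> C) \<and>
      (\<forall>E\<in>sets \<mu>. (\<integral>\<^sup>+ z. ennreal (u (fst z) * v (snd z) * L z) * indicator E (fst z) \<partial>P) \<le> emeasure \<mu> E) \<and>
      (\<forall>F\<in>sets \<nu>. (\<integral>\<^sup>+ z. ennreal (u (fst z) * v (snd z) * L z) * indicator F (snd z) \<partial>P) \<le> emeasure \<nu> F + ennreal (e n)) \<and>
      (\<integral>\<^sup>+ z. ennreal (u (fst z) * v (snd z) * L z) \<partial>P) = 1" for n u v
  have "\<exists>u v. approx n u v" for n
  proof -
    have \<delta>: "0 < \<delta>" "measure \<mu> {x \<in> space \<mu>. A x < \<delta>} \<le> 1 / 4" "measure \<nu> {y \<in> space \<nu>. B y < \<delta>} \<le> 1 / 4"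
      using m0[unfolded a_def b_def, folded \<delta>_def] by (simp_all only:) (simp add: \<delta>_def)
    have e: "0 < e n" "e n \<le> 1 / 4" by (simp_all add: e_def)
    note K_meas = \<open>K \<in> borel_measurable P\<close>[unfolded P_def]
    show ?thesis
    proof (rule approximate_coupling[OF \<open>prob_space \<mu>\<close> \<open>prob_space \<nu>\<close> K_meas
            \<open>A \<in> borel_measurable \<mu>\<close> \<open>B \<in> borel_measurable \<nu>\<close> K A(1,3) B AB \<delta> e, folded L_def P_def])
      fix u v
      assume uv: "u \<in> borel_measurable \<mu>" "v \<in> borel_measurable \<nu>"
        "\<And>x. 0 \<le> u x" "\<And>x. u x \<le> 1" "\<And>y. 0 \<le> v y" "\<And>y. v y \<le> 4 / \<delta>\<^sup>2 + 1 / (\<integral>y. B y \<partial>\<nu>)"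
        "\<And>E. E \<in> sets \<mu> \<Longrightarrow> (\<integral>\<^sup>+ z. ennreal (u (fst z) * v (snd z) * L z) * indicator E (fst z) \<partial>P) \<le> emeasure \<mu> E"
        "\<And>F. F \<in> sets \<nu> \<Longrightarrow> (\<integral>\<^sup>+ z. ennreal (u (fst z) * v (snd z) * L z) * indicator F (snd z) \<partial>P) \<le> emeasure \<nu> F + ennreal (e n)"
        "(\<integral>\<^sup>+ z. ennreal (u (fst z) * v (snd z) * L z) \<partial>P) = 1"
      have "u x \<le> C" "v y \<le> C" for x y
        unfolding C_def by (intro max.coboundedI1 uv, intro max.coboundedI2 uv)
      with uv show ?thesis unfolding approx_def by blast
    qed
  qed
  then obtain un vn where approx: "\<And>n. approx n (un n) (vn n)" by metis
  have un: "un n \<in> borel_measurable \<mu>" "0 \<le> un n x" "un n x \<le> C" and vn: "vn n \<in> borel_measurable \<nu>" "0 \<le> vn n y" "vn n y \<le> C" for n x y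
    using approx[of n] unfolding approx_def by blast+
  obtain r1 u where r1: "strict_mono (r1 :: nat \<Rightarrow> nat)" and u_meas: "u \<in> borel_measurable \<mu>" and u: "\<And>x. 0 \<le> u x" "\<And>x. u x \<le> C"
    and u_lim: "\<And>h. integrable \<mu> h \<Longrightarrow> (\<lambda>n. \<integral>x. un (r1 n) x * h x \<partial>\<mu>) \<longlonglongrightarrow> (\<integral>x. u x * h x \<partial>\<mu>)"
    by (rule bounded_sequence_weak_limit[OF \<mu>.finite_measure_axioms sets_cong(1), of un C, OF un]) blast
  obtain r2 v where r2: "strict_mono (r2 :: nat \<Rightarrow> nat)" and v_meas: "v \<in> borel_measurable \<nu>" and v: "\<And>x. 0 \<le> v x" "\<And>x. v x \<le> C"
    and v_lim: "\<And>h. integrable \<nu> h \<Longrightarrow> (\<lambda>n. \<integral>y. vn (r1 (r2 n)) y * h y \<partial>\<nu>) \<longlonglongrightarrow> (\<integral>y. v y * h y \<partial>\<nu>)"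
    by (rule bounded_sequence_weak_limit[OF \<nu>.finite_measure_axioms sets_cong(2), of "\<lambda>n. vn (r1 n)" C, OF vn]) blast
  define r where "r n = r1 (r2 n)" for n
  have r: "strict_mono r" using r1 r2 by (simp add: r_def strict_mono_def)
  have u_lim': "(\<lambda>n. \<integral>x. un (r n) x * h x \<partial>\<mu>) \<longlonglongrightarrow> (\<integral>x. u x * h x \<partial>\<mu>)" if "integrable \<mu> h" for h
    using LIMSEQ_subseq_LIMSEQ[OF u_lim[OF that] r2] by (simp add: o_def r_def)
  note un(1)[measurable] vn(1)[measurable] u_meas[measurable] v_meas[measurable]
  define qn where "qn n z = un (r n) (fst z) * vn (r n) (snd z) * L z" for n z
  define q where "q z = u (fst z) * v (snd z) * L z" for z
  have [measurable]: "qn n \<in> borel_measurable P" "q \<in> borel_measurable P" for n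
    unfolding qn_def q_def by measurable
  have qn: "\<And>E. E \<in> sets \<mu> \<Longrightarrow> (\<integral>\<^sup>+ z. ennreal (qn n z) * indicator E (fst z) \<partial>P) \<le> emeasure \<mu> E"
      "\<And>F. F \<in> sets \<nu> \<Longrightarrow> (\<integral>\<^sup>+ z. ennreal (qn n z) * indicator F (snd z) \<partial>P) \<le> emeasure \<nu> F + ennreal (e (r n))"
      "(\<integral>\<^sup>+ z. ennreal (qn n z) \<partial>P) = 1" for n
    using approx[of "r n"] unfolding approx_def qn_def by blast+
  define X where "X m = {x. 1 / real (Suc m) \<le> A x}" for m
  define Y where "Y m = {y. 1 / real (Suc m) \<le> B y}" for m
  have X_sets[measurable]: "X m \<in> sets \<mu>" and Y_sets[measurable]: "Y m \<in> sets \<nu>" for m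
  proof -
    have "{x \<in> space \<mu>. 1 / real (Suc m) \<le> A x} \<in> sets \<mu>" "{y \<in> space \<nu>. 1 / real (Suc m) \<le> B y} \<in> sets \<nu>" by measurable
    then show "X m \<in> sets \<mu>" "Y m \<in> sets \<nu>" by (simp_all add: X_def Y_def)
  qed
  define S where "S m = X m \<times> Y m" for m
  have S_sets[measurable]: "S m \<in> sets P" for m unfolding S_def P_def by measurable
  have C: "1 \<le> C" by (simp add: C_def)

  have lim: "(\<lambda>n. \<integral>\<^sup>+ z. ennreal (qn n z) * indicator (H \<inter> S m) z \<partial>P) \<longlonglongrightarrow> (\<integral>\<^sup>+ z. ennreal (q z) * indicator (H \<inter> S m) z \<partial>P)"
    if [measurable]: "H \<in> sets P" for H m
  proof -
    define G where "G z = L z * indicator (H \<inter> S m) z" for z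
    have [measurable]: "G \<in> borel_measurable P" unfolding G_def by measurable
    define D where "D = (real (Suc m))\<^sup>2"
    have G: "0 \<le> G z" "G z \<le> D" for z
    proof -
      show "0 \<le> G z" by (simp add: G_def L_nonneg)
      show "G z \<le> D"
      proof (cases "z \<in> H \<inter> S m")
        case True
        then have ge: "1 / real (Suc m) \<le> A (fst z)" "1 / real (Suc m) \<le> B (snd z)" by (auto simp: S_def X_def Y_def)
        have "1 / D \<le> A (fst z) * B (snd z)"
          using mult_mono[OF ge] A(1) by (simp add: D_def power2_eq_square)
        then have "K z / (A (fst z) * B (snd z)) \<le> 1 / (1 / D)"
          using K[of z] by (intro frac_le) (auto simp: D_def)
        then show ?thesis using True by (simp add: G_def L_def)
      qed (simp add: G_def D_def)
    qed
    have nn: "(\<integral>\<^sup>+ z. ennreal (f (fst z) * g (snd z) * L z) * indicator (H \<inter> S m) z \<partial>P) = ennreal (\<integral>z. f (fst z) * g (snd z) * G z \<partial>P)"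
      if [measurable]: "f \<in> borel_measurable \<mu>" "g \<in> borel_measurable \<nu>"
        and f: "\<And>x. 0 \<le> f x" "\<And>x. f x \<le> C" and g: "\<And>y. 0 \<le> g y" "\<And>y. g y \<le> C" for f g
    proof -
      have le: "f (fst z) * g (snd z) * G z \<le> C * C * D" for z
        using C f g G by (intro mult_mono) auto
      have nonneg: "0 \<le> f (fst z) * g (snd z) * G z" for z using f g G by simp
      have "integrable P (\<lambda>z. f (fst z) * g (snd z) * G z)"
        unfolding P_def
      proof (rule P.integrable_const_bound)
        show "AE z in \<mu> \<Otimes>\<^sub>M \<nu>. norm (f (fst z) * g (snd z) * G z) \<le> C * C * D"
          using le nonneg by (intro AE_I2) simp
        show "(\<lambda>z. f (fst z) * g (snd z) * G z) \<in> borel_measurable (\<mu> \<Otimes>\<^sub>M \<nu>)"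
          unfolding P_def[symmetric] by measurable
      qed
      then have "(\<integral>\<^sup>+ z. ennreal (f (fst z) * g (snd z) * G z) \<partial>P) = ennreal (\<integral>z. f (fst z) * g (snd z) * G z \<partial>P)"
        using nonneg by (intro nn_integral_eq_integral) auto
      moreover have "ennreal (f (fst z) * g (snd z) * L z) * indicator (H \<inter> S m) z = ennreal (f (fst z) * g (snd z) * G z)" for z
        by (simp add: G_def split: split_indicator)
      ultimately show ?thesis by simp
    qed
    have "(\<lambda>n. \<integral>z. un (r n) (fst z) * vn (r n) (snd z) * G z \<partial>P) \<longlonglongrightarrow> (\<integral>z. u (fst z) * v (snd z) * G z \<partial>P)"
      unfolding P_def
    proof (rule weak_limit_product[where C = C and D = D])
      show "G \<in> borel_measurable (\<mu> \<Otimes>\<^sub>M \<nu>)" unfolding P_def[symmetric] by measurable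
      show "(\<lambda>n. \<integral>y. vn (r n) y * h y \<partial>\<nu>) \<longlonglongrightarrow> (\<integral>y. v y * h y \<partial>\<nu>)" if "integrable \<nu> h" for h
        using v_lim[OF that] by (simp add: r_def)
    qed (use un vn u v G u_lim' in auto)
    then show ?thesis
      unfolding qn_def q_def by (simp add: nn un vn u v)
  qed
  have e_lim: "(\<lambda>n. ennreal (e (r n))) \<longlonglongrightarrow> 0"
  proof -
    have "e \<longlonglongrightarrow> 0" unfolding e_def using LIMSEQ_ignore_initial_segment[OF lim_1_over_n, of 4] by simp
    from LIMSEQ_subseq_LIMSEQ[OF this r] show ?thesis
      by (subst ennreal_tendsto_0_iff) (auto simp: o_def e_def)
  qed
  have mono: "(\<integral>\<^sup>+ z. ennreal (q z) * indicator H z \<partial>P) = (SUP m. \<integral>\<^sup>+ z. ennreal (q z) * indicator (H \<inter> S m) z \<partial>P)"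
    if [measurable]: "H \<in> sets P" for H
  proof -
    have S_mono: "S m \<subseteq> S (Suc m)" for m
    proof -
      have "1 / real (Suc (Suc m)) \<le> 1 / real (Suc m)" by (intro divide_left_mono) auto
      then show ?thesis by (auto simp: S_def X_def Y_def)
    qed
    have "(SUP m. \<integral>\<^sup>+ z. ennreal (q z) * indicator (H \<inter> S m) z \<partial>P) = (\<integral>\<^sup>+ z. (SUP m. ennreal (q z) * indicator (H \<inter> S m) z) \<partial>P)"
      using S_mono by (intro nn_integral_monotone_convergence_SUP[symmetric] incseq_SucI le_funI mult_left_mono)
        (auto split: split_indicator)
    also have "\<dots> = (\<integral>\<^sup>+ z. ennreal (q z) * indicator H z \<partial>P)"
    proof (intro nn_integral_cong)
      fix z
      show "(SUP m. ennreal (q z) * indicator (H \<inter> S m) z) = ennreal (q z) * indicator H z"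
      proof (cases "A (fst z) = 0 \<or> B (snd z) = 0")
        case True then show ?thesis by (auto simp: q_def L_def)
      next
        case False
        then have "0 < min (A (fst z)) (B (snd z))" using A(1)[of "fst z"] B(1)[of "snd z"] by auto
        then obtain m where "inverse (real (Suc m)) < min (A (fst z)) (B (snd z))" using reals_Archimedean by blast
        then have zm: "z \<in> S m" by (cases z) (auto simp: S_def X_def Y_def inverse_eq_divide)
        show ?thesis
        proof (rule antisym)
          show "(SUP m. ennreal (q z) * indicator (H \<inter> S m) z) \<le> ennreal (q z) * indicator H z"
            by (intro SUP_least) (auto split: split_indicator)
          have "ennreal (q z) * indicator H z = ennreal (q z) * indicator (H \<inter> S m) z"
            using zm by (auto split: split_indicator)
          then show "ennreal (q z) * indicator H z \<le> (SUP m. ennreal (q z) * indicator (H \<inter> S m) z)"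
            by (auto intro: SUP_upper2)
        qed
      qed
    qed
    finally show ?thesis by simp
  qed
  have marg1: "(\<integral>\<^sup>+ z. ennreal (q z) * indicator (fst -` E) z \<partial>P) \<le> emeasure \<mu> E" if E[measurable]: "E \<in> sets \<mu>" for E
  proof -
    have [measurable]: "fst -` E \<in> sets P" using measurable_sets[OF fst_snd(1) E] by simp
    have "(\<integral>\<^sup>+ z. ennreal (q z) * indicator (fst -` E \<inter> S m) z \<partial>P) \<le> emeasure \<mu> E" for m
    proof (rule LIMSEQ_le_const2[OF lim])
      have "(\<integral>\<^sup>+ z. ennreal (qn n z) * indicator (fst -` E \<inter> S m) z \<partial>P) \<le> (\<integral>\<^sup>+ z. ennreal (qn n z) * indicator E (fst z) \<partial>P)" for n
        by (intro nn_integral_mono) (auto split: split_indicator)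
      then show "\<exists>N. \<forall>n\<ge>N. (\<integral>\<^sup>+ z. ennreal (qn n z) * indicator (fst -` E \<inter> S m) z \<partial>P) \<le> emeasure \<mu> E"
        using qn(1)[OF E] order_trans by blast
    qed measurable
    then show ?thesis by (subst mono) (auto intro: SUP_least)
  qed
  have marg2: "(\<integral>\<^sup>+ z. ennreal (q z) * indicator (snd -` F) z \<partial>P) \<le> emeasure \<nu> F" if F[measurable]: "F \<in> sets \<nu>" for F
  proof -
    have [measurable]: "snd -` F \<in> sets P" using measurable_sets[OF fst_snd(2) F] by simp
    have "(\<integral>\<^sup>+ z. ennreal (q z) * indicator (snd -` F \<inter> S m) z \<partial>P) \<le> emeasure \<nu> F + 0" for m
    proof (rule LIMSEQ_le[OF lim tendsto_add[OF tendsto_const e_lim]])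
      have "(\<integral>\<^sup>+ z. ennreal (qn n z) * indicator (snd -` F \<inter> S m) z \<partial>P) \<le> (\<integral>\<^sup>+ z. ennreal (qn n z) * indicator F (snd z) \<partial>P)" for n
        by (intro nn_integral_mono) (auto split: split_indicator)
      then show "\<exists>N. \<forall>n\<ge>N. (\<integral>\<^sup>+ z. ennreal (qn n z) * indicator (snd -` F \<inter> S m) z \<partial>P) \<le> emeasure \<nu> F + ennreal (e (r n))"
        using qn(2)[OF F] order_trans by blast
    qed measurable
    then show ?thesis by (subst mono) (auto intro: SUP_least)
  qed
  have total: "(\<integral>\<^sup>+ z. ennreal (q z) \<partial>P) = 1"
  proof (rule antisym)
    show "(\<integral>\<^sup>+ z. ennreal (q z) \<partial>P) \<le> 1"
      using marg1[of UNIV] \<mu>.emeasure_space_1 sets.top[of \<mu>] by simp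
    \<comment> \<open>The mass of q outside S m is added on both sides, so that the limit is the total mass of q.\<close>
    have le: "1 \<le> (\<integral>\<^sup>+ z. ennreal (q z) \<partial>P) + ennreal (a m) + (ennreal (b m) + 0)" for m
    proof (rule LIMSEQ_le_const)
      show "(\<lambda>n. (\<integral>\<^sup>+ z. ennreal (qn n z) * indicator (UNIV \<inter> S m) z \<partial>P) + (\<integral>\<^sup>+ z. ennreal (q z) * indicator (- S m) z \<partial>P) + ennreal (a m) + (ennreal (b m) + ennreal (e (r n))))
          \<longlonglongrightarrow> (\<integral>\<^sup>+ z. ennreal (q z) \<partial>P) + ennreal (a m) + (ennreal (b m) + 0)"
      proof -
        have [measurable]: "- S m \<in> sets P" using sets.compl_sets[OF S_sets[of m]] by (simp add: Compl_eq_Diff_UNIV)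
        have "(\<integral>\<^sup>+ z. ennreal (q z) \<partial>P) = (\<integral>\<^sup>+ z. ennreal (q z) * indicator (UNIV \<inter> S m) z + ennreal (q z) * indicator (- S m) z \<partial>P)"
          by (intro nn_integral_cong) (auto split: split_indicator)
        also have "\<dots> = (\<integral>\<^sup>+ z. ennreal (q z) * indicator (UNIV \<inter> S m) z \<partial>P) + (\<integral>\<^sup>+ z. ennreal (q z) * indicator (- S m) z \<partial>P)"
          by (intro nn_integral_add) measurable
        finally show ?thesis
          by (simp only:) (intro tendsto_add tendsto_const e_lim lim, use sets.top[of P] in simp)
      qed
      have "1 \<le> (\<integral>\<^sup>+ z. ennreal (qn n z) * indicator (UNIV \<inter> S m) z \<partial>P) + ennreal (a m) + (ennreal (b m) + ennreal (e (r n)))" for n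
      proof -
        have XY: "UNIV - X m \<in> sets \<mu>" "UNIV - Y m \<in> sets \<nu>"
          using sets.compl_sets[OF X_sets[of m]] sets.compl_sets[OF Y_sets[of m]] by simp_all
        have [measurable]: "(\<lambda>z. indicator (UNIV - X m) (fst z) :: ennreal) \<in> borel_measurable P"
          "(\<lambda>z. indicator (UNIV - Y m) (snd z) :: ennreal) \<in> borel_measurable P"
          using XY by measurable
        have "1 = (\<integral>\<^sup>+ z. ennreal (qn n z) \<partial>P)" by (simp add: qn)
        also have "\<dots> \<le> (\<integral>\<^sup>+ z. ennreal (qn n z) * indicator (UNIV \<inter> S m) z + ennreal (qn n z) * indicator (UNIV - X m) (fst z) + ennreal (qn n z) * indicator (UNIV - Y m) (snd z) \<partial>P)"
          by (intro nn_integral_mono) (auto simp: S_def split: split_indicator)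
        also have "\<dots> = (\<integral>\<^sup>+ z. ennreal (qn n z) * indicator (UNIV \<inter> S m) z \<partial>P) + (\<integral>\<^sup>+ z. ennreal (qn n z) * indicator (UNIV - X m) (fst z) \<partial>P) + (\<integral>\<^sup>+ z. ennreal (qn n z) * indicator (UNIV - Y m) (snd z) \<partial>P)"
          by (simp add: nn_integral_add)
        also have "\<dots> \<le> (\<integral>\<^sup>+ z. ennreal (qn n z) * indicator (UNIV \<inter> S m) z \<partial>P) + emeasure \<mu> (UNIV - X m) + (emeasure \<nu> (UNIV - Y m) + ennreal (e (r n)))"
          by (intro add_mono order_refl qn XY)
        also have "UNIV - X m = {x \<in> space \<mu>. A x < 1 / Suc m}" by (auto simp: X_def)
        also have "UNIV - Y m = {y \<in> space \<nu>. B y < 1 / Suc m}" by (auto simp: Y_def)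
        finally show ?thesis
          unfolding \<mu>.emeasure_eq_measure \<nu>.emeasure_eq_measure a_def[symmetric] b_def[symmetric] .
      qed
      moreover have "s + t + w \<le> s + s' + t + w" for s s' t w :: ennreal
        by (simp add: add.assoc add_left_mono)
      ultimately show "\<exists>N. \<forall>n\<ge>N. 1 \<le> (\<integral>\<^sup>+ z. ennreal (qn n z) * indicator (UNIV \<inter> S m) z \<partial>P) + (\<integral>\<^sup>+ z. ennreal (q z) * indicator (- S m) z \<partial>P) + ennreal (a m) + (ennreal (b m) + ennreal (e (r n)))"
        by (intro exI[of _ 0] allI impI) (rule order_trans)
    qed
    have "(\<lambda>m. (\<integral>\<^sup>+ z. ennreal (q z) \<partial>P) + ennreal (a m) + (ennreal (b m) + 0)) \<longlonglongrightarrow> (\<integral>\<^sup>+ z. ennreal (q z) \<partial>P) + ennreal 0 + (ennreal 0 + 0)"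
      by (intro tendsto_intros a_lim b_lim)
    then show "1 \<le> (\<integral>\<^sup>+ z. ennreal (q z) \<partial>P)"
      using LIMSEQ_le_const[of _ _ 1] le by fastforce
  qed
  define \<pi> where "\<pi> = density P q"
  have em: "emeasure \<pi> H = (\<integral>\<^sup>+ z. ennreal (q z) * indicator H z \<partial>P)" if "H \<in> sets P" for H
    unfolding \<pi>_def using that by (intro emeasure_density) auto
  have sets_\<pi>: "sets \<pi> = sets P" "space \<pi> = UNIV" by (simp_all add: \<pi>_def)
  have prob_\<pi>: "prob_space \<pi>"
    using total em[of UNIV] sets.top[of P] by (intro prob_spaceI) (simp add: sets_\<pi>)
  interpret \<pi>: prob_space \<pi> by fact
  have ms: "fst \<in> \<pi> \<rightarrow>\<^sub>M \<mu>" "snd \<in> \<pi> \<rightarrow>\<^sub>M \<nu>" using fst_snd by (simp_all add: \<pi>_def)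
  have fst_\<pi>: "distr \<pi> \<mu> fst = \<mu>"
  proof (rule prob_space_eqI_le[OF \<open>prob_space \<mu>\<close>])
    show "prob_space (distr \<pi> \<mu> fst)" by (rule \<pi>.prob_space_distr[OF ms(1)])
    show "emeasure (distr \<pi> \<mu> fst) E \<le> emeasure \<mu> E" if "E \<in> sets \<mu>" for E
      using marg1[OF that] measurable_sets[OF fst_snd(1) that] that by (simp add: emeasure_distr[OF ms(1)] sets_\<pi> em)
  qed simp
  have snd_\<pi>: "distr \<pi> \<nu> snd = \<nu>"
  proof (rule prob_space_eqI_le[OF \<open>prob_space \<nu>\<close>])
    show "prob_space (distr \<pi> \<nu> snd)" by (rule \<pi>.prob_space_distr[OF ms(2)])
    show "emeasure (distr \<pi> \<nu> snd) F \<le> emeasure \<nu> F" if "F \<in> sets \<nu>" for F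
      using marg2[OF that] measurable_sets[OF fst_snd(2) that] that by (simp add: emeasure_distr[OF ms(2)] sets_\<pi> em)
  qed simp
  have "distr \<pi> borel fst = distr \<pi> \<mu> fst" "distr \<pi> borel snd = distr \<pi> \<nu> snd"
    by (rule distr_cong; simp add: sets_cong)+
  then have "\<pi> \<in> couplings \<mu> \<nu>"
    unfolding couplings_def prob_measures_def using prob_\<pi> fst_\<pi> snd_\<pi> sets_P sets_\<pi>(1) by simp
  have u_pos: "AE x in \<mu>. 0 < u x"
  proof -
    have U: "{x \<in> space \<mu>. u x = 0} \<in> sets \<mu>" by measurable
    have "emeasure \<mu> {x \<in> space \<mu>. u x = 0} = emeasure (distr \<pi> \<mu> fst) {x \<in> space \<mu>. u x = 0}" by (simp only: fst_\<pi>)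
    also have "\<dots> = (\<integral>\<^sup>+ z. ennreal (q z) * indicator (fst -` {x. u x = 0}) z \<partial>P)"
      using U measurable_sets[OF fst_snd(1) U] by (simp add: emeasure_distr[OF ms(1)] sets_\<pi> em)
    also have "\<dots> = (\<integral>\<^sup>+ z. 0 \<partial>P)" by (intro nn_integral_cong) (auto simp: q_def split: split_indicator)
    finally have "AE x in \<mu>. \<not> u x = 0" using U by (subst AE_iff_measurable[OF U]) auto
    then show ?thesis by eventually_elim (use u in \<open>auto simp: less_le\<close>)
  qed
  have v_pos: "AE y in \<nu>. 0 < v y"
  proof -
    have U: "{y \<in> space \<nu>. v y = 0} \<in> sets \<nu>" by measurable
    have "emeasure \<nu> {y \<in> space \<nu>. v y = 0} = emeasure (distr \<pi> \<nu> snd) {y \<in> space \<nu>. v y = 0}" by (simp only: snd_\<pi>)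
    also have "\<dots> = (\<integral>\<^sup>+ z. ennreal (q z) * indicator (snd -` {y. v y = 0}) z \<partial>P)"
      using U measurable_sets[OF fst_snd(2) U] by (simp add: emeasure_distr[OF ms(2)] sets_\<pi> em)
    also have "\<dots> = (\<integral>\<^sup>+ z. 0 \<partial>P)" by (intro nn_integral_cong) (auto simp: q_def split: split_indicator)
    finally have "AE y in \<nu>. \<not> v y = 0" using U by (subst AE_iff_measurable[OF U]) auto
    then show ?thesis by eventually_elim (use v in \<open>auto simp: less_le\<close>)
  qed
  \<comment> \<open>The value 1 on the exceptional null sets makes the factors positive everywhere.\<close>
  define \<phi> where "\<phi> x = (if 0 < u x \<and> 0 < A x then u x / A x else 1)" for x
  define \<psi> where "\<psi> y = (if 0 < v y \<and> 0 < B y then v y / B y else 1)" for y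
  have [measurable]: "\<phi> \<in> borel_measurable \<mu>" "\<psi> \<in> borel_measurable \<nu>"
    unfolding \<phi>_def \<psi>_def by measurable
  have "AE z in P. ennreal (\<phi> (fst z) * \<psi> (snd z) * K z) = ennreal (q z)"
    unfolding P_def
  proof (rule AE_pair_measure)
    have "{z \<in> space P. ennreal (\<phi> (fst z) * \<psi> (snd z) * K z) = ennreal (q z)} \<in> sets P" by measurable
    then show "{z \<in> space (\<mu> \<Otimes>\<^sub>M \<nu>). ennreal (\<phi> (fst z) * \<psi> (snd z) * K z) = ennreal (q z)} \<in> sets (\<mu> \<Otimes>\<^sub>M \<nu>)" by (simp add: P_def)
    show "AE x in \<mu>. AE y in \<nu>. ennreal (\<phi> (fst (x, y)) * \<psi> (snd (x, y)) * K (x, y)) = ennreal (q (x, y))"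
      using u_pos A(3)
    proof eventually_elim
      case (elim x)
      show ?case using v_pos B(3)
        by eventually_elim (use elim in \<open>simp add: \<phi>_def \<psi>_def q_def L_def\<close>)
    qed
  qed
  then have "density P (\<lambda>z. ennreal (\<phi> (fst z) * \<psi> (snd z) * K z)) = \<pi>"
    unfolding \<pi>_def by (intro density_cong) auto
  with \<open>\<pi> \<in> couplings \<mu> \<nu>\<close> have "density P (\<lambda>z. ennreal (\<phi> (fst z) * \<psi> (snd z) * K z)) \<in> couplings \<mu> \<nu>" by simp
  then show ?thesis
    unfolding P_def by (intro that[of \<phi> \<psi>]) (auto simp: \<phi>_def \<psi>_def)
qed

section \<open>The theorem\<close>

theorem theorem1p3:
  fixes c :: "'a::polish_space \<times> 'b::polish_space \<Rightarrow> real"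
    and \<epsilon> :: real
    and \<mu> :: "'a measure"
    and \<nu> :: "'b measure"
  assumes diff_X: "differentiation_of_measures (dist :: 'a \<Rightarrow> 'a \<Rightarrow> real)"
    and diff_XY: "differentiation_of_measures (max_dist :: 'a \<times> 'b \<Rightarrow> 'a \<times> 'b \<Rightarrow> real)"
    and c_cont: "continuous_on UNIV c"
    and c_nonneg: "\<And>z. 0 \<le> c z"
    and eps_pos: "0 < \<epsilon>"
    and mu: "\<mu> \<in> prob_measures"
    and nu: "\<nu> \<in> prob_measures"
  shows "(\<exists>!\<pi>. \<pi> \<in> couplings \<mu> \<nu> \<and> cyclically_invariant c \<epsilon> \<mu> \<nu> \<pi>) \<and>
    (\<bar>eot_value c \<epsilon> \<mu> \<nu>\<bar> \<noteq> \<infinity> \<longrightarrow>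
      (\<forall>\<pi>. \<pi> \<in> couplings \<mu> \<nu> \<and> cyclically_invariant c \<epsilon> \<mu> \<nu> \<pi> \<longrightarrow>
        eot_minimizer c \<epsilon> \<mu> \<nu> \<pi> \<and>
        (\<forall>\<pi>'. eot_minimizer c \<epsilon> \<mu> \<nu> \<pi>' \<longrightarrow> \<pi>' = \<pi>)))"
proof -
  have sets_cong: "sets \<mu> = sets borel" "sets \<nu> = sets borel" and prob: "prob_space \<mu>" "prob_space \<nu>"
    using mu nu by (auto simp: prob_measures_def)
  have sets_P: "sets (\<mu> \<Otimes>\<^sub>M \<nu>) = sets (borel :: ('a \<times> 'b) measure)"
    by (simp only: sets_pair_measure_cong[OF sets_cong] borel_prod)
  have c_borel: "c \<in> borel_measurable borel" by (intro borel_measurable_continuous_onI c_cont)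
  have c_meas: "c \<in> borel_measurable (\<mu> \<Otimes>\<^sub>M \<nu>)"
    using c_borel by (simp add: measurable_cong_sets[OF sets_P refl])
  define K where "K z = exp (- c z / \<epsilon>)" for z
  have K: "0 < K z" "K z \<le> 1" for z using c_nonneg[of z] eps_pos by (simp_all add: K_def)
  have K_cont: "continuous_on UNIV K" unfolding K_def using eps_pos by (intro continuous_intros c_cont) simp
  have K_meas: "K \<in> borel_measurable (\<mu> \<Otimes>\<^sub>M \<nu>)" unfolding K_def using c_meas by measurable
  note iff = cyclically_invariant_iff_product_form[OF sets_cong c_borel, of \<epsilon>]
  have ex: "\<exists>\<pi>. \<pi> \<in> couplings \<mu> \<nu> \<and> cyclically_invariant c \<epsilon> \<mu> \<nu> \<pi>"
  proof (rule product_form_coupling_exists[OF prob sets_cong K_cont K])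
    fix \<phi> \<psi>
    assume "\<phi> \<in> borel_measurable \<mu>" "\<psi> \<in> borel_measurable \<nu>" "\<And>x. 0 < \<phi> x" "\<And>y. 0 < \<psi> y"
      "density (\<mu> \<Otimes>\<^sub>M \<nu>) (\<lambda>z. ennreal (\<phi> (fst z) * \<psi> (snd z) * K z)) \<in> couplings \<mu> \<nu>"
    then show ?thesis unfolding iff K_def by blast
  qed
  have unique: "\<pi> = \<pi>'"
    if "\<pi> \<in> couplings \<mu> \<nu>" "cyclically_invariant c \<epsilon> \<mu> \<nu> \<pi>" "\<pi>' \<in> couplings \<mu> \<nu>" "cyclically_invariant c \<epsilon> \<mu> \<nu> \<pi>'" for \<pi> \<pi>'
  proof -
    from that(2) obtain \<phi> \<psi> where f: "\<phi> \<in> borel_measurable \<mu>" "\<psi> \<in> borel_measurable \<nu>" "\<forall>x. 0 < \<phi> x" "\<forall>y. 0 < \<psi> y"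
      "density (\<mu> \<Otimes>\<^sub>M \<nu>) (\<lambda>z. ennreal (\<phi> (fst z) * \<psi> (snd z) * K z)) = \<pi>"
      unfolding iff K_def by blast
    from that(4) obtain \<phi>' \<psi>' where g: "\<phi>' \<in> borel_measurable \<mu>" "\<psi>' \<in> borel_measurable \<nu>" "\<forall>x. 0 < \<phi>' x" "\<forall>y. 0 < \<psi>' y"
      "density (\<mu> \<Otimes>\<^sub>M \<nu>) (\<lambda>z. ennreal (\<phi>' (fst z) * \<psi>' (snd z) * K z)) = \<pi>'"
      unfolding iff K_def by blast
    show ?thesis
      using product_form_coupling_unique[OF sets_cong f(1,2) g(1,2) K_meas f(3,4)[rule_format] g(3,4)[rule_format] K(1), unfolded f(5) g(5)]
        that(1,3) by simp
  qed
  have optimal: "eot_cost c \<epsilon> \<mu> \<nu> \<pi> \<le> eot_cost c \<epsilon> \<mu> \<nu> \<pi>'"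
    and strict: "eot_cost c \<epsilon> \<mu> \<nu> \<pi>' \<le> eot_cost c \<epsilon> \<mu> \<nu> \<pi> \<Longrightarrow> \<pi>' = \<pi>"
    if \<pi>: "\<pi> \<in> couplings \<mu> \<nu>" "cyclically_invariant c \<epsilon> \<mu> \<nu> \<pi>" and \<pi>': "\<pi>' \<in> couplings \<mu> \<nu>" "eot_cost c \<epsilon> \<mu> \<nu> \<pi>' < \<infinity>" for \<pi> \<pi>'
  proof -
    from \<pi>(2) obtain \<phi> \<psi> where f: "\<phi> \<in> borel_measurable \<mu>" "\<psi> \<in> borel_measurable \<nu>" "\<forall>x. 0 < \<phi> x" "\<forall>y. 0 < \<psi> y"
      "density (\<mu> \<Otimes>\<^sub>M \<nu>) (\<lambda>z. ennreal (\<phi> (fst z) * \<psi> (snd z) * exp (- c z / \<epsilon>))) = \<pi>"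
      unfolding iff by blast
    note opt = product_form_coupling_optimal[OF prob sets_cong f(1,2) c_meas f(3,4)[rule_format] c_nonneg eps_pos f(5) \<pi>(1) \<pi>']
    show "eot_cost c \<epsilon> \<mu> \<nu> \<pi> \<le> eot_cost c \<epsilon> \<mu> \<nu> \<pi>'" by (rule opt(1))
    show "eot_cost c \<epsilon> \<mu> \<nu> \<pi>' \<le> eot_cost c \<epsilon> \<mu> \<nu> \<pi> \<Longrightarrow> \<pi>' = \<pi>" by (rule opt(2))
  qed
  show ?thesis
  proof (intro conjI impI allI)
    show "\<exists>!\<pi>. \<pi> \<in> couplings \<mu> \<nu> \<and> cyclically_invariant c \<epsilon> \<mu> \<nu> \<pi>"
      using ex unique by blast
    fix \<pi>
    assume "\<bar>eot_value c \<epsilon> \<mu> \<nu>\<bar> \<noteq> \<infinity>" and "\<pi> \<in> couplings \<mu> \<nu> \<and> cyclically_invariant c \<epsilon> \<mu> \<nu> \<pi>"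
    then have fin: "eot_value c \<epsilon> \<mu> \<nu> < \<infinity>" and \<pi>: "\<pi> \<in> couplings \<mu> \<nu>" "cyclically_invariant c \<epsilon> \<mu> \<nu> \<pi>"
      by (auto simp: less_ereal.simps)
    have "eot_cost c \<epsilon> \<mu> \<nu> \<pi> \<le> eot_value c \<epsilon> \<mu> \<nu>"
      unfolding eot_value_def
    proof (rule INF_greatest)
      fix \<pi>' assume "\<pi>' \<in> couplings \<mu> \<nu>"
      then show "eot_cost c \<epsilon> \<mu> \<nu> \<pi> \<le> eot_cost c \<epsilon> \<mu> \<nu> \<pi>'"
        using optimal[OF \<pi>] by (cases "eot_cost c \<epsilon> \<mu> \<nu> \<pi>' < \<infinity>") auto
    qed
    moreover have "eot_value c \<epsilon> \<mu> \<nu> \<le> eot_cost c \<epsilon> \<mu> \<nu> \<pi>"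
      unfolding eot_value_def by (intro INF_lower \<pi>)
    ultimately have eq: "eot_cost c \<epsilon> \<mu> \<nu> \<pi> = eot_value c \<epsilon> \<mu> \<nu>" by (rule antisym)
    with \<pi>(1) show "eot_minimizer c \<epsilon> \<mu> \<nu> \<pi>" by (simp add: eot_minimizer_def)
    fix \<pi>' assume "eot_minimizer c \<epsilon> \<mu> \<nu> \<pi>'"
    then have "\<pi>' \<in> couplings \<mu> \<nu>" "eot_cost c \<epsilon> \<mu> \<nu> \<pi>' = eot_value c \<epsilon> \<mu> \<nu>"
      by (simp_all add: eot_minimizer_def)
    with strict[OF \<pi>, of \<pi>'] fin eq show "\<pi>' = \<pi>" by simp
  qed
qed

end
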